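(* Let $\mathbb{F}$ be an algebraically closed field, let $G(\lambda)\in\mathbb{F}(\lambda)^{p\times m}$ with $\operatorname{rank}G(\lambda)=r$ and let $$P(\lambda)=\begin{bmatrix}A(\lambda)&B(\lambda)\\-C(\lambda)&D(\lambda)\end{bmatrix}\in\mathbb{F}[\lambda]^{(n+p)\times(n+m)}$$ be a polynomial system matrix of degree $d$, with state matrix $A(\lambda)\in\mathbb{F}[\lambda]^{n\times n}$, which is minimal at $\infty$ and whose transfer function matrix is $G(\lambda)$. Let $e_1\le\cdots\le e_s$ be the partial multiplicities of $\operatorname{rev}_dA(\lambda)$ at $0$ and let $\widetilde e_1\le\cdots\le\widetilde e_u$ be the partial multiplicities of $\operatorname{rev}P(\lambda)$ at $0$. Then the invariant orders at infinity $q_1\le q_2\le\cdots\le q_r$ of $G(\lambda)$ are $$(q_1,q_2,\ldots,q_r)=(-e_s,-e_{s-1},\ldots,-e_1,\underbrace{0,\ldots,0}_{r-s-u},\widetilde e_1,\widetilde e_2,\ldots,\widetilde e_u)-(d,d,\ldots,d).$$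
   Context: $\operatorname{rank}G(\lambda)$ is the normal rank (rank over $\mathbb{F}(\lambda)$). For a rational matrix $G(\lambda)$ and an integer $g$, $\operatorname{rev}_gG(\lambda):=\lambda^gG(1/\lambda)$. For a polynomial matrix $P(\lambda)$ of degree $d$ (largest exponent of $\lambda$ with nonzero matrix coefficient; $d=0$ for the zero matrix), $\operatorname{rev}P(\lambda):=\operatorname{rev}_dP(\lambda)$. A square rational matrix is regular at $\lambda_0\in\mathbb{F}$ if none of its entries has a pole at $\lambda_0$ and its determinant is nonzero at $\lambda_0$. Every rational matrix $G$ of normal rank $r$ can be written $G=R_1\,\mathrm{diag}\left((\lambda-\lambda_0)^{\nu_1},\ldots,(\lambda-\lambda_0)^{\nu_r},0_{(p-r)\times(m-r)}\right)R_2$ with $R_1,R_2$ rational and regular at $\lambda_0$, and with unique integers $\nu_1\le\cdots\le\nu_r$ (invariant orders at $\lambda_0$). For a polynomial matrix these are nonnegative and the nonzero ones are called its partial multiplicities at $\lambda_0$. A biproper matrix is a square matrix of proper rational functions whose inverse is also proper (a rational function is proper if the degree of its numerator is at most that of its denominator). Every rational matrix $G$ of normal rank $r$ can be written $G=B_1\,\mathrm{diag}(\lambda^{-q_1},\ldots,\lambda^{-q_r},0_{(p-r)\times(m-r)})B_2$ with $B_1,B_2$ biproper and unique integers $q_1\le\cdots\le q_r$, called the invariant orders at infinity of $G$. A polynomial system matrix is a polynomial matrix partitioned as $P(\lambda)=\begin{bmatrix}A&B\\-C&D\end{bmatrix}$ with $A(\lambda)$ an $n\times n$ polynomial matrix with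 $\det A(\lambda)\not\equiv0$ (if $n>0$); $A$ is its state matrix and $D+CA^{-1}B$ its transfer function matrix; if $n=0$ the blocks $A,B,C$ are empty and $P=G=D$. For $n>0$, $P$ is minimal at $\lambda_0\in\mathbb{F}$ if $\operatorname{rank}\begin{bmatrix}A(\lambda_0)\\C(\lambda_0)\end{bmatrix}=\operatorname{rank}\begin{bmatrix}A(\lambda_0)&B(\lambda_0)\end{bmatrix}=n$; if $n=0$, $P$ is by convention minimal at every point of $\mathbb{F}$. If $d=\deg P$, then $\operatorname{rev}P=\begin{bmatrix}\operatorname{rev}_dA&\operatorname{rev}_dB\\-\operatorname{rev}_dC&\operatorname{rev}_dD\end{bmatrix}$ is also a polynomial system matrix (with state matrix $\operatorname{rev}_dA$), and $P$ is said to be minimal at $\infty$ if $\operatorname{rev}P$ is minimal at $0$. *)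

theory Defs
  imports
    "HOL-Computational_Algebra.Polynomial_Factorial"
    "Jordan_Normal_Form.Gauss_Jordan_Elimination"
    "Jordan_Normal_Form.Determinant"
    "Jordan_Normal_Form.DL_Rank"
begin

section \<open>Polynomial and rational matrices\<close>

text \<open>Rational functions over a field are elements of the fraction field of its polynomial ring.\<close>

type_synonym 'a rat_fun = "'a poly fract"

abbreviation rat_mat :: "'a::field poly mat \<Rightarrow> 'a rat_fun mat" where
  "rat_mat \<equiv> map_mat to_fract"

definition mat_rank :: "'a::field mat \<Rightarrow> nat" where
  "mat_rank M = vec_space.rank (dim_row M) M"

text \<open>For rational matrices, whose entries lie in the field \<open>'a poly fract\<close>, this is the
  normal rank.\<close>

definition eval_mat :: "'a::field poly mat \<Rightarrow> 'a \<Rightarrow> 'a mat" where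
  "eval_mat P x = map_mat (\<lambda>p. poly p x) P"

definition mat_degree :: "'a::field poly mat \<Rightarrow> nat" where
  "mat_degree P =
     Max (insert 0 {k. map_mat (\<lambda>p. coeff p k) P \<noteq> 0\<^sub>m (dim_row P) (dim_col P)})"

text \<open>The insertion of 0 gives the zero matrix, and any matrix without entries, degree 0.\<close>

text \<open>Reversal with respect to \<open>g\<close>, \<open>\<lambda>^g p(1/\<lambda>)\<close>, as a polynomial. It is meaningful only for
  polynomials of degree at most \<open>g\<close>; lemma \<open>to_fract_rev_poly\<close> below is the defining formula.\<close>

definition rev_poly :: "nat \<Rightarrow> 'a::field poly \<Rightarrow> 'a poly" where
  "rev_poly g p = (\<Sum>k\<le>g. monom (coeff p k) (g - k))"

definition rev_mat :: "nat \<Rightarrow> 'a::field poly mat \<Rightarrow> 'a poly mat" where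
  "rev_mat g P = map_mat (rev_poly g) P"

abbreviation rat_var :: "'a::field rat_fun" where
  "rat_var \<equiv> to_fract [:0, 1:]"

lemma to_fract_monom:
  "to_fract (monom (c::'a::field) k) = to_fract [:c:] * rat_var ^ k"
proof (induction k)
  case 0
  then show ?case by (simp add: monom_0)
next
  case (Suc k)
  have "monom c (Suc k) = [:0, 1:] * monom c k"
    by (simp add: monom_Suc)
  then have "to_fract (monom c (Suc k)) = rat_var * to_fract (monom c k)"
    by (simp only: to_fract_mult)
  then show ?case using Suc by (simp add: mult_ac)
qed

lemma to_fract_rev_poly:
  fixes p :: "'a::field poly"
  assumes "degree p \<le> g"
  shows "to_fract (rev_poly g p) =
    rat_var ^ g * poly (map_poly (\<lambda>c. to_fract [:c:]) p) (1 / rat_var)"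
proof -
  have var: "(rat_var :: 'a rat_fun) \<noteq> 0" by simp
  have deg: "degree (map_poly (\<lambda>c. to_fract [:c:]) p) = degree p"
    by (rule degree_map_poly) simp
  have cf: "coeff (map_poly (\<lambda>c. to_fract [:c:]) p) k = to_fract [:coeff p k:]" for k
    by (simp add: coeff_map_poly)
  have sum_hom: "to_fract (\<Sum>k\<in>I. f k) = (\<Sum>k\<in>I. to_fract (f k))"
    for f :: "nat \<Rightarrow> 'a poly" and I
    by (induction I rule: infinite_finite_induct) auto
  have "rat_var ^ g * poly (map_poly (\<lambda>c. to_fract [:c:]) p) (1 / rat_var)
      = rat_var ^ g * (\<Sum>k\<le>degree p. to_fract [:coeff p k:] * (1 / rat_var) ^ k)"
    by (simp add: poly_altdef deg cf)
  also have "(\<Sum>k\<le>degree p. to_fract [:coeff p k:] * (1 / rat_var) ^ k)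
      = (\<Sum>k\<le>g. to_fract [:coeff p k:] * (1 / rat_var) ^ k)"
    by (rule sum.mono_neutral_left) (use assms in \<open>auto simp: coeff_eq_0\<close>)
  also have "rat_var ^ g * \<dots> = (\<Sum>k\<le>g. to_fract [:coeff p k:] * rat_var ^ (g - k))"
    unfolding sum_distrib_left
    by (rule sum.cong) (use var in \<open>auto simp: power_diff power_divide field_simps\<close>)
  also have "\<dots> = to_fract (rev_poly g p)"
    unfolding rev_poly_def sum_hom by (simp add: to_fract_monom)
  finally show ?thesis by simp
qed

text \<open>The \<open>nr \<times> nc\<close> matrix with the entries of \<open>ds\<close> on the leading diagonal positions and zeros
  elsewhere.\<close>

definition rect_diag :: "nat \<Rightarrow> nat \<Rightarrow> 'a::zero list \<Rightarrow> 'a mat" where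
  "rect_diag nr nc ds = mat nr nc (\<lambda>(i, j). if i = j \<and> i < length ds then ds ! i else 0)"


section \<open>Invariant orders at a finite point\<close>

text \<open>\<open>takes_value_at f x v\<close>: the rational function \<open>f\<close> has no pole at \<open>x\<close>, and its value
  there is \<open>v\<close>.\<close>

definition takes_value_at :: "'a::field rat_fun \<Rightarrow> 'a \<Rightarrow> 'a \<Rightarrow> bool" where
  "takes_value_at f x v \<longleftrightarrow>
     (\<exists>a b. f = Fract a b \<and> poly b x \<noteq> 0 \<and> v = poly a x / poly b x)"

definition has_pole_at :: "'a::field rat_fun \<Rightarrow> 'a \<Rightarrow> bool" where
  "has_pole_at f x \<longleftrightarrow> (\<nexists>v. takes_value_at f x v)"

definition regular_at :: "'a::field rat_fun mat \<Rightarrow> 'a \<Rightarrow> bool" where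
  "regular_at R x \<longleftrightarrow> square_mat R \<and> (\<forall>f\<in>elements_mat R. \<not> has_pole_at f x) \<and>
     (\<exists>v. v \<noteq> 0 \<and> takes_value_at (det R) x v)"

definition invariant_orders_at :: "'a::field rat_fun mat \<Rightarrow> 'a \<Rightarrow> int list \<Rightarrow> bool" where
  "invariant_orders_at G x nus \<longleftrightarrow>
     sorted nus \<and> length nus = mat_rank G \<and>
     (\<exists>R\<^sub>1\<in>carrier_mat (dim_row G) (dim_row G). \<exists>R\<^sub>2\<in>carrier_mat (dim_col G) (dim_col G).
        regular_at R\<^sub>1 x \<and> regular_at R\<^sub>2 x \<and>
        G = R\<^sub>1 * rect_diag (dim_row G) (dim_col G) (map (\<lambda>nu. to_fract [:- x, 1:] powi nu) nus)
              * R\<^sub>2)"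

definition partial_multiplicities_at :: "'a::field poly mat \<Rightarrow> 'a \<Rightarrow> int list \<Rightarrow> bool" where
  "partial_multiplicities_at P x es \<longleftrightarrow>
     (\<exists>nus. invariant_orders_at (rat_mat P) x nus \<and> es = filter (\<lambda>nu. nu \<noteq> 0) nus)"


section \<open>Invariant orders at infinity\<close>

definition proper :: "'a::field rat_fun \<Rightarrow> bool" where
  "proper f \<longleftrightarrow> (\<exists>a b. f = Fract a b \<and> b \<noteq> 0 \<and> degree a \<le> degree b)"

definition biproper :: "'a::field rat_fun mat \<Rightarrow> bool" where
  "biproper M \<longleftrightarrow> square_mat M \<and> (\<forall>f\<in>elements_mat M. proper f) \<and>
     (\<exists>N\<in>carrier_mat (dim_row M) (dim_row M).
        inverts_mat M N \<and> inverts_mat N M \<and> (\<forall>f\<in>elements_mat N. proper f))"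

definition invariant_orders_at_infinity :: "'a::field rat_fun mat \<Rightarrow> int list \<Rightarrow> bool" where
  "invariant_orders_at_infinity G qs \<longleftrightarrow>
     sorted qs \<and> length qs = mat_rank G \<and>
     (\<exists>B\<^sub>1\<in>carrier_mat (dim_row G) (dim_row G). \<exists>B\<^sub>2\<in>carrier_mat (dim_col G) (dim_col G).
        biproper B\<^sub>1 \<and> biproper B\<^sub>2 \<and>
        G = B\<^sub>1 * rect_diag (dim_row G) (dim_col G) (map (\<lambda>q. rat_var powi (- q)) qs) * B\<^sub>2)"


section \<open>Polynomial system matrices\<close>

text \<open>The four blocks are kept as separate arguments, since the partition is part of the data. The
  lower left block of the system matrix is \<open>- C\<close>. The state matrix may be empty, in which case the
  determinant condition holds because \<open>det A = 1\<close>.\<close>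

definition system_matrix_blocks ::
  "nat \<Rightarrow> nat \<Rightarrow> nat \<Rightarrow> 'a::field poly mat \<Rightarrow> 'a poly mat \<Rightarrow> 'a poly mat \<Rightarrow> 'a poly mat \<Rightarrow> bool"
where
  "system_matrix_blocks n p m A B C D \<longleftrightarrow>
     A \<in> carrier_mat n n \<and> B \<in> carrier_mat n m \<and> C \<in> carrier_mat p n \<and> D \<in> carrier_mat p m \<and>
     det A \<noteq> 0"

definition system_matrix ::
  "'a::field poly mat \<Rightarrow> 'a poly mat \<Rightarrow> 'a poly mat \<Rightarrow> 'a poly mat \<Rightarrow> 'a poly mat" where
  "system_matrix A B C D = four_block_mat A B (- C) D"

definition transfer_function ::
  "'a::field poly mat \<Rightarrow> 'a poly mat \<Rightarrow> 'a poly mat \<Rightarrow> 'a poly mat \<Rightarrow> 'a rat_fun mat" where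
  "transfer_function A B C D =
     rat_mat D + rat_mat C * the (mat_inverse (rat_mat A)) * rat_mat B"

text \<open>\<open>D\<close> plays no role in minimality. Adjoining a block with no rows puts \<open>A\<close> and \<open>B\<close> side by
  side.\<close>

definition minimal_at ::
  "'a::field poly mat \<Rightarrow> 'a poly mat \<Rightarrow> 'a poly mat \<Rightarrow> 'a \<Rightarrow> bool" where
  "minimal_at A B C x \<longleftrightarrow>
     dim_row A = 0 \<or>
     (mat_rank (eval_mat A x @\<^sub>r eval_mat C x) = dim_row A \<and>
      mat_rank (four_block_mat (eval_mat A x) (eval_mat B x)
                  (0\<^sub>m 0 (dim_col A)) (0\<^sub>m 0 (dim_col B))) = dim_row A)"

definition minimal_at_infinity ::
  "'a::field poly mat \<Rightarrow> 'a poly mat \<Rightarrow> 'a poly mat \<Rightarrow> 'a poly mat \<Rightarrow> bool" where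
  "minimal_at_infinity A B C D \<longleftrightarrow>
     (let d = mat_degree (system_matrix A B C D)
      in minimal_at (rev_mat d A) (rev_mat d B) (rev_mat d C) 0)"

end

theory Submission
  imports Defs "Jordan_Normal_Form.Char_Poly"
begin

text \<open>
  The rational functions without a pole at \<open>0\<close> and the proper rational functions are discrete valuation
  rings, and \<open>\<lambda> \<mapsto> 1/\<lambda>\<close> exchanges them. If \<open>H\<close> is the transfer function of \<open>rev P\<close>, then
  \<open>G(\<lambda>) = \<lambda>\<^sup>d H(1/\<lambda>)\<close>, so the orders of \<open>G\<close> at infinity are those of \<open>H\<close> at \<open>0\<close> shifted by \<open>-d\<close>, and it
  remains to compare \<open>H\<close> with \<open>rev A\<close> and \<open>rev P\<close> at \<open>0\<close>, where the realization is minimal.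

  Write \<open>N\<^sub>k(M)\<close> for the number of orders of \<open>M\<close> that are at most \<open>k\<close>. If \<open>M = U M' V + E\<close> with \<open>U\<close>, \<open>V\<close>
  integral and \<open>E\<close> divisible by \<open>\<pi>^(k+1)\<close>, then \<open>N\<^sub>k(M) \<le> N\<^sub>k(M')\<close>: otherwise linear algebra produces a vector,
  nonzero modulo \<open>\<pi>\<close> and supported on the coordinates of \<open>M\<close> of order at most \<open>k\<close>, that \<open>M\<close> nevertheless maps
  into multiples of \<open>\<pi>^(k+1)\<close>. Minimality gives Bezout cofactors \<open>A X + B Y = 1\<close> and \<open>X' A + Y' C = 1\<close>, hence
  \<open>A\<^sup>-\<^sup>1 = Y' H Y + E\<close> with \<open>E\<close> integral, which together with \<open>H = D + C A\<^sup>-\<^sup>1 B\<close> yields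
  \<open>N\<^sub>k(H) = N\<^sub>k(A\<^sup>-\<^sup>1)\<close> for \<open>k < 0\<close>. The same kind of argument, applied to the system matrix \<open>P\<close> itself, yields
  \<open>N\<^sub>k(P) = n + N\<^sub>k(H)\<close> for \<open>k \<ge> 0\<close>. These numbers determine the sorted list of orders of \<open>H\<close>.
\<close>

section \<open>Matrices over a discrete valuation ring\<close>

text \<open>Over the field, \<open>P\<close> splits into the blocks \<open>A\<close> and
  \<open>H\<close>, but the eliminating factors A^-1 B and C A^-1 need not be integral. This is why
  counts that tolerate errors replace an explicit normal form of \<open>P\<close>. The two ranges of
  k come from the size of the tolerated error. For k < 0 the exponent k + 1 is at most 0, so every
  integral matrix is a tolerated error and two formulas that differ by \<open>D\<close> or
  \<open>E\<close> can still be compared. For k >= 0 integral errors are visible, and vectors (x, y)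
  are followed through \<open>P\<close> instead; the summand n is the number of equations A x + B y
  = 0, or dually the number of free state coordinates. For large k the same identity reads rank P =
  n + rank H, and this fixes how many orders of \<open>H\<close> are zero. Minimality is a rank
  condition on values in the constant field. It yields cofactors over the local ring because every
  element of that ring is congruent to a constant modulo the uniformizer.\<close>

text \<open>Variants of the library's matrix laws whose side conditions only involve dimensions, so that the
  simplifier can discharge them without instantiation.\<close>

lemma assoc_mult_mat_dim:
  fixes A :: "'a::semiring_0 mat"
  shows "dim_col A = dim_row B \<Longrightarrow> dim_col B = dim_row C \<Longrightarrow> (A * B) * C = A * (B * C)"
  by (rule assoc_mult_mat[of _ "dim_row A" "dim_col A" _ "dim_col B" _ "dim_col C"];
      (rule carrier_matI)?; simp)

lemma mult_add_distrib_mat_dim: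
  fixes A :: "'a::semiring_0 mat"
  shows "dim_col A = dim_row B \<Longrightarrow> dim_row C = dim_row B \<Longrightarrow> dim_col C = dim_col B \<Longrightarrow>
    A * (B + C) = A * B + A * C"
  by (rule mult_add_distrib_mat[of _ "dim_row A" "dim_col A" _ "dim_col B"];
      (rule carrier_matI)?; simp)

lemma add_mult_distrib_mat_dim:
  fixes A :: "'a::semiring_0 mat"
  shows "dim_row A = dim_row B \<Longrightarrow> dim_col A = dim_col B \<Longrightarrow> dim_col A = dim_row C \<Longrightarrow>
    (A + B) * C = A * C + B * C"
  by (rule add_mult_distrib_mat[of _ "dim_row A" "dim_col A" _ _ "dim_col C"];
      (rule carrier_matI)?; simp)

lemma assoc_mult_mat_vec_dim:
  fixes A :: "'a::semiring_0 mat"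
  shows "dim_col A = dim_row B \<Longrightarrow> dim_col B = dim_vec v \<Longrightarrow> (A * B) *\<^sub>v v = A *\<^sub>v (B *\<^sub>v v)"
  by (rule assoc_mult_mat_vec[of _ "dim_row A" "dim_col A" _ "dim_col B"];
      (rule carrier_matI carrier_vecI)?; simp)

lemma mult_add_distrib_mat_vec_dim:
  fixes A :: "'a::comm_semiring_0 mat"
  shows "dim_col A = dim_vec v \<Longrightarrow> dim_vec w = dim_vec v \<Longrightarrow> A *\<^sub>v (v + w) = A *\<^sub>v v + A *\<^sub>v w"
  by (rule mult_add_distrib_mat_vec[of _ "dim_row A" "dim_col A"];
      (rule carrier_matI carrier_vecI)?; simp)

lemma add_mult_distrib_mat_vec_dim:
  fixes A :: "'a::comm_semiring_0 mat"
  shows "dim_row A = dim_row B \<Longrightarrow> dim_col A = dim_col B \<Longrightarrow> dim_col A = dim_vec v \<Longrightarrow>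
    (A + B) *\<^sub>v v = A *\<^sub>v v + B *\<^sub>v v"
  by (rule add_mult_distrib_mat_vec[of _ "dim_row A" "dim_col A"];
      (rule carrier_matI carrier_vecI)?; simp)

lemma mult_diff_distrib_mat_vec_dim:
  fixes A :: "'a::comm_ring_1 mat"
  shows "dim_col A = dim_vec v \<Longrightarrow> dim_vec w = dim_vec v \<Longrightarrow> A *\<^sub>v (v - w) = A *\<^sub>v v - A *\<^sub>v w"
  by (intro eq_vecI) (auto simp: scalar_prod_def sum_subtractf right_diff_distrib)

lemma left_mult_one_mat_dim: "dim_row A = n \<Longrightarrow> 1\<^sub>m n * (A :: 'a::semiring_1 mat) = A"
  by (rule left_mult_one_mat[of _ _ "dim_col A"], rule carrier_matI) simp_all

lemma right_mult_one_mat_dim: "dim_col A = n \<Longrightarrow> (A :: 'a::semiring_1 mat) * 1\<^sub>m n = A"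
  by (rule right_mult_one_mat[of _ "dim_row A"], rule carrier_matI) simp_all

text \<open>As a complete simp set this brings both sides of an identity to right-nested products
  distributed over sums; unfolding the carriers turns typing facts into the dimension equations that
  the conditional laws ask for.\<close>

lemmas mat_dim_simps = left_mult_one_mat_dim right_mult_one_mat_dim index_one_mat(2,3)
  carrier_mat_def carrier_vec_def mem_Collect_eq index_mult_mat(2,3) index_add_mat(2,3)
  index_minus_mat(2,3) dim_mult_mat_vec index_add_vec(2) index_minus_vec(2) assoc_mult_mat_dim mult_add_distrib_mat_dim
  add_mult_distrib_mat_dim assoc_mult_mat_vec_dim mult_add_distrib_mat_vec_dim
  add_mult_distrib_mat_vec_dim mult_diff_distrib_mat_vec_dim

lemma four_block_mult_vec_lower:
  fixes A :: "'a::ring mat"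
  assumes "A \<in> carrier_mat nr1 nc1" "B \<in> carrier_mat nr1 nc2" "C \<in> carrier_mat nr2 nc1"
    "D \<in> carrier_mat nr2 nc2" "x \<in> carrier_vec nc1" "y \<in> carrier_vec nc2" "i < nr2"
  shows "(four_block_mat A B C D *\<^sub>v (x @\<^sub>v y)) $ (nr1 + i) = (C *\<^sub>v x + D *\<^sub>v y) $ i"
  unfolding four_block_mat_mult_vec[OF assms(1-6)] using assms by auto

lemma mult_mat_vec_uminus:
  fixes M :: "'a::comm_ring_1 mat"
  assumes "M \<in> carrier_mat nr nc" "v \<in> carrier_vec nc"
  shows "(- M) *\<^sub>v v = - (M *\<^sub>v v)"
  using assms by (intro eq_vecI) (auto simp: scalar_prod_def sum_negf)


text \<open>Fewer than \<open>l\<close> rows, padded with zero rows, form a singular square matrix;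
  any nonzero kernel vector will do.\<close>

lemma exists_nonzero_orthogonal_vec:
  fixes R :: "'k::field vec set"
  assumes "finite R" "R \<subseteq> carrier_vec l" "card R < l"
  shows "\<exists>w\<in>carrier_vec l. w \<noteq> 0\<^sub>v l \<and> (\<forall>r\<in>R. r \<bullet> w = 0)"
proof -
  obtain rs where rs: "set rs = R" "distinct rs"
    using assms(1) finite_distinct_list by blast
  have len: "length rs < l"
    using assms(3) rs distinct_card by metis
  define M where "M = mat_of_rows l (rs @ replicate (l - length rs) (0\<^sub>v l))"
  have M: "M \<in> carrier_mat l l"
    unfolding M_def using len by (intro carrier_matI) simp_all
  have rowM: "row M i = (rs @ replicate (l - length rs) (0\<^sub>v l)) ! i" if "i < l" for i
    unfolding M_def using that len rs assms(2)
    by (intro mat_of_rows_row) (auto simp: nth_append set_conv_nth)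
  have "row M (l - 1) = 0\<^sub>v l"
    using len by (subst rowM) (auto simp: nth_append)
  then have "M\<^sup>T *\<^sub>v unit_vec l (l - 1) = 0\<^sub>v l"
    using M len by (intro eq_vecI) (auto simp: vec_eq_iff)
  moreover have "unit_vec l (l - 1) \<noteq> (0\<^sub>v l :: 'k vec)"
    using len by (intro unit_vec_nonzero) simp
  ultimately have "det M\<^sup>T = 0"
    using det_0_iff_vec_prod_zero[of "M\<^sup>T" l] M by (metis transpose_carrier_mat unit_vec_carrier)
  then have "det M = 0" using det_transpose[OF M] by simp
  then obtain w where w: "w \<in> carrier_vec l" "w \<noteq> 0\<^sub>v l" "M *\<^sub>v w = 0\<^sub>v l"
    using det_0_iff_vec_prod_zero[OF M] by blast
  have "r \<bullet> w = 0" if r: "r \<in> R" for r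
  proof -
    obtain i where i: "i < length rs" "rs ! i = r" using r rs(1) by (auto simp: set_conv_nth)
    then have "row M i = r" using len rowM[of i] by (simp add: nth_append)
    moreover have "(M *\<^sub>v w) $ i = 0" using w(3) i len by simp
    ultimately show ?thesis using M i len by simp
  qed
  then show ?thesis using w by blast
qed

text \<open>The ring is described inside its fraction field. \<open>unit_decomp\<close> makes every
  nonzero element a unit times a power of \<pi>, which is all that a valuation requires.
  \<open>inverse_pi_not_mem\<close> makes \<pi> a non-unit and also nonzero, because
  \<open>inverse 0 = 0\<close> lies in \<O>.\<close>

locale dvr =
  fixes \<O> :: "'k::field set" and \<pi> :: 'k
  assumes one_mem: "1 \<in> \<O>"
    and diff_mem: "\<lbrakk>x \<in> \<O>; y \<in> \<O>\<rbrakk> \<Longrightarrow> x - y \<in> \<O>"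
    and mult_mem: "\<lbrakk>x \<in> \<O>; y \<in> \<O>\<rbrakk> \<Longrightarrow> x * y \<in> \<O>"
    and pi_mem: "\<pi> \<in> \<O>"
    and inverse_pi_not_mem: "inverse \<pi> \<notin> \<O>"
    and unit_decomp: "x \<noteq> 0 \<Longrightarrow> \<exists>k::int. x * \<pi> powi k \<in> \<O> \<and> inverse (x * \<pi> powi k) \<in> \<O>"
begin

lemma zero_mem: "0 \<in> \<O>" using diff_mem[OF one_mem one_mem] by simp
lemma uminus_mem: "x \<in> \<O> \<Longrightarrow> - x \<in> \<O>" using diff_mem[OF zero_mem] by simp
lemma add_mem: "x \<in> \<O> \<Longrightarrow> y \<in> \<O> \<Longrightarrow> x + y \<in> \<O>" using diff_mem[OF _ uminus_mem, of x y] by simp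
lemma sum_mem: "(\<And>i. i \<in> I \<Longrightarrow> f i \<in> \<O>) \<Longrightarrow> sum f I \<in> \<O>"
  by (induction I rule: infinite_finite_induct) (auto simp: zero_mem add_mem)
lemma prod_mem: "(\<And>i. i \<in> I \<Longrightarrow> f i \<in> \<O>) \<Longrightarrow> prod f I \<in> \<O>"
  by (induction I rule: infinite_finite_induct) (auto simp: one_mem mult_mem)
lemma power_mem: "x \<in> \<O> \<Longrightarrow> x ^ k \<in> \<O>"
  by (induction k) (auto simp: one_mem mult_mem)
lemma pi_nonzero: "\<pi> \<noteq> 0" using inverse_pi_not_mem zero_mem by auto

lemma powi_add: "\<pi> powi (j + k) = \<pi> powi j * \<pi> powi k"
  by (rule power_int_add) (use pi_nonzero in auto)

lemma powi_mem_iff: "\<pi> powi k \<in> \<O> \<longleftrightarrow> 0 \<le> k"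
proof
  assume a: "\<pi> powi k \<in> \<O>"
  show "0 \<le> k"
  proof (rule ccontr)
    assume "\<not> 0 \<le> k"
    then have "inverse \<pi> = \<pi> powi k * \<pi> ^ nat (- k - 1)"
      using pi_nonzero powi_add[of k "- k - 1"]
      by (simp add: power_int_def power_int_minus split: if_splits)
    then show False using inverse_pi_not_mem mult_mem[OF a power_mem[OF pi_mem]] by simp
  qed
qed (auto simp: power_int_def power_mem pi_mem)

text \<open>\<open>vge k x\<close>: the valuation of \<open>x\<close> is at least \<open>k\<close>; this includes \<open>x = 0\<close>, where \<open>vval\<close> is a junk
  value.\<close>

definition vge :: "int \<Rightarrow> 'k \<Rightarrow> bool" where
  "vge k x \<longleftrightarrow> x * \<pi> powi (- k) \<in> \<O>"

lemma vge_0_iff: "vge 0 x \<longleftrightarrow> x \<in> \<O>" by (simp add: vge_def)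
lemma vge_zero [simp]: "vge k 0" by (simp add: vge_def zero_mem)
lemma vge_add: "vge k x \<Longrightarrow> vge k y \<Longrightarrow> vge k (x + y)"
  by (simp add: vge_def distrib_right add_mem)
lemma vge_uminus: "vge k x \<Longrightarrow> vge k (- x)"
  by (simp add: vge_def uminus_mem)
lemma vge_diff: "vge k x \<Longrightarrow> vge k y \<Longrightarrow> vge k (x - y)"
  using vge_add[OF _ vge_uminus, of k x y] by simp
lemma vge_mult: "vge j x \<Longrightarrow> vge k y \<Longrightarrow> vge (j + k) (x * y)"
  using mult_mem[of "x * \<pi> powi (- j)" "y * \<pi> powi (- k)"] powi_add[of "- j" "- k"]
  by (simp add: vge_def mult_ac)
lemma vge_sum: "(\<And>i. i \<in> I \<Longrightarrow> vge k (f i)) \<Longrightarrow> vge k (sum f I)"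
  by (induction I rule: infinite_finite_induct) (auto intro: vge_add)
lemma vge_powi_iff: "vge k (\<pi> powi j) \<longleftrightarrow> k \<le> j"
  unfolding vge_def powi_add[symmetric] powi_mem_iff by simp
lemma vge_mono: assumes "vge k x" "j \<le> k" shows "vge j x"
  using vge_mult[OF assms(1), of "j - k" 1] assms(2) vge_powi_iff[of "j - k" 0] by simp
lemma vge_1_one: "\<not> vge 1 1" using vge_powi_iff[of 1 0] by simp
lemma vge_powi_mult_iff: "vge k (\<pi> powi j * x) \<longleftrightarrow> vge (k - j) x"
proof
  assume "vge k (\<pi> powi j * x)"
  from vge_mult[OF this, of "- j" "\<pi> powi (- j)"] show "vge (k - j) x"
    using powi_add[of j "- j"] by (simp add: vge_powi_iff mult_ac)
next
  assume "vge (k - j) x"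
  from vge_mult[OF this, of j "\<pi> powi j"] show "vge k (\<pi> powi j * x)"
    by (simp add: vge_powi_iff mult_ac)
qed

definition vval :: "'k \<Rightarrow> int" where "vval x = (SOME k. vge k x \<and> vge (- k) (inverse x))"

lemma vval: assumes "x \<noteq> 0" shows "vge (vval x) x" "vge (- vval x) (inverse x)"
proof -
  obtain k :: int where "x * \<pi> powi k \<in> \<O>" "inverse (x * \<pi> powi k) \<in> \<O>"
    using unit_decomp[OF assms] by blast
  then have "vge (- k) x \<and> vge (- (- k)) (inverse x)"
    unfolding vge_def by (simp add: power_int_minus inverse_mult_distrib)
  then have "vge (vval x) x \<and> vge (- vval x) (inverse x)" unfolding vval_def by (rule someI)
  then show "vge (vval x) x" "vge (- vval x) (inverse x)" by auto
qed

text \<open>Multiplying by \<open>inverse x\<close>, which has valuation at least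
  \<open>- vval x\<close>, turns a bound on \<open>x\<close> into a bound on 1. The same argument
  shows that the exponent chosen in \<open>vval\<close> is unique.\<close>

lemma vge_iff: assumes "x \<noteq> 0" shows "vge k x \<longleftrightarrow> k \<le> vval x"
proof
  assume "vge k x"
  from vge_mult[OF this vval(2)[OF assms]] have "vge (k - vval x) (\<pi> powi 0)" using assms by simp
  then show "k \<le> vval x" unfolding vge_powi_iff by simp
qed (use vval[OF assms] vge_mono in blast)

section \<open>Vectors and matrices with entries of bounded valuation\<close>

definition vec_ge :: "int \<Rightarrow> 'k vec \<Rightarrow> bool" where
  "vec_ge k v \<longleftrightarrow> (\<forall>i<dim_vec v. vge k (v $ i))"

definition mat_ge :: "int \<Rightarrow> 'k mat \<Rightarrow> bool" where
  "mat_ge k M \<longleftrightarrow> (\<forall>i<dim_row M. \<forall>j<dim_col M. vge k (M $$ (i, j)))"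

lemma mat_ge_0_iff: "mat_ge 0 M \<longleftrightarrow> elements_mat M \<subseteq> \<O>"
  unfolding mat_ge_def vge_0_iff by blast

lemma vec_ge_mono: "vec_ge k v \<Longrightarrow> j \<le> k \<Longrightarrow> vec_ge j v"
  unfolding vec_ge_def using vge_mono by blast
lemma vec_ge_add: "vec_ge k v \<Longrightarrow> vec_ge k w \<Longrightarrow> v \<in> carrier_vec n \<Longrightarrow> w \<in> carrier_vec n \<Longrightarrow> vec_ge k (v + w)"
  unfolding vec_ge_def by (auto intro: vge_add)
lemma vec_ge_diff: "vec_ge k v \<Longrightarrow> vec_ge k w \<Longrightarrow> v \<in> carrier_vec n \<Longrightarrow> w \<in> carrier_vec n \<Longrightarrow> vec_ge k (v - w)"
  unfolding vec_ge_def by (auto intro: vge_diff)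
lemma mat_ge_mult_vec:
  "mat_ge j M \<Longrightarrow> vec_ge k v \<Longrightarrow> M \<in> carrier_mat nr nc \<Longrightarrow> v \<in> carrier_vec nc \<Longrightarrow> vec_ge (j + k) (M *\<^sub>v v)"
  unfolding vec_ge_def mat_ge_def by (auto simp: scalar_prod_def intro!: vge_sum vge_mult)
lemma mat_ge_mult:
  "mat_ge j M \<Longrightarrow> mat_ge k N \<Longrightarrow> M \<in> carrier_mat nr n \<Longrightarrow> N \<in> carrier_mat n nc \<Longrightarrow> mat_ge (j + k) (M * N)"
  unfolding mat_ge_def by (auto simp: scalar_prod_def intro!: vge_sum vge_mult)
lemma mat_ge_add:
  "mat_ge k M \<Longrightarrow> mat_ge k N \<Longrightarrow> M \<in> carrier_mat nr nc \<Longrightarrow> N \<in> carrier_mat nr nc \<Longrightarrow> mat_ge k (M + N)"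
  unfolding mat_ge_def by (auto intro: vge_add)
lemma mat_ge_uminus: "mat_ge k M \<Longrightarrow> mat_ge k (- M)"
  unfolding mat_ge_def by (auto intro: vge_uminus)
lemma mat_ge_one: "mat_ge 0 (1\<^sub>m n)"
  unfolding mat_ge_def by (auto simp: vge_0_iff one_mem zero_mem)
lemma mat_ge_four_block:
  "mat_ge k A \<Longrightarrow> mat_ge k B \<Longrightarrow> mat_ge k C \<Longrightarrow> mat_ge k D \<Longrightarrow>
   A \<in> carrier_mat nr1 nc1 \<Longrightarrow> B \<in> carrier_mat nr1 nc2 \<Longrightarrow> C \<in> carrier_mat nr2 nc1 \<Longrightarrow> D \<in> carrier_mat nr2 nc2 \<Longrightarrow>
   mat_ge k (four_block_mat A B C D)"
  unfolding mat_ge_def by auto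
lemma mat_ge_zero: "mat_ge k (0\<^sub>m nr nc)" unfolding mat_ge_def by auto
lemma mat_ge_transpose: "mat_ge k M\<^sup>T \<longleftrightarrow> mat_ge k M" unfolding mat_ge_def by auto
lemma vec_ge_unit: "vec_ge 0 (unit_vec n i)"
  unfolding vec_ge_def by (auto simp: unit_vec_def vge_0_iff one_mem zero_mem)

text \<open>Membership of \<open>U\<close> in GL_n(\<O>) with the inverse \<open>V\<close> as an
  explicit witness, so that equivalences can be inverted and mapped by homomorphisms without
  determinants.\<close>

definition unimodular_pair :: "nat \<Rightarrow> 'k mat \<Rightarrow> 'k mat \<Rightarrow> bool" where
  "unimodular_pair n U V \<longleftrightarrow> U \<in> carrier_mat n n \<and> V \<in> carrier_mat n n \<and>
     mat_ge 0 U \<and> mat_ge 0 V \<and> U * V = 1\<^sub>m n \<and> V * U = 1\<^sub>m n"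

lemma unimodular_pair_mult:
  assumes "unimodular_pair n U V" "unimodular_pair n U' V'"
  shows "unimodular_pair n (U * U') (V' * V)"
proof -
  have c: "U \<in> carrier_mat n n" "V \<in> carrier_mat n n" "U' \<in> carrier_mat n n" "V' \<in> carrier_mat n n"
    using assms unfolding unimodular_pair_def by blast+
  have "U * U' * (V' * V) = U * ((U' * V') * V)" "V' * V * (U * U') = V' * ((V * U) * U')"
    using c by (simp_all add: assoc_mult_mat[of _ n n _ n _ n])
  then show ?thesis
    using c assms mat_ge_mult[of 0 U 0 U' n n n] mat_ge_mult[of 0 V' 0 V n n n]
    unfolding unimodular_pair_def by (simp add: mult_carrier_mat[of _ n n _ n])
qed

lemma unimodular_pair_sym: "unimodular_pair n U V \<Longrightarrow> unimodular_pair n V U"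
  unfolding unimodular_pair_def by auto

text \<open>The unit vectors outside \<open>I\<close> join the conditions; they force the support
  into \<open>I\<close> and still leave fewer than \<open>l\<close> conditions. Scaling the solution
  by the least valuation of its coordinates makes it integral and nonzero modulo \<pi>. All test
  vectors of the counting arguments come from here.\<close>

lemma exists_primitive_orthogonal_vec:
  assumes R: "finite R" "R \<subseteq> carrier_vec l" and I: "I \<subseteq> {..<l}" and card: "card R < card I"
  shows "\<exists>c\<in>carrier_vec l. (\<forall>r\<in>R. r \<bullet> c = 0) \<and> vec_ge 0 c \<and> (\<forall>i<l. i \<notin> I \<longrightarrow> c $ i = 0)
           \<and> (\<exists>i\<in>I. \<not> vge 1 (c $ i))"
proof -
  let ?R = "R \<union> unit_vec l ` ({..<l} - I)"
  have "card ?R \<le> card R + card ({..<l} - I)"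
    by (rule order_trans[OF card_Un_le]) (simp add: card_image_le)
  also have "\<dots> < card I + card ({..<l} - I)" using card by simp
  also have "\<dots> = l"
    using card_Diff_subset[OF finite_subset[OF I finite_lessThan] I] card_mono[OF finite_lessThan I]
    by simp
  finally have "card ?R < l" .
  moreover have "finite ?R" "?R \<subseteq> carrier_vec l" using R by auto
  ultimately obtain w where w: "w \<in> carrier_vec l" "w \<noteq> 0\<^sub>v l" "\<forall>r\<in>?R. r \<bullet> w = 0"
    using exists_nonzero_orthogonal_vec by meson
  have supp: "w $ i = 0" if "i < l" "i \<notin> I" for i
  proof -
    have "unit_vec l i \<bullet> w = 0" using w(3) that by blast
    then show ?thesis using w(1) that by simp
  qed
  let ?J = "{i\<in>{..<l}. w $ i \<noteq> 0}"
  have ne: "?J \<noteq> {}" using w(1,2) by (auto simp: vec_eq_iff)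
  define k where "k = Min ((\<lambda>i. vval (w $ i)) ` ?J)"
  have kle: "k \<le> vval (w $ i)" if "i \<in> ?J" for i
    unfolding k_def using that by (intro Min_le) auto
  have "k \<in> (\<lambda>i. vval (w $ i)) ` ?J" unfolding k_def using ne by (intro Min_in) auto
  then obtain i0 where i0: "i0 \<in> ?J" "k = vval (w $ i0)" by blast
  define c where "c = \<pi> powi (- k) \<cdot>\<^sub>v w"
  have c: "c \<in> carrier_vec l" unfolding c_def using w by simp
  have ci: "c $ i = \<pi> powi (- k) * w $ i" if "i < l" for i using w(1) that unfolding c_def by simp
  have "vge 0 (c $ i)" if "i < l" for i
  proof (cases "w $ i = 0")
    case False
    then show ?thesis using kle[of i] that by (simp add: ci vge_powi_mult_iff vge_iff)
  qed (simp add: ci that)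
  moreover have "\<not> vge 1 (c $ i0)"
    using i0 by (simp add: ci vge_powi_mult_iff vge_iff)
  moreover have "i0 \<in> I" using i0 supp by auto
  moreover have "r \<bullet> c = 0" if "r \<in> R" for r
  proof -
    have "r \<bullet> w = 0" using that w(3) by blast
    moreover have "r \<in> carrier_vec l" using R that by blast
    ultimately show ?thesis unfolding c_def using w(1) by simp
  qed
  moreover have "\<forall>i<l. i \<notin> I \<longrightarrow> c $ i = 0" using supp ci by simp
  ultimately show ?thesis using c unfolding vec_ge_def by (intro bexI[of _ c]) auto
qed

end

text \<open>This is N_k of the overview, on lists of orders. It ignores the arrangement of the list,
  so a list such as \<open>map uminus \<alpha>\<close> can be counted without sorting.\<close>

definition count_le :: "int \<Rightarrow> int list \<Rightarrow> nat" where
  "count_le k ks = length (filter (\<lambda>x. x \<le> k) ks)"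

lemma count_le_card: "count_le k ks = card {i. i < length ks \<and> ks ! i \<le> k}"
  unfolding count_le_def by (rule length_filter_conv_card)

context dvr begin

definition pi_diag :: "nat \<Rightarrow> nat \<Rightarrow> int list \<Rightarrow> 'k mat" where
  "pi_diag nr nc ks = rect_diag nr nc (map (\<lambda>k. \<pi> powi k) ks)"

lemma pi_diag_carrier [simp]: "pi_diag nr nc ks \<in> carrier_mat nr nc"
  unfolding pi_diag_def rect_diag_def by simp

lemma pi_diag_dim [simp]: "dim_row (pi_diag nr nc ks) = nr" "dim_col (pi_diag nr nc ks) = nc"
  unfolding pi_diag_def rect_diag_def by simp_all

lemma pi_diag_index:
  "i < nr \<Longrightarrow> j < nc \<Longrightarrow>
   pi_diag nr nc ks $$ (i, j) = (if i = j \<and> i < length ks then \<pi> powi (ks ! i) else 0)"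
  unfolding pi_diag_def rect_diag_def by simp

lemma pi_diag_mult_vec:
  assumes "w \<in> carrier_vec nc" "i < nr"
  shows "(pi_diag nr nc ks *\<^sub>v w) $ i = (if i < nc \<and> i < length ks then \<pi> powi (ks ! i) * w $ i else 0)"
proof -
  have "(pi_diag nr nc ks *\<^sub>v w) $ i = (\<Sum>j<nc. pi_diag nr nc ks $$ (i, j) * w $ j)"
    using assms by (simp add: scalar_prod_def atLeast0LessThan)
  also have "\<dots> = (\<Sum>j<nc. if j = i then (if i < length ks then \<pi> powi (ks ! i) * w $ i else 0) else 0)"
    using assms by (intro sum.cong) (auto simp: pi_diag_index)
  also have "\<dots> = (if i < nc \<and> i < length ks then \<pi> powi (ks ! i) * w $ i else 0)"
    by (simp add: sum.delta)
  finally show ?thesis .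
qed

text \<open>A coordinate of order at least \<open>k\<close> receives a sufficient power of \<pi>
  from the diagonal; one of lower order must have been killed. The counting arguments use it with
  \<open>k + 1\<close>, after killing the coordinates of order at most \<open>k\<close>.\<close>

lemma vec_ge_pi_diag_mult:
  assumes w: "w \<in> carrier_vec nc" and int: "vec_ge 0 w"
    and zero: "\<And>j. j < length ks \<Longrightarrow> j < nc \<Longrightarrow> ks ! j < k \<Longrightarrow> w $ j = 0"
  shows "vec_ge k (pi_diag nr nc ks *\<^sub>v w)"
  unfolding vec_ge_def
proof (intro allI impI)
  fix i assume i: "i < dim_vec (pi_diag nr nc ks *\<^sub>v w)"
  show "vge k ((pi_diag nr nc ks *\<^sub>v w) $ i)"
  proof (cases "i < nc \<and> i < length ks \<and> k \<le> ks ! i")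
    case True
    then have "vge 0 (w $ i)" using int w unfolding vec_ge_def by simp
    then show ?thesis using True w i vge_mono[of 0 "w $ i" "k - ks ! i"]
      by (simp add: pi_diag_mult_vec vge_powi_mult_iff del: index_mult_mat_vec)
  next
    case False
    then show ?thesis using w i zero[of i]
      by (auto simp: pi_diag_mult_vec simp del: index_mult_mat_vec)
  qed
qed

lemma count_le_mono:
  assumes eq: "pi_diag nr nc a = U * pi_diag nr' nc' b * V + E"
    and U: "U \<in> carrier_mat nr nr'" "mat_ge 0 U" and V: "V \<in> carrier_mat nc' nc" "mat_ge 0 V"
    and E: "E \<in> carrier_mat nr nc" "mat_ge (k + 1) E"
    and len: "length a \<le> nr" "length a \<le> nc" "length b \<le> nc'"
  shows "count_le k a \<le> count_le k b"
proof (rule ccontr)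
  assume neg: "\<not> ?thesis"
  define I where "I = {i. i < length a \<and> a ! i \<le> k}"
  define J where "J = {j. j < length b \<and> b ! j \<le> k}"
  \<comment> \<open>The conditions on \<open>c\<close>: the rows of \<open>V\<close> in
    \<open>J\<close> compute those coordinates of \<open>V *\<^sub>v c\<close> which the diagonal of
    \<open>b\<close> multiplies by less than \<pi>^(k+1).\<close>
  have "card (row V ` J) \<le> card J" unfolding J_def by (intro card_image_le) simp
  also have "\<dots> < card I" using neg unfolding I_def J_def count_le_card by simp
  finally have "card (row V ` J) < card I" .
  moreover have "finite (row V ` J)" unfolding J_def by simp
  moreover have "row V ` J \<subseteq> carrier_vec nc" using V by auto
  moreover have "I \<subseteq> {..<nc}" unfolding I_def using len by auto
  ultimately obtain c where c: "c \<in> carrier_vec nc" "\<forall>r\<in>row V ` J. r \<bullet> c = 0" "vec_ge 0 c"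
      "\<exists>i\<in>I. \<not> vge 1 (c $ i)"
    using exists_primitive_orthogonal_vec[of "row V ` J" nc I] by blast
  have Vc: "V *\<^sub>v c \<in> carrier_vec nc'" using V c by simp
  have "vec_ge (k + 1) (pi_diag nr' nc' b *\<^sub>v (V *\<^sub>v c))"
  proof (rule vec_ge_pi_diag_mult[OF Vc])
    show "vec_ge 0 (V *\<^sub>v c)" using mat_ge_mult_vec[OF V(2) c(3) V(1) c(1)] by simp
    show "(V *\<^sub>v c) $ j = 0" if "j < length b" "j < nc'" "b ! j < k + 1" for j
      using c(2) that V unfolding J_def by simp
  qed
  from mat_ge_mult_vec[OF U(2) this U(1)]
  have 1: "vec_ge (k + 1) (U *\<^sub>v (pi_diag nr' nc' b *\<^sub>v (V *\<^sub>v c)))"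
    by (simp add: mult_mat_vec_carrier[OF pi_diag_carrier Vc])
  have 2: "vec_ge (k + 1) (E *\<^sub>v c)" using mat_ge_mult_vec[OF E(2) c(3) E(1) c(1)] by simp
  have "pi_diag nr nc a *\<^sub>v c = U *\<^sub>v (pi_diag nr' nc' b *\<^sub>v (V *\<^sub>v c)) + E *\<^sub>v c"
    unfolding eq using U(1) V(1) E(1) c(1)
    by (subst add_mult_distrib_mat_vec[of _ nr nc]) (auto simp: assoc_mult_mat_vec[of _ nr nc' _ nc]
        assoc_mult_mat_vec[of _ nr nr' _ nc'])
  then have ge: "vec_ge (k + 1) (pi_diag nr nc a *\<^sub>v c)"
    using vec_ge_add[OF 1 2 mult_mat_vec_carrier[OF U(1)] mult_mat_vec_carrier[OF E(1) c(1)]] Vc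
    by (simp add: mult_mat_vec_carrier[OF pi_diag_carrier])
  obtain i where i: "i \<in> I" "\<not> vge 1 (c $ i)" using c(4) by blast
  then have i': "i < length a" "a ! i \<le> k" "i < nr" "i < nc" using len unfolding I_def by auto
  from ge i' have "vge (k + 1) ((pi_diag nr nc a *\<^sub>v c) $ i)" unfolding vec_ge_def by simp
  \<comment> \<open>The order \<open>a ! i\<close> is at most \<open>k\<close>, so at least one
    factor \<pi> would have to come from \<open>c $ i\<close>, against the choice of
    \<open>i\<close>.\<close>
  then have "vge (k + 1 - a ! i) (c $ i)"
    using i' c(1) by (simp add: pi_diag_mult_vec vge_powi_mult_iff del: index_mult_mat_vec)
  then show False using i(2) i'(2) vge_mono[of "k + 1 - a ! i" "c $ i" 1] by simp
qed

section \<open>Unimodular matrices and the Smith form over the valuation ring\<close>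

lemma unimodular_pair_four_block:
  assumes "unimodular_pair n U V" "unimodular_pair m U' V'"
  shows "unimodular_pair (n + m) (four_block_mat U (0\<^sub>m n m) (0\<^sub>m m n) U')
    (four_block_mat V (0\<^sub>m n m) (0\<^sub>m m n) V')"
proof -
  have c: "U \<in> carrier_mat n n" "V \<in> carrier_mat n n" "U' \<in> carrier_mat m m" "V' \<in> carrier_mat m m"
    and g: "mat_ge 0 U" "mat_ge 0 V" "mat_ge 0 U'" "mat_ge 0 V'"
    and e: "U * V = 1\<^sub>m n" "V * U = 1\<^sub>m n" "U' * V' = 1\<^sub>m m" "V' * U' = 1\<^sub>m m"
    using assms unfolding unimodular_pair_def by blast+
  let ?W = "four_block_mat U (0\<^sub>m n m) (0\<^sub>m m n) U'"
    and ?W' = "four_block_mat V (0\<^sub>m n m) (0\<^sub>m m n) V'"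
  have "?W * ?W' = 1\<^sub>m (n + m)" "?W' * ?W = 1\<^sub>m (n + m)"
    by (subst mult_four_block_mat[of _ n n _ m _ m _ _ n _ m]; use c e in simp)+
  moreover have "mat_ge 0 ?W" "mat_ge 0 ?W'"
    by (rule mat_ge_four_block[of _ _ _ _ _ n n m m]; use c g in \<open>simp add: mat_ge_zero\<close>)+
  ultimately show ?thesis unfolding unimodular_pair_def using c by simp
qed

lemma unimodular_pair_lower:
  assumes X: "X \<in> carrier_mat m n" "mat_ge 0 X"
  shows "unimodular_pair (n + m) (four_block_mat (1\<^sub>m n) (0\<^sub>m n m) X (1\<^sub>m m))
    (four_block_mat (1\<^sub>m n) (0\<^sub>m n m) (- X) (1\<^sub>m m))"
    (is "unimodular_pair _ ?W ?W'")
proof -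
  have inv: "X + - X = 0\<^sub>m m n" "- X + X = 0\<^sub>m m n"
    using X(1) by (auto intro!: eq_matI)
  have zero: "- 0\<^sub>m k k = (0\<^sub>m k k :: 'k mat)" for k by (auto intro!: eq_matI)
  have "?W * ?W' = 1\<^sub>m (n + m)" "?W' * ?W = 1\<^sub>m (n + m)"
    by (subst mult_four_block_mat[of _ n n _ m _ m _ _ n _ m]; use X(1) inv in \<open>simp add: zero\<close>)+
  moreover have "mat_ge 0 ?W" "mat_ge 0 ?W'"
    by (rule mat_ge_four_block[of _ _ _ _ _ n n m m];
        use X in \<open>simp add: mat_ge_zero mat_ge_one mat_ge_uminus\<close>)+
  ultimately show ?thesis unfolding unimodular_pair_def by simp
qed

lemma unimodular_pair_upper:
  assumes X: "X \<in> carrier_mat n m" "mat_ge 0 X"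
  shows "unimodular_pair (n + m) (four_block_mat (1\<^sub>m n) X (0\<^sub>m m n) (1\<^sub>m m))
    (four_block_mat (1\<^sub>m n) (- X) (0\<^sub>m m n) (1\<^sub>m m))"
    (is "unimodular_pair _ ?W ?W'")
proof -
  have inv: "X + - X = 0\<^sub>m n m" "- X + X = 0\<^sub>m n m"
    using X(1) by (auto intro!: eq_matI)
  have zero: "- 0\<^sub>m k k = (0\<^sub>m k k :: 'k mat)" for k by (auto intro!: eq_matI)
  have "?W * ?W' = 1\<^sub>m (n + m)" "?W' * ?W = 1\<^sub>m (n + m)"
    by (subst mult_four_block_mat[of _ n n _ m _ m _ _ n _ m]; use X(1) inv in \<open>simp add: zero\<close>)+
  moreover have "mat_ge 0 ?W" "mat_ge 0 ?W'"
    by (rule mat_ge_four_block[of _ _ _ _ _ n n m m];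
        use X in \<open>simp add: mat_ge_zero mat_ge_one mat_ge_uminus\<close>)+
  ultimately show ?thesis unfolding unimodular_pair_def by simp
qed

lemma unimodular_pair_swap:
  "i < n \<Longrightarrow> j < n \<Longrightarrow> unimodular_pair n (swaprows_mat n i j) (swaprows_mat n i j)"
  unfolding unimodular_pair_def mat_ge_def
  by (auto simp: swaprows_mat_inv vge_0_iff zero_mem one_mem)

lemma unimodular_pair_one: "unimodular_pair n (1\<^sub>m n) (1\<^sub>m n)"
  unfolding unimodular_pair_def by (simp add: mat_ge_one)

definition equivalent :: "nat \<Rightarrow> nat \<Rightarrow> 'k mat \<Rightarrow> 'k mat \<Rightarrow> bool" where
  "equivalent nr nc M N \<longleftrightarrow>
     (\<exists>U U' V V'. unimodular_pair nr U U' \<and> unimodular_pair nc V V' \<and> M = U * N * V)"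

lemma equivalentI:
  "unimodular_pair nr U U' \<Longrightarrow> unimodular_pair nc V V' \<Longrightarrow> M = U * N * V \<Longrightarrow> equivalent nr nc M N"
  unfolding equivalent_def by blast

lemma equivalent_trans:
  assumes "equivalent nr nc M N" "equivalent nr nc N L" "L \<in> carrier_mat nr nc"
  shows "equivalent nr nc M L"
proof -
  obtain U U' V V' where 1: "unimodular_pair nr U U'" "unimodular_pair nc V V'" "M = U * N * V"
    using assms(1) unfolding equivalent_def by blast
  obtain S S' T T' where 2: "unimodular_pair nr S S'" "unimodular_pair nc T T'" "N = S * L * T"
    using assms(2) unfolding equivalent_def by blast
  have c: "U \<in> carrier_mat nr nr" "S \<in> carrier_mat nr nr" "V \<in> carrier_mat nc nc" "T \<in> carrier_mat nc nc"
    using 1 2 unfolding unimodular_pair_def by blast+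
  have "M = (U * S) * L * (T * V)"
    unfolding 1(3) 2(3) using c assms(3)
    by (simp add: assoc_mult_mat[of _ nr nr _ nr _ nc] assoc_mult_mat[of _ nr nr _ nc _ nc]
        assoc_mult_mat[of _ nr nc _ nc _ nc] assoc_mult_mat[of _ nr nr _ nr _ nr])
  then show ?thesis
    using equivalentI[OF unimodular_pair_mult[OF 1(1) 2(1)] unimodular_pair_mult[OF 2(2) 1(2)]] by blast
qed


lemma unimodular_pair_smult_one:
  assumes "u \<in> \<O>" "inverse u \<in> \<O>" "u \<noteq> 0"
  shows "unimodular_pair n (u \<cdot>\<^sub>m 1\<^sub>m n) (inverse u \<cdot>\<^sub>m 1\<^sub>m n)"
proof -
  have "(u \<cdot>\<^sub>m 1\<^sub>m n) * (inverse u \<cdot>\<^sub>m 1\<^sub>m n) = 1\<^sub>m n" "(inverse u \<cdot>\<^sub>m 1\<^sub>m n) * (u \<cdot>\<^sub>m 1\<^sub>m n) = 1\<^sub>m n"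
    using assms(3) by (auto intro!: eq_matI simp: mult_smult_assoc_mat[of _ n n] mult_smult_distrib[of _ n n])
  then show ?thesis
    using assms unfolding unimodular_pair_def mat_ge_def by (auto simp: vge_0_iff zero_mem)
qed

lemma equivalent_refl: "M \<in> carrier_mat nr nc \<Longrightarrow> equivalent nr nc M M"
  by (rule equivalentI[OF unimodular_pair_one unimodular_pair_one]) simp

lemma mat_ge_smult: "vge j x \<Longrightarrow> mat_ge k M \<Longrightarrow> mat_ge (j + k) (x \<cdot>\<^sub>m M)"
  unfolding mat_ge_def by (auto intro: vge_mult)

lemma mat_ge_diff:
  "mat_ge k M \<Longrightarrow> mat_ge k N \<Longrightarrow> M \<in> carrier_mat nr nc \<Longrightarrow> N \<in> carrier_mat nr nc \<Longrightarrow> mat_ge k (M - N)"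
  unfolding mat_ge_def by (auto intro: vge_diff)

text \<open>An entry of least valuation divides all others in \<O>, which keeps elimination with it
  integral.\<close>

lemma exists_pivot:
  assumes M: "M \<in> carrier_mat nr nc" "M \<noteq> 0\<^sub>m nr nc"
  shows "\<exists>i<nr. \<exists>j<nc. M $$ (i, j) \<noteq> 0 \<and> mat_ge (vval (M $$ (i, j))) M"
proof -
  let ?Z = "{p \<in> {..<nr} \<times> {..<nc}. M $$ p \<noteq> 0}"
  define k where "k = Min ((\<lambda>p. vval (M $$ p)) ` ?Z)"
  have "?Z \<noteq> {}" using M by (auto simp: mat_eq_iff)
  then have "k \<in> (\<lambda>p. vval (M $$ p)) ` ?Z"
    unfolding k_def by (intro Min_in) auto
  then obtain p where p: "p \<in> ?Z" "k = vval (M $$ p)" by blast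
  have min: "k \<le> vval (M $$ q)" if "q \<in> ?Z" for q
    unfolding k_def using that by (intro Min_le) auto
  have "vge k (M $$ (a, b))" if ab: "a < nr" "b < nc" for a b
  proof (cases "M $$ (a, b) = 0")
    case False
    then show ?thesis using min[of "(a, b)"] ab by (simp add: vge_iff)
  qed simp
  then have "mat_ge k M" unfolding mat_ge_def using M by simp
  then show ?thesis using p by (cases p) auto
qed

lemma pi_diag_Cons:
  "pi_diag (1 + n) (1 + m) (k # ks) =
     four_block_mat (pi_diag 1 1 [k]) (0\<^sub>m 1 m) (0\<^sub>m n 1) (pi_diag n m ks)"
  by (rule eq_matI) (auto simp: pi_diag_index nth_Cons')

text \<open>Elimination with the Schur complement \<open>D = d - X * b\<close>: the pivot divides
  its row and its column in \<O>, so the shears \<open>X\<close> and \<open>Y\<close> are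
  integral.\<close>

lemma equivalent_pivot:
  assumes M: "M \<in> carrier_mat (1 + n) (1 + m)"
    and nz: "M $$ (0, 0) \<noteq> 0" and ge: "mat_ge (vval (M $$ (0, 0))) M"
  shows "\<exists>D\<in>carrier_mat n m. mat_ge (vval (M $$ (0, 0))) D \<and>
    equivalent (1 + n) (1 + m) M
      (four_block_mat (pi_diag 1 1 [vval (M $$ (0, 0))]) (0\<^sub>m 1 m) (0\<^sub>m n 1) D)"
proof -
  define \<alpha> where "\<alpha> = M $$ (0, 0)"
  define k where "k = vval \<alpha>"
  obtain a b c d where sp: "split_block M 1 1 = (a, b, c, d)" by (metis prod_cases4)
  have dims: "dim_row M = 1 + n" "dim_col M = 1 + m" using M by auto
  note bl = split_block[OF sp dims]
  have alpha: "\<alpha> \<noteq> 0" using nz unfolding \<alpha>_def .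
  have a00: "a $$ (0, 0) = \<alpha>" using bl M unfolding \<alpha>_def by simp
  have geM: "vge k (M $$ (i, j))" if "i < 1 + n" "j < 1 + m" for i j
    using ge that M unfolding mat_ge_def k_def \<alpha>_def by simp
  have gb: "mat_ge k b" unfolding mat_ge_def
  proof (intro allI impI)
    fix i j assume "i < dim_row b" "j < dim_col b"
    then show "vge k (b $$ (i, j))" using geM[of 0 "1 + j"] bl by simp
  qed
  have gc: "mat_ge k c" unfolding mat_ge_def
  proof (intro allI impI)
    fix i j assume "i < dim_row c" "j < dim_col c"
    then show "vge k (c $$ (i, j))" using geM[of "1 + i" 0] bl by simp
  qed
  have gd: "mat_ge k d" unfolding mat_ge_def
  proof (intro allI impI)
    fix i j assume "i < dim_row d" "j < dim_col d"
    then show "vge k (d $$ (i, j))" using geM[of "1 + i" "1 + j"] bl by simp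
  qed
  have ginv: "vge (- k) (inverse \<alpha>)" unfolding k_def by (rule vval(2)[OF alpha])
  define X where "X = inverse \<alpha> \<cdot>\<^sub>m c"
  define Y where "Y = inverse \<alpha> \<cdot>\<^sub>m b"
  define D where "D = d - X * b"
  have X: "X \<in> carrier_mat n 1" "mat_ge 0 X"
    unfolding X_def using bl mat_ge_smult[OF ginv gc] by auto
  have Y: "Y \<in> carrier_mat 1 m" "mat_ge 0 Y"
    unfolding Y_def using bl mat_ge_smult[OF ginv gb] by auto
  have D: "D \<in> carrier_mat n m" "mat_ge k D"
    unfolding D_def using bl X mat_ge_mult[OF X(2) gb X(1) bl(2)]
    by (auto intro!: mat_ge_diff[OF gd, of _ n m])
  have Xa: "X * a = c"
    using bl alpha a00 X unfolding X_def by (intro eq_matI) (auto simp: scalar_prod_def)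
  have aY: "a * Y = b"
    using bl alpha a00 Y unfolding Y_def by (intro eq_matI) (auto simp: scalar_prod_def)
  have cY: "c * Y = X * b"
    using Xa aY X(1) bl(1) Y(1) by (metis assoc_mult_mat)
  have XbD: "X * b + D = d"
    unfolding D_def using X(1) bl by (intro eq_matI) auto
  let ?L = "four_block_mat (1\<^sub>m 1) (0\<^sub>m 1 n) X (1\<^sub>m n)"
  let ?R = "four_block_mat (1\<^sub>m 1) Y (0\<^sub>m m 1) (1\<^sub>m m)"
  let ?M1 = "four_block_mat a (0\<^sub>m 1 m) (0\<^sub>m n 1) D"
  have "?L * ?M1 = four_block_mat a (0\<^sub>m 1 m) c D"
    by (subst mult_four_block_mat[of _ 1 1 _ n _ n _ _ 1 _ m]) (use X(1) bl D(1) Xa in auto)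
  moreover have "four_block_mat a (0\<^sub>m 1 m) c D * ?R = four_block_mat a b c d"
    by (subst mult_four_block_mat[of _ 1 1 _ m _ n _ _ 1 _ m]) (use Y(1) bl D(1) aY cY XbD in auto)
  ultimately have "M = ?L * ?M1 * ?R" using bl(5) by simp
  then have 1: "equivalent (1 + n) (1 + m) M ?M1"
    by (rule equivalentI[OF unimodular_pair_lower[OF X] unimodular_pair_upper[OF Y]])
  \<comment> \<open>The pivot is the unit \<open>u\<close> times \<pi>^k. The unit goes into the
    left factor, so that the diagonal carries a pure power.\<close>
  define u where "u = \<alpha> * \<pi> powi (- k)"
  have u: "u \<in> \<O>" "inverse u \<in> \<O>" "u \<noteq> 0"
    using vval(1)[OF alpha] vval(2)[OF alpha] alpha pi_nonzero
    unfolding u_def k_def vge_def by (auto simp: power_int_minus)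
  have au: "a = (u \<cdot>\<^sub>m 1\<^sub>m 1) * pi_diag 1 1 [k]"
    using bl a00 pi_nonzero unfolding u_def
    by (intro eq_matI) (auto simp: scalar_prod_def pi_diag_index power_int_minus)
  let ?M2 = "four_block_mat (pi_diag 1 1 [k]) (0\<^sub>m 1 m) (0\<^sub>m n 1) D"
  let ?U = "four_block_mat (u \<cdot>\<^sub>m 1\<^sub>m 1) (0\<^sub>m 1 n) (0\<^sub>m n 1) (1\<^sub>m n)"
  have M2: "?M2 \<in> carrier_mat (1 + n) (1 + m)"
    by (rule four_block_carrier_mat[OF pi_diag_carrier D(1)])
  have "?U * ?M2 = ?M1"
    by (subst mult_four_block_mat[of _ 1 1 _ n _ n _ _ 1 _ m]) (use D(1) bl in \<open>auto simp: au[symmetric, unfolded One_nat_def]\<close>)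
  moreover have "?U \<in> carrier_mat (1 + n) (1 + n)"
    by (rule four_block_carrier_mat) simp_all
  ultimately have "?M1 = ?U * ?M2 * 1\<^sub>m (1 + m)"
    using right_mult_one_mat[OF mult_carrier_mat[OF _ M2]] by metis
  then have 2: "equivalent (1 + n) (1 + m) ?M1 ?M2"
    by (rule equivalentI[OF unimodular_pair_four_block[OF unimodular_pair_smult_one[OF u] unimodular_pair_one]
        unimodular_pair_one])
  show ?thesis
    using equivalent_trans[OF 1 2 M2] D unfolding k_def \<alpha>_def by blast
qed

lemma equivalent_four_block_right:
  assumes "equivalent n m D N" "a \<in> carrier_mat l l'" "D \<in> carrier_mat n m" "N \<in> carrier_mat n m"
  shows "equivalent (l + n) (l' + m) (four_block_mat a (0\<^sub>m l m) (0\<^sub>m n l') D)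
    (four_block_mat a (0\<^sub>m l m) (0\<^sub>m n l') N)"
proof -
  obtain U U' V V' where uv: "unimodular_pair n U U'" "unimodular_pair m V V'" "D = U * N * V"
    using assms(1) unfolding equivalent_def by blast
  have c: "U \<in> carrier_mat n n" "V \<in> carrier_mat m m"
    using uv unfolding unimodular_pair_def by blast+
  let ?L = "four_block_mat (1\<^sub>m l) (0\<^sub>m l n) (0\<^sub>m n l) U"
  let ?R = "four_block_mat (1\<^sub>m l') (0\<^sub>m l' m) (0\<^sub>m m l') V"
  have "?L * four_block_mat a (0\<^sub>m l m) (0\<^sub>m n l') N = four_block_mat a (0\<^sub>m l m) (0\<^sub>m n l') (U * N)"
    by (subst mult_four_block_mat[of _ l l _ n _ n _ _ l' _ m]) (use assms c in auto)
  moreover have "four_block_mat a (0\<^sub>m l m) (0\<^sub>m n l') (U * N) * ?R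
      = four_block_mat a (0\<^sub>m l m) (0\<^sub>m n l') (U * N * V)"
    by (subst mult_four_block_mat[of _ l l' _ m _ n _ _ l' _ m]) (use assms c in auto)
  ultimately show ?thesis
    by (intro equivalentI[OF unimodular_pair_four_block[OF unimodular_pair_one uv(1)]
        unimodular_pair_four_block[OF unimodular_pair_one uv(2)]]) (simp add: uv(3))
qed

text \<open>Swaps are their own inverses, so moving the chosen entry to the corner stays within the
  equivalence class; being integral, they keep every lower bound on valuations.\<close>

lemma equivalent_swap_pivot:
  assumes M: "M \<in> carrier_mat nr nc" and ij: "i < nr" "j < nc"
  shows "\<exists>N\<in>carrier_mat nr nc. N $$ (0, 0) = M $$ (i, j) \<and> (\<forall>k. mat_ge k M \<longrightarrow> mat_ge k N)
    \<and> equivalent nr nc M N"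
proof -
  let ?S = "swaprows_mat nr 0 i" and ?T = "swaprows_mat nc 0 j"
  have nz: "0 < nr" "0 < nc" using ij by auto
  have S: "unimodular_pair nr ?S ?S" and T: "unimodular_pair nc ?T ?T"
    using unimodular_pair_swap nz ij by auto
  define N where "N = ?S * M * ?T"
  have N: "N \<in> carrier_mat nr nc" unfolding N_def using M by (meson mult_carrier_mat swaprows_mat_carrier)
  have SM: "?S * M \<in> carrier_mat nr nc" using M by (meson mult_carrier_mat swaprows_mat_carrier)
  have "?S * N * ?T = (?S * ?S) * M * (?T * ?T)"
    unfolding N_def using M SM
    by (simp add: assoc_mult_mat[of _ nr nr _ nc _ nc] assoc_mult_mat[of _ nr nr _ nr _ nc]
        assoc_mult_mat[of _ nr nc _ nc _ nc] mult_carrier_mat[of _ nr nc _ nc] mult_carrier_mat[of _ nc nc _ nc] mult_carrier_mat[of _ nr nr _ nc])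
  also have "\<dots> = M" using M nz ij by (simp add: swaprows_mat_inv)
  finally have eq: "equivalent nr nc M N" using equivalentI[OF S T] by metis
  have colT: "col ?T 0 = unit_vec nc j"
    using nz ij by (intro eq_vecI) auto
  have "N $$ (0, 0) = row (?S * M) 0 \<bullet> col ?T 0"
    unfolding N_def using nz M by simp
  also have "\<dots> = (?S * M) $$ (0, j)"
    unfolding colT using nz ij M SM by simp
  also have "\<dots> = M $$ (i, j)"
    using nz ij M swaprows_mat[OF M nz(1) ij(1)] by (metis carrier_matD index_mat_swaprows(1))
  finally have "N $$ (0, 0) = M $$ (i, j)" .
  moreover have "mat_ge k N" if "mat_ge k M" for k
  proof -
    have "mat_ge k (?S * M)"
      using mat_ge_mult[of 0 ?S k M nr nr nc] S that M unfolding unimodular_pair_def by simp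
    then show ?thesis unfolding N_def
      using mat_ge_mult[of k "?S * M" 0 ?T nr nc nc] T SM unfolding unimodular_pair_def by simp
  qed
  ultimately show ?thesis using N eq by blast
qed

text \<open>The bound \<open>w\<close> carries divisibility through the induction: the Schur
  complement keeps the valuation of the pivot as a lower bound, so all later orders are at least
  that of the pivot and the list comes out sorted. A negative \<open>w\<close> covers matrices with
  poles.\<close>

theorem smith_form:
  assumes "M \<in> carrier_mat nr nc" "mat_ge w M"
  shows "\<exists>ks. sorted ks \<and> (\<forall>k\<in>set ks. w \<le> k) \<and> length ks \<le> nr \<and> length ks \<le> nc \<and>
    equivalent nr nc M (pi_diag nr nc ks)"
  using assms
proof (induction nr arbitrary: nc M w)
  case 0
  then have "M = pi_diag 0 nc []" by (intro eq_matI) auto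
  then show ?case using equivalent_refl[of M 0 nc] 0 by (intro exI[of _ "[]"]) auto
next
  case (Suc n)
  show ?case
  proof (cases "M = 0\<^sub>m (Suc n) nc")
    case True
    then have "M = pi_diag (Suc n) nc []" by (intro eq_matI) (auto simp: pi_diag_index)
    then show ?thesis using equivalent_refl[of M "Suc n" nc] Suc.prems by (intro exI[of _ "[]"]) auto
  next
    case False
    obtain i j where ij: "i < Suc n" "j < nc" "M $$ (i, j) \<noteq> 0" "mat_ge (vval (M $$ (i, j))) M"
      using exists_pivot[OF Suc.prems(1) False] by blast
    then obtain m where m: "nc = Suc m" by (cases nc) auto
    define k where "k = vval (M $$ (i, j))"
    have "vge w (M $$ (i, j))" using Suc.prems ij unfolding mat_ge_def by simp
    then have wk: "w \<le> k" unfolding k_def using vge_iff[OF ij(3)] by simp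
    obtain N where N: "N \<in> carrier_mat (1 + n) (1 + m)" "N $$ (0, 0) = M $$ (i, j)" "mat_ge k N"
        "equivalent (1 + n) (1 + m) M N"
      using equivalent_swap_pivot[OF Suc.prems(1) ij(1,2)] ij(4) unfolding k_def m by auto
    obtain D where D: "D \<in> carrier_mat n m" "mat_ge k D"
        "equivalent (1 + n) (1 + m) N (four_block_mat (pi_diag 1 1 [k]) (0\<^sub>m 1 m) (0\<^sub>m n 1) D)"
      using equivalent_pivot[OF N(1)] N(2,3) ij(3) unfolding k_def by auto
    obtain ks where ks: "sorted ks" "\<forall>x\<in>set ks. k \<le> x" "length ks \<le> n" "length ks \<le> m"
        "equivalent n m D (pi_diag n m ks)"
      using Suc.IH[OF D(1,2)] by blast
    have "equivalent (1 + n) (1 + m) (four_block_mat (pi_diag 1 1 [k]) (0\<^sub>m 1 m) (0\<^sub>m n 1) D)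
        (pi_diag (1 + n) (1 + m) (k # ks))"
      unfolding pi_diag_Cons by (rule equivalent_four_block_right[OF ks(5)]) (use D in auto)
    from equivalent_trans[OF N(4) equivalent_trans[OF D(3) this]]
    have "equivalent (Suc n) nc M (pi_diag (Suc n) nc (k # ks))" unfolding m by simp
    then show ?thesis using ks wk m by (intro exI[of _ "k # ks"]) auto
  qed
qed

lemma exists_mat_ge: "\<exists>w. mat_ge w M"
proof (cases "M = 0\<^sub>m (dim_row M) (dim_col M)")
  case True
  then show ?thesis using mat_ge_zero by metis
next
  case False
  then show ?thesis using exists_pivot[of M "dim_row M" "dim_col M"] by auto
qed

text \<open>The hypothesis \<open>inj\<close> says that \<open>N\<close> has full column rank over the residue field.\<close>

lemma exists_left_inverse:
  assumes N: "N \<in> carrier_mat l n" "mat_ge 0 N"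
    and inj: "\<And>w. w \<in> carrier_vec n \<Longrightarrow> vec_ge 0 w \<Longrightarrow> vec_ge 1 (N *\<^sub>v w) \<Longrightarrow> vec_ge 1 w"
  shows "\<exists>L\<in>carrier_mat n l. mat_ge 0 L \<and> L * N = 1\<^sub>m n"
proof -
  obtain ks where ks: "sorted ks" "\<forall>x\<in>set ks. 0 \<le> x" "length ks \<le> l" "length ks \<le> n"
      "equivalent l n N (pi_diag l n ks)"
    using smith_form[OF N] by blast
  obtain U U' V V' where uv: "unimodular_pair l U U'" "unimodular_pair n V V'"
      "N = U * pi_diag l n ks * V"
    using ks(5) unfolding equivalent_def by blast
  have c: "U \<in> carrier_mat l l" "U' \<in> carrier_mat l l" "V \<in> carrier_mat n n" "V' \<in> carrier_mat n n"
    and g: "mat_ge 0 U" "mat_ge 0 U'" "mat_ge 0 V" "mat_ge 0 V'"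
    and e: "U' * U = 1\<^sub>m l" "V * V' = 1\<^sub>m n" "V' * V = 1\<^sub>m n"
    using uv(1,2) unfolding unimodular_pair_def by blast+
  \<comment> \<open>Injectivity modulo \<pi> leaves only orders 0. Otherwise \<open>N\<close> would
    send column \<open>i\<close> of \<open>V'\<close> to multiples of \<pi>, so this column would
    itself be divisible by \<pi>; but \<open>V\<close> maps it to a unit vector.\<close>
  have full: "i < length ks \<and> ks ! i = 0" if i: "i < n" for i
  proof (rule ccontr)
    assume neg: "\<not> ?thesis"
    define w where "w = V' *\<^sub>v unit_vec n i"
    have w: "w \<in> carrier_vec n" "vec_ge 0 w"
      unfolding w_def using c mat_ge_mult_vec[OF g(4) vec_ge_unit c(4)] by auto
    have Vw: "V *\<^sub>v w = unit_vec n i"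
      unfolding w_def using c e by (simp add: assoc_mult_mat_vec[symmetric, of _ n n _ n])
    have "vec_ge 1 (pi_diag l n ks *\<^sub>v unit_vec n i)"
    proof (rule vec_ge_pi_diag_mult[OF unit_vec_carrier vec_ge_unit])
      fix j assume j: "j < length ks" "j < n" "ks ! j < 1"
      then have "ks ! j = 0" using ks(2) nth_mem by fastforce
      then show "unit_vec n i $ j = (0::'k)" using neg j i by (cases "i = j") auto
    qed
    from mat_ge_mult_vec[OF g(1) this c(1)]
    have "vec_ge 1 (U *\<^sub>v (pi_diag l n ks *\<^sub>v unit_vec n i))"
      by (simp add: mult_mat_vec_carrier[OF pi_diag_carrier unit_vec_carrier])
    moreover have "N *\<^sub>v w = U *\<^sub>v (pi_diag l n ks *\<^sub>v unit_vec n i)"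
      unfolding uv(3) Vw[symmetric] using c w(1)
      by (simp add: assoc_mult_mat_vec[of _ l n _ n] assoc_mult_mat_vec[of _ l l _ n]
          mult_carrier_mat[of _ l l _ n])
    ultimately have "vec_ge 1 w" using inj[OF w] by simp
    from mat_ge_mult_vec[OF g(3) this c(3) w(1)] have "vec_ge 1 (unit_vec n i)"
      unfolding Vw by simp
    then show False using i vge_1_one unfolding vec_ge_def by auto
  qed
  have len: "length ks = n" using full[of "n - 1"] ks(4) by (cases n) auto
  then have nl: "n \<le> l" using ks(3) by simp
  have "pi_diag n l ks * pi_diag l n ks = 1\<^sub>m n"
  proof (rule eq_matI)
    fix i j assume ij: "i < dim_row (1\<^sub>m n :: 'k mat)" "j < dim_col (1\<^sub>m n :: 'k mat)"
    then have ij': "i < n" "j < n" "i < l" "j < l" using nl by auto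
    have "(pi_diag n l ks * pi_diag l n ks) $$ (i, j) = (pi_diag n l ks *\<^sub>v col (pi_diag l n ks) j) $ i"
      using ij' by simp
    also have "\<dots> = (if i < l \<and> i < length ks then \<pi> powi (ks ! i) * col (pi_diag l n ks) j $ i else 0)"
      by (rule pi_diag_mult_vec[OF _ ij'(1)]) (simp add: carrier_vecI)
    also have "\<dots> = pi_diag l n ks $$ (i, j)"
      using ij' full[OF ij'(1)] by simp
    also have "\<dots> = 1\<^sub>m n $$ (i, j)"
      using ij' full[OF ij'(1)] by (auto simp: pi_diag_index)
    finally show "(pi_diag n l ks * pi_diag l n ks) $$ (i, j) = 1\<^sub>m n $$ (i, j)" .
  qed simp_all
  then have diag: "pi_diag n l ks * (pi_diag l n ks * V) = V"
    using c by (simp add: assoc_mult_mat[symmetric, of _ n l _ n _ n])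
  \<comment> \<open>All orders being 0, the diagonal factor is an identity block above zero rows,
    and the transposed shape inverts it from the left.\<close>
  define L where "L = V' * (pi_diag n l ks * U')"
  have "mat_ge 0 (pi_diag n l ks)"
    using ks(2) unfolding mat_ge_def by (simp add: pi_diag_index vge_powi_iff)
  then have DU: "mat_ge 0 (pi_diag n l ks * U')" "pi_diag n l ks * U' \<in> carrier_mat n l"
    using mat_ge_mult[OF _ g(2) pi_diag_carrier c(2), of 0] mult_carrier_mat[OF pi_diag_carrier c(2)]
    by simp_all
  then have L: "L \<in> carrier_mat n l" "mat_ge 0 L"
    unfolding L_def using c(4) mat_ge_mult[OF g(4) DU(1) c(4) DU(2)] by simp_all
  have "L * N = V' * (pi_diag n l ks * ((U' * U) * (pi_diag l n ks * V)))"
    unfolding L_def uv(3) using c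
    by (simp add: assoc_mult_mat[of _ n n _ l _ n] assoc_mult_mat[of _ n l _ l _ n]
        assoc_mult_mat[of _ l l _ l _ n] assoc_mult_mat[of _ l l _ n _ n]
        mult_carrier_mat[of _ n l _ l] mult_carrier_mat[of _ l l _ n] mult_carrier_mat[of _ l n _ n])
  also have "\<dots> = 1\<^sub>m n" using c e diag by (simp add: mult_carrier_mat[of _ l n _ n])
  finally show ?thesis using L by blast
qed


section \<open>Uniqueness of the orders and the orders of an inverse\<close>

lemma equivalent_sym:
  assumes "equivalent nr nc M N" "N \<in> carrier_mat nr nc"
  shows "equivalent nr nc N M"
proof -
  obtain U U' V V' where uv: "unimodular_pair nr U U'" "unimodular_pair nc V V'" "M = U * N * V"
    using assms(1) unfolding equivalent_def by blast
  have c: "U \<in> carrier_mat nr nr" "U' \<in> carrier_mat nr nr" "V \<in> carrier_mat nc nc" "V' \<in> carrier_mat nc nc"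
    and e: "U' * U = 1\<^sub>m nr" "V * V' = 1\<^sub>m nc"
    using uv(1,2) unfolding unimodular_pair_def by blast+
  have "U' * M * V' = (U' * U) * N * (V * V')"
    unfolding uv(3) using c assms(2) by (simp only: mat_dim_simps pi_diag_dim)
  then have "N = U' * M * V'" using assms(2) e by simp
  then show ?thesis
    by (rule equivalentI[OF unimodular_pair_sym[OF uv(1)] unimodular_pair_sym[OF uv(2)]])
qed

lemma equivalent_mat_ge:
  assumes "equivalent nr nc M N" "N \<in> carrier_mat nr nc" "mat_ge k N"
  shows "mat_ge k M"
proof -
  obtain U U' V V' where uv: "unimodular_pair nr U U'" "unimodular_pair nc V V'" "M = U * N * V"
    using assms(1) unfolding equivalent_def by blast
  have c: "U \<in> carrier_mat nr nr" "V \<in> carrier_mat nc nc" "mat_ge 0 U" "mat_ge 0 V"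
    using uv(1,2) unfolding unimodular_pair_def by blast+
  have "mat_ge (0 + k + 0) (U * N * V)"
    using mat_ge_mult[OF mat_ge_mult[OF c(3) assms(3) c(1) assms(2)] c(4) mult_carrier_mat[OF c(1) assms(2)] c(2)] .
  then show ?thesis using uv(3) by simp
qed

text \<open>Inverting the unimodular factors writes the diagonal form as a product of integral
  matrices, and its entries are powers of \<pi>.\<close>

lemma pi_diag_nonneg:
  assumes "equivalent nr nc M (pi_diag nr nc ks)" "M \<in> carrier_mat nr nc" "mat_ge 0 M"
    "length ks \<le> nr" "length ks \<le> nc" "k \<in> set ks"
  shows "0 \<le> k"
proof -
  have ge: "mat_ge 0 (pi_diag nr nc ks)"
    using equivalent_mat_ge[OF equivalent_sym[OF assms(1) pi_diag_carrier] assms(2,3)] .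
  obtain i where i: "i < length ks" "ks ! i = k" using assms(6) by (auto simp: in_set_conv_nth)
  then have "vge 0 (pi_diag nr nc ks $$ (i, i))" using ge assms(4,5) unfolding mat_ge_def by simp
  then show ?thesis using i assms(4,5) by (simp add: pi_diag_index vge_powi_iff)
qed

text \<open>The unimodular factors on both sides are integral: they merge into \<open>U\<close> and
  \<open>V\<close>, and around \<open>E\<close> they preserve its divisibility. This reduces the
  comparison to diagonal matrices.\<close>

lemma count_le_mono_equivalent:
  assumes M: "M = U * N * V + E" "equivalent nr nc M (pi_diag nr nc a)" "equivalent nr' nc' N (pi_diag nr' nc' b)"
    and U: "U \<in> carrier_mat nr nr'" "mat_ge 0 U" and V: "V \<in> carrier_mat nc' nc" "mat_ge 0 V"
    and E: "E \<in> carrier_mat nr nc" "mat_ge (k + 1) E"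
    and len: "length a \<le> nr" "length a \<le> nc" "length b \<le> nc'"
  shows "count_le k a \<le> count_le k b"
proof -
  obtain S S' T T' where st: "unimodular_pair nr S S'" "unimodular_pair nc T T'"
      "pi_diag nr nc a = S * M * T"
    using equivalent_sym[OF M(2) pi_diag_carrier] unfolding equivalent_def by blast
  obtain L L' R R' where lr: "unimodular_pair nr' L L'" "unimodular_pair nc' R R'"
      "N = L * pi_diag nr' nc' b * R"
    using M(3) unfolding equivalent_def by blast
  have c: "S \<in> carrier_mat nr nr" "T \<in> carrier_mat nc nc" "L \<in> carrier_mat nr' nr'" "R \<in> carrier_mat nc' nc'"
    and g: "mat_ge 0 S" "mat_ge 0 T" "mat_ge 0 L" "mat_ge 0 R"
    using st(1,2) lr(1,2) unfolding unimodular_pair_def by blast+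
  let ?D = "pi_diag nr' nc' b"
  have UNV: "U * N * V \<in> carrier_mat nr nc"
    unfolding lr(3) using U(1) V(1) c by (meson mult_carrier_mat pi_diag_carrier)
  have "pi_diag nr nc a = S * (U * N * V) * T + S * E * T"
    unfolding st(3) M(1) using c UNV E(1)
    by (simp add: mult_add_distrib_mat[of _ nr nr _ nc] add_mult_distrib_mat[of _ nr nc _ _ nc]
        mult_carrier_mat[of _ nr nr _ nc])
  also have "S * (U * N * V) * T = (S * (U * L)) * ?D * (R * (V * T))"
    unfolding lr(3) using U(1) V(1) c by (simp only: mat_dim_simps pi_diag_dim)
  finally have eq: "pi_diag nr nc a = (S * (U * L)) * ?D * (R * (V * T)) + S * E * T" .
  have SUL: "S * (U * L) \<in> carrier_mat nr nr'" "mat_ge 0 (S * (U * L))"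
    using mat_ge_mult[OF g(1) mat_ge_mult[OF U(2) g(3) U(1) c(3)] c(1) mult_carrier_mat[OF U(1) c(3)]] U(1) c
    by simp_all
  have RVT: "R * (V * T) \<in> carrier_mat nc' nc" "mat_ge 0 (R * (V * T))"
    using mat_ge_mult[OF g(4) mat_ge_mult[OF V(2) g(2) V(1) c(2)] c(4) mult_carrier_mat[OF V(1) c(2)]] V(1) c
    by simp_all
  have SET: "S * E * T \<in> carrier_mat nr nc" "mat_ge (k + 1) (S * E * T)"
    using mat_ge_mult[OF mat_ge_mult[OF g(1) E(2) c(1) E(1)] g(2) mult_carrier_mat[OF c(1) E(1)] c(2)] E(1) c
    by simp_all
  show ?thesis by (rule count_le_mono[OF eq SUL RVT SET len])
qed

text \<open>Monotonicity in both directions, with identity factors and zero error.\<close>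

lemma count_le_unique:
  assumes "equivalent nr nc M (pi_diag nr nc a)" "equivalent nr nc M (pi_diag nr nc b)"
    and "M \<in> carrier_mat nr nc" "length a \<le> nr" "length a \<le> nc" "length b \<le> nr" "length b \<le> nc"
  shows "count_le k a = count_le k b"
proof -
  have M: "M = 1\<^sub>m nr * M * 1\<^sub>m nc + 0\<^sub>m nr nc" using assms(3) by simp
  show ?thesis
    using count_le_mono_equivalent[OF M assms(1,2) one_carrier_mat mat_ge_one one_carrier_mat mat_ge_one]
      count_le_mono_equivalent[OF M assms(2,1) one_carrier_mat mat_ge_one one_carrier_mat mat_ge_one]
      assms(4-) mat_ge_zero by (metis le_antisym zero_carrier_mat)
qed

lemma pi_diag_mult_uminus:
  assumes "length ks = n"
  shows "pi_diag n n ks * pi_diag n n (map uminus ks) = 1\<^sub>m n"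
proof (rule eq_matI)
  fix i j assume "i < dim_row (1\<^sub>m n :: 'k mat)" "j < dim_col (1\<^sub>m n :: 'k mat)"
  then have ij: "i < n" "j < n" by auto
  let ?E = "pi_diag n n (map uminus ks)"
  have "(pi_diag n n ks * ?E) $$ (i, j) = (pi_diag n n ks *\<^sub>v col ?E j) $ i"
    using ij by simp
  also have "\<dots> = (if i < n \<and> i < length ks then \<pi> powi (ks ! i) * col ?E j $ i else 0)"
    by (rule pi_diag_mult_vec[OF _ ij(1)]) (simp add: carrier_vecI)
  also have "\<dots> = 1\<^sub>m n $$ (i, j)"
    using ij assms powi_add[of "ks ! i" "- (ks ! i)"] by (auto simp: pi_diag_index)
  finally show "(pi_diag n n ks * ?E) $$ (i, j) = 1\<^sub>m n $$ (i, j)" .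
qed simp_all

text \<open>Inverting the product negates the exponents and exchanges the outer factors. Negation
  reverses a sorted list, which is harmless because only counts are taken.\<close>

lemma equivalent_inverse:
  assumes A: "equivalent n n A (pi_diag n n ks)" "A \<in> carrier_mat n n"
    and Ai: "Ai \<in> carrier_mat n n" "A * Ai = 1\<^sub>m n" and len: "length ks = n"
  shows "equivalent n n Ai (pi_diag n n (map uminus ks))"
proof -
  obtain U U' V V' where uv: "unimodular_pair n U U'" "unimodular_pair n V V'" "A = U * pi_diag n n ks * V"
    using A(1) unfolding equivalent_def by blast
  have c: "U \<in> carrier_mat n n" "U' \<in> carrier_mat n n" "V \<in> carrier_mat n n" "V' \<in> carrier_mat n n"
    and e: "U' * U = 1\<^sub>m n" "U * U' = 1\<^sub>m n" "V' * V = 1\<^sub>m n" "V * V' = 1\<^sub>m n"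
    using uv(1,2) unfolding unimodular_pair_def by blast+
  let ?D = "pi_diag n n ks" and ?E = "pi_diag n n (map uminus ks)"
  have "A * (V' * ?E * U') = U * (?D * ((V * V') * (?E * U')))"
    unfolding uv(3) using c by (simp only: mat_dim_simps pi_diag_dim)
  also have "\<dots> = U * ((?D * ?E) * U')" using c e by (simp only: mat_dim_simps pi_diag_dim)
  also have "\<dots> = 1\<^sub>m n" using c e pi_diag_mult_uminus[OF len] by simp
  finally have inv: "A * (V' * ?E * U') = 1\<^sub>m n" .
  have "Ai * A = 1\<^sub>m n" by (rule mat_mult_left_right_inverse[OF A(2) Ai])
  have E: "V' * ?E * U' \<in> carrier_mat n n"
    by (intro mult_carrier_mat[of _ n n] pi_diag_carrier c)
  have "Ai = Ai * (A * (V' * ?E * U'))" using Ai(1) inv by simp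
  also have "\<dots> = (Ai * A) * (V' * ?E * U')" by (rule assoc_mult_mat[symmetric, OF Ai(1) A(2) E])
  also have "\<dots> = V' * ?E * U'" using left_mult_one_mat[OF E] \<open>Ai * A = 1\<^sub>m n\<close> by simp
  finally have "Ai = V' * ?E * U'" .
  then show ?thesis
    by (rule equivalentI[OF unimodular_pair_sym[OF uv(2)] unimodular_pair_sym[OF uv(1)]])
qed

end

section \<open>Rank\<close>

lemma rank_le_card_cols:
  assumes "A \<in> carrier_mat nr nc"
  shows "mat_rank A \<le> card (set (cols A))"
proof -
  interpret vec_space "TYPE('a)" nr .
  obtain S where S: "maximal S (\<lambda>T. T \<subseteq> set (cols A) \<and> lin_indpt T)"
    using maximal_exists_superset[of "set (cols A)" "\<lambda>T. T \<subseteq> set (cols A) \<and> lin_indpt T" "{}"] 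
    by (auto simp: lin_dep_def)
  have "mat_rank A = card S" using rank_card_indpt[OF assms S] assms unfolding mat_rank_def by simp
  then show ?thesis using S unfolding maximal_def by (simp add: card_mono)
qed

lemma full_column_rank_injective:
  assumes A: "A \<in> carrier_mat nr nc" and rank: "mat_rank A = nc"
    and v: "v \<in> carrier_vec nc" "A *\<^sub>v v = 0\<^sub>v nr"
  shows "v = 0\<^sub>v nc"
proof -
  interpret vec_space "TYPE('a)" nr .
  \<comment> \<open>Independence is a property of the set of columns, so repetitions must be
    excluded: the rank is at most the number of different columns.\<close>
  have dist: "distinct (cols A)"
    using rank_le_card_cols[OF A] rank A card_length[of "cols A"] by (intro card_distinct) simp
  have "lin_indpt (set (cols A))"
    using full_rank_lin_indpt[OF A _ dist] rank A unfolding mat_rank_def by simp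
  then show ?thesis using lin_depI[OF A v(1) _ v(2) dist] by blast
qed

text \<open>Full row rank makes \<open>A\<close> surjective, so each coordinate of \<open>v\<close>
  is some \<open>v \<bullet> (A *\<^sub>v x)\<close>, which transposition turns into a product with
  \<open>A\<^sup>T *\<^sub>v v\<close>.\<close>

lemma full_row_rank_transpose_injective:
  fixes A :: "'a::field mat"
  assumes A: "A \<in> carrier_mat nr nc" and rank: "mat_rank A = nr"
    and v: "v \<in> carrier_vec nr" "A\<^sup>T *\<^sub>v v = 0\<^sub>v nc"
  shows "v = 0\<^sub>v nr"
proof (rule eq_vecI)
  interpret vec_space "TYPE('a)" nr .
  obtain S where S: "finite S" "maximal S (\<lambda>T. T \<subseteq> set (cols A) \<and> lin_indpt T)"
    using maximal_exists_superset[of "set (cols A)" "\<lambda>T. T \<subseteq> set (cols A) \<and> lin_indpt T" "{}"] 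
    by (auto simp: lin_dep_def)
  then have S': "S \<subseteq> set (cols A)" "lin_indpt S" unfolding maximal_def by auto
  have cols: "set (cols A) \<subseteq> carrier_vec nr" using A cols_dim by blast
  have "card S = dim" using rank_card_indpt[OF A S(2)] rank A dim_is_n unfolding mat_rank_def by simp
  then have "basis S" using dim_li_is_basis[OF fin_dim S(1) _ S'(2)] S'(1) cols by auto
  then have "carrier_vec nr \<subseteq> span (set (cols A))"
    using span_is_monotone[OF S'(1)] unfolding basis_def by auto
  then have surj: "\<exists>x\<in>carrier_vec nc. A *\<^sub>v x = y" if "y \<in> carrier_vec nr" for y
    using that col_space_eq[OF A] A unfolding col_space_def by auto
  fix i assume "i < dim_vec (0\<^sub>v nr :: 'a vec)"
  then have i: "i < nr" by simp
  obtain x where x: "x \<in> carrier_vec nc" "A *\<^sub>v x = unit_vec nr i" using surj[of "unit_vec nr i"] by auto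
  have "v $ i = v \<bullet> (A *\<^sub>v x)" unfolding x(2) using v(1) i by simp
  also have "\<dots> = (A\<^sup>T *\<^sub>v v) \<bullet> x" using transpose_vec_mult_scalar[OF A x(1) v(1)] by simp
  also have "\<dots> = 0" unfolding v(2) using x(1) by simp
  finally show "v $ i = 0\<^sub>v nr $ i" using i by simp
qed (use v in simp)

lemma mat_rank_left_invertible:
  fixes N :: "'a::field mat"
  assumes N: "N \<in> carrier_mat nr l" and L: "L \<in> carrier_mat l nr" "L * N = 1\<^sub>m l"
  shows "mat_rank N = l"
proof -
  interpret vec_space "TYPE('a)" nr .
  have inj: "v = 0\<^sub>v l" if v: "v \<in> carrier_vec l" "N *\<^sub>v v = 0\<^sub>v nr" for v
  proof -
    have "v = (L * N) *\<^sub>v v" unfolding L(2) using v(1) by simp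
    also have "\<dots> = L *\<^sub>v 0\<^sub>v nr" unfolding assoc_mult_mat_vec[OF L(1) N v(1)] v(2) ..
    also have "\<dots> = 0\<^sub>v l" using L(1) by (intro eq_vecI) auto
    finally show ?thesis .
  qed
  have dist: "distinct (cols N)"
  proof (rule ccontr)
    assume "\<not> distinct (cols N)"
    then obtain i j where ij: "i < l" "j < l" "i \<noteq> j" "col N i = col N j"
      using N by (auto simp: distinct_conv_nth)
    have "col (L * N) i = col (L * N) j"
      using ij N L(1) by (simp add: col_mult2[OF L(1) N])
    then have "(1\<^sub>m l :: 'a mat) $$ (i, i) = 1\<^sub>m l $$ (i, j)"
      unfolding L(2) using ij by (metis index_one_mat(2,3) index_col)
    then show False using ij by simp
  qed
  have "lin_indpt (set (cols N))"
    using lin_depE[OF N _ dist] inj by metis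
  then show ?thesis using lin_indpt_full_rank[OF N dist] N unfolding mat_rank_def by simp
qed

text \<open>Each matrix is the other times a right factor, so the column spaces agree.\<close>

lemma mat_rank_eqI:
  fixes M N :: "'a::field mat"
  assumes M: "M \<in> carrier_mat nr nc" and N: "N \<in> carrier_mat nr l"
    and X: "X \<in> carrier_mat l nc" "M = N * X" and Y: "Y \<in> carrier_mat nc l" "N = M * Y"
  shows "mat_rank M = mat_rank N"
proof -
  interpret vec_space "TYPE('a)" nr .
  have "\<exists>w\<in>carrier_vec l. N *\<^sub>v w = M *\<^sub>v v" if v: "v \<in> carrier_vec nc" for v
    using assoc_mult_mat_vec[OF N X(1) v] X v by (intro bexI[of _ "X *\<^sub>v v"]) auto
  moreover have "\<exists>v\<in>carrier_vec nc. M *\<^sub>v v = N *\<^sub>v w" if w: "w \<in> carrier_vec l" for w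
    using assoc_mult_mat_vec[OF M Y(1) w] Y w by (intro bexI[of _ "Y *\<^sub>v w"]) auto
  ultimately have "col_space M = col_space N"
    unfolding col_space_eq[OF M] col_space_eq[OF N] using M N by fastforce
  then have "rank M = rank N" unfolding vec_space.rank_def col_space_def by simp
  then show ?thesis using M N unfolding mat_rank_def by simp
qed

lemma rect_diag_mult:
  fixes xs ys :: "'a::semiring_0 list"
  assumes "length xs \<le> b"
  shows "rect_diag a b xs * rect_diag b c ys = rect_diag a c (map2 (*) xs ys)"
proof (rule eq_matI)
  fix i j assume "i < dim_row (rect_diag a c (map2 (*) xs ys))" "j < dim_col (rect_diag a c (map2 (*) xs ys))"
  then have ij: "i < a" "j < c" by (simp_all add: rect_diag_def)
  have "(rect_diag a b xs * rect_diag b c ys) $$ (i, j)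
      = (\<Sum>k<b. rect_diag a b xs $$ (i, k) * rect_diag b c ys $$ (k, j))"
    using ij by (simp add: rect_diag_def scalar_prod_def atLeast0LessThan)
  also have "\<dots> = (\<Sum>k<b. if k = i then (if i = j \<and> i < length xs \<and> i < length ys then xs ! i * ys ! i else 0) else 0)"
    using ij by (intro sum.cong) (auto simp: rect_diag_def)
  also have "\<dots> = rect_diag a c (map2 (*) xs ys) $$ (i, j)"
    using ij assms by (auto simp: rect_diag_def)
  finally show "(rect_diag a b xs * rect_diag b c ys) $$ (i, j) = rect_diag a c (map2 (*) xs ys) $$ (i, j)" .
qed (simp_all add: rect_diag_def)

text \<open>The columns of \<open>U * E\<close> span the column space, because the nonzero entries
  of \<open>ds\<close> can be divided out, and they are independent, because \<open>E' * U'\<close>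
  inverts \<open>U * E\<close> from the left.\<close>

lemma mat_rank_rect_diag:
  fixes U U' V V' :: "'a::field mat"
  assumes U: "U \<in> carrier_mat nr nr" "U' \<in> carrier_mat nr nr" "U' * U = 1\<^sub>m nr"
    and V: "V \<in> carrier_mat nc nc" "V' \<in> carrier_mat nc nc" "V * V' = 1\<^sub>m nc"
    and ds: "length ds \<le> nr" "length ds \<le> nc" "\<forall>d\<in>set ds. d \<noteq> 0"
  shows "mat_rank (U * rect_diag nr nc ds * V) = length ds"
proof -
  let ?l = "length ds"
  have car: "rect_diag a b xs \<in> carrier_mat a b" for a b and xs :: "'a list"
    unfolding rect_diag_def by simp
  define E where "E = rect_diag nr ?l (replicate ?l (1::'a))"
  define F where "F = rect_diag ?l nc ds"
  define F' where "F' = rect_diag nc ?l (map inverse ds)"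
  define E' where "E' = rect_diag ?l nr (replicate ?l (1::'a))"
  have c: "E \<in> carrier_mat nr ?l" "F \<in> carrier_mat ?l nc" "F' \<in> carrier_mat nc ?l" "E' \<in> carrier_mat ?l nr"
    unfolding E_def F_def F'_def E'_def by (rule car)+
  have ones: "rect_diag ?l ?l (replicate ?l (1::'a)) = 1\<^sub>m ?l"
    unfolding rect_diag_def by (intro eq_matI) auto
  have "map2 (*) (replicate ?l (1::'a)) ds = ds" by (intro nth_equalityI) auto
  then have DEF: "rect_diag nr nc ds = E * F"
    unfolding E_def F_def by (subst rect_diag_mult) simp_all
  have "map2 (*) ds (map inverse ds) = replicate ?l 1" using ds(3) by (intro nth_equalityI) auto
  then have EDF: "E = rect_diag nr nc ds * F'"
    unfolding E_def F'_def by (subst rect_diag_mult) (use ds in simp_all)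
  have "map2 (*) (replicate ?l (1::'a)) (replicate ?l 1) = replicate ?l 1" by (intro nth_equalityI) auto
  then have EE: "E' * E = 1\<^sub>m ?l"
    unfolding E_def E'_def by (subst rect_diag_mult) (use ds ones in simp_all)
  let ?M = "U * rect_diag nr nc ds * V"
  have M: "?M \<in> carrier_mat nr nc" by (rule mult_carrier_mat[OF mult_carrier_mat[OF U(1) car] V(1)])
  have N: "U * E \<in> carrier_mat nr ?l" by (rule mult_carrier_mat[OF U(1) c(1)])
  have "?M = (U * E) * (F * V)"
    unfolding DEF assoc_mult_mat[OF U(1) c(1,2), symmetric] by (rule assoc_mult_mat[OF N c(2) V(1)])
  moreover have "U * E = ?M * (V' * F')"
  proof -
    have "?M * (V' * F') = U * rect_diag nr nc ds * ((V * V') * F')"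
      using assoc_mult_mat[OF mult_carrier_mat[OF U(1) car] V(1) mult_carrier_mat[OF V(2) c(3)]]
        assoc_mult_mat[OF V(1,2) c(3)] by simp
    also have "\<dots> = U * E" unfolding V(3) left_mult_one_mat[OF c(3)] EDF
      by (rule assoc_mult_mat[OF U(1) car c(3)])
    finally show ?thesis by simp
  qed
  ultimately have "mat_rank ?M = mat_rank (U * E)"
    using mat_rank_eqI[OF M N mult_carrier_mat[OF c(2) V(1)] _ mult_carrier_mat[OF V(2) c(3)]] by blast
  also have "\<dots> = ?l"
  proof (rule mat_rank_left_invertible[OF N mult_carrier_mat[OF c(4) U(2)]])
    have "E' * U' * (U * E) = E' * ((U' * U) * E)"
      using assoc_mult_mat[OF c(4) U(2) N] assoc_mult_mat[OF U(2,1) c(1)] by simp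
    then show "E' * U' * (U * E) = 1\<^sub>m ?l" unfolding U(3) left_mult_one_mat[OF c(1)] EE .
  qed
  finally show ?thesis .
qed

context dvr begin

lemma mat_rank_equivalent_pi_diag:
  assumes "equivalent nr nc M (pi_diag nr nc ks)" "length ks \<le> nr" "length ks \<le> nc"
  shows "mat_rank M = length ks"
proof -
  obtain U U' V V' where uv: "unimodular_pair nr U U'" "unimodular_pair nc V V'" "M = U * pi_diag nr nc ks * V"
    using assms(1) unfolding equivalent_def by blast
  have "mat_rank (U * rect_diag nr nc (map (\<lambda>k. \<pi> powi k) ks) * V) = length (map (\<lambda>k. \<pi> powi k) ks)"
    by (rule mat_rank_rect_diag[of _ _ U' _ _ V'])
      (use uv(1,2) assms(2,3) pi_nonzero in \<open>auto simp: unimodular_pair_def\<close>)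
  then show ?thesis unfolding uv(3) pi_diag_def by simp
qed

lemma exists_orders:
  assumes "M \<in> carrier_mat nr nc"
  shows "\<exists>ks. sorted ks \<and> length ks = mat_rank M \<and> length ks \<le> nr \<and> length ks \<le> nc \<and>
    equivalent nr nc M (pi_diag nr nc ks)"
proof -
  obtain w where "mat_ge w M" using exists_mat_ge by blast
  then obtain ks where "sorted ks" "length ks \<le> nr" "length ks \<le> nc" "equivalent nr nc M (pi_diag nr nc ks)"
    using smith_form[OF assms] by blast
  then show ?thesis using mat_rank_equivalent_pi_diag by metis
qed


lemma vec_ge_append: "vec_ge k (v @\<^sub>v w) \<longleftrightarrow> vec_ge k v \<and> vec_ge k w"
proof
  assume a: "vec_ge k (v @\<^sub>v w)"
  have "vge k (w $ i)" if "i < dim_vec w" for i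
    using a that unfolding vec_ge_def by (auto dest: spec[of _ "dim_vec v + i"])
  moreover have "vge k (v $ i)" if "i < dim_vec v" for i
    using a that unfolding vec_ge_def by (auto dest: spec[of _ i])
  ultimately show "vec_ge k v \<and> vec_ge k w" unfolding vec_ge_def by blast
next
  assume "vec_ge k v \<and> vec_ge k w"
  then show "vec_ge k (v @\<^sub>v w)" unfolding vec_ge_def by auto
qed

lemma mat_ge_0_mult:
  "mat_ge 0 M \<Longrightarrow> mat_ge 0 N \<Longrightarrow> M \<in> carrier_mat nr k \<Longrightarrow> N \<in> carrier_mat k nc \<Longrightarrow> mat_ge 0 (M * N)"
  using mat_ge_mult[of 0 M 0 N nr k nc] by simp

lemma mat_ge_0_mult_vec:
  "mat_ge 0 M \<Longrightarrow> vec_ge k v \<Longrightarrow> M \<in> carrier_mat nr nc \<Longrightarrow> v \<in> carrier_vec nc \<Longrightarrow> vec_ge k (M *\<^sub>v v)"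
  using mat_ge_mult_vec[of 0 M k v nr nc] by simp

end

section \<open>Minimal realizations\<close>

text \<open>\<open>X\<close>, \<open>Y\<close> and \<open>X'\<close>, \<open>Y'\<close> are Bezout cofactors: they witness that \<open>A\<close> and \<open>B\<close> are left coprime
  and that \<open>A\<close> and \<open>C\<close> are right coprime, i.e. that the realization is minimal.\<close>

locale minimal_realization = dvr \<O> \<pi> for \<O> :: "'k::field set" and \<pi> +
  fixes n p m :: nat and A B C D Ai X Y X' Y' :: "'k mat"
  assumes A: "A \<in> carrier_mat n n" and B: "B \<in> carrier_mat n m" and C: "C \<in> carrier_mat p n"
    and D: "D \<in> carrier_mat p m" and Ai: "Ai \<in> carrier_mat n n"
    and X: "X \<in> carrier_mat n n" and Y: "Y \<in> carrier_mat m n"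
    and X': "X' \<in> carrier_mat n n" and Y': "Y' \<in> carrier_mat n p"
    and geA: "mat_ge 0 A" and geB: "mat_ge 0 B" and geC: "mat_ge 0 C" and geD: "mat_ge 0 D"
    and geX: "mat_ge 0 X" and geY: "mat_ge 0 Y" and geX': "mat_ge 0 X'" and geY': "mat_ge 0 Y'"
    and AAi: "A * Ai = 1\<^sub>m n" and AiA: "Ai * A = 1\<^sub>m n"
    and left_coprime: "A * X + B * Y = 1\<^sub>m n" and right_coprime: "X' * A + Y' * C = 1\<^sub>m n"
begin

lemmas carriers = A B C D Ai X Y X' Y'

definition H where "H = D + C * Ai * B"
definition P where "P = four_block_mat A B (- C) D"

lemma H: "H \<in> carrier_mat p m" unfolding H_def using carriers by simp
lemma P: "P \<in> carrier_mat (n + p) (n + m)" unfolding P_def using A D by (rule four_block_carrier_mat)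

lemma geP: "mat_ge 0 P"
  unfolding P_def by (rule mat_ge_four_block[OF geA geB mat_ge_uminus[OF geC] geD A B _ D]) (use C in simp)

lemma inverse_from_transfer: "\<exists>E\<in>carrier_mat n n. mat_ge 0 E \<and> Ai = Y' * H * Y + E"
proof -
  \<comment> \<open>From expanding \<open>(X' * A + Y' * C) * (Ai * (A * X + B * Y))\<close>. The
    term \<open>Y' * (C * (Ai * (B * Y)))\<close> is \<open>Y' * H * Y\<close> minus
    \<open>Y' * (D * Y)\<close>; the remaining terms reduce to \<open>X\<close> and
    \<open>X' - X' * (A * X)\<close> by cancelling \<open>Ai\<close> and using coprimeness, so they
    are integral.\<close>
  define E where "E = X' + X - X' * (A * X) - Y' * (D * Y)"
  note AX = mat_ge_0_mult[OF geA geX A X] mult_carrier_mat[OF A X]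
  note DY = mat_ge_0_mult[OF geD geY D Y] mult_carrier_mat[OF D Y]
  note X'AX = mat_ge_0_mult[OF geX' AX(1) X' AX(2)] mult_carrier_mat[OF X' AX(2)]
  note Y'DY = mat_ge_0_mult[OF geY' DY(1) Y' DY(2)] mult_carrier_mat[OF Y' DY(2)]
  have E: "E \<in> carrier_mat n n"
    unfolding E_def by (intro minus_carrier_mat Y'DY(2))
  have "mat_ge 0 E" unfolding E_def
    by (rule mat_ge_diff[OF mat_ge_diff[OF mat_ge_add[OF geX' geX X' X] X'AX(1) add_carrier_mat[OF X] X'AX(2)]
        Y'DY(1) minus_carrier_mat[OF X'AX(2)] Y'DY(2)])
  moreover have "Ai = Y' * H * Y + E"
  proof -
    have f: "Ai = (X' * A + Y' * C) * (Ai * (A * X + B * Y))"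
      unfolding left_coprime right_coprime using Ai by simp
    have 1: "Ai * (A * X + B * Y) = Ai * (A * X) + Ai * (B * Y)"
      using carriers by (simp only: mat_dim_simps)
    have e: "Ai = (X' * (A * (Ai * (A * X))) + Y' * (C * (Ai * (A * X))))
        + (X' * (A * (Ai * (B * Y))) + Y' * (C * (Ai * (B * Y))))"
      by (subst f, unfold 1, use carriers in \<open>simp only: mat_dim_simps\<close>)
    have "Ai * (A * X) = (Ai * A) * X" using carriers by (simp only: mat_dim_simps)
    then have a1: "Ai * (A * X) = X" using AiA X by simp
    have "A * (Ai * (B * Y)) = (A * Ai) * (B * Y)" using carriers by (simp only: mat_dim_simps)
    then have a2: "A * (Ai * (B * Y)) = B * Y" using AAi B Y by simp
    have e2: "Ai = (X' * (A * X) + Y' * (C * X)) + (X' * (B * Y) + Y' * (C * (Ai * (B * Y))))"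
      using e unfolding a1 a2 .
    have "X' * (A * X) + X' * (B * Y) = X' * (A * X + B * Y)"
      using carriers by (simp only: mat_dim_simps)
    then have e3: "X' * (A * X) + X' * (B * Y) = X'" unfolding left_coprime using X' by simp
    have "X' * (A * X) + Y' * (C * X) = (X' * A + Y' * C) * X"
      using carriers by (simp only: mat_dim_simps)
    then have e4: "X' * (A * X) + Y' * (C * X) = X" unfolding right_coprime using X by simp
    have e5: "Y' * H * Y = Y' * (D * Y) + Y' * (C * (Ai * (B * Y)))"
      unfolding H_def using carriers by (simp only: mat_dim_simps)
    have generic: "a = (d + w) + (x' + z - q - d)"
      if "a = z + (u + w)" "q + u = x'" 
        "z \<in> carrier_mat n n" "u \<in> carrier_mat n n" "d \<in> carrier_mat n n" "w \<in> carrier_mat n n" "q \<in> carrier_mat n n"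
      for a x' u d w q z :: "'k mat"
      using that(3-) unfolding that(1) that(2)[symmetric] by (intro eq_matI) auto
    have car: "X' * (B * Y) \<in> carrier_mat n n" "Y' * (C * (Ai * (B * Y))) \<in> carrier_mat n n"
      using mult_carrier_mat[OF X' mult_carrier_mat[OF B Y]]
        mult_carrier_mat[OF Y' mult_carrier_mat[OF C mult_carrier_mat[OF Ai mult_carrier_mat[OF B Y]]]] .
    show ?thesis unfolding e5 E_def
      by (rule generic[OF e2[unfolded e4] e3 X car(1) Y'DY(2) car(2) X'AX(2)])
  qed
  ultimately show ?thesis using E by blast
qed

text \<open>Elimination of the state: x + A^-1 B y = A^-1 (A x + B y). The bracket on the right is
  the lower component of \<open>P\<close> applied to \<open>x @\<^sub>v y\<close>, and the
  correction vanishes when the upper component does.\<close>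

lemma transfer_mult_vec:
  assumes x: "x \<in> carrier_vec n" and y: "y \<in> carrier_vec m"
  shows "H *\<^sub>v y = (- C *\<^sub>v x + D *\<^sub>v y) + C *\<^sub>v (Ai *\<^sub>v (A *\<^sub>v x + B *\<^sub>v y))"
proof -
  have "Ai *\<^sub>v (A *\<^sub>v x + B *\<^sub>v y) = (Ai * A) *\<^sub>v x + Ai *\<^sub>v (B *\<^sub>v y)"
    using carriers x y by (simp only: mat_dim_simps)
  also have "(Ai * A) *\<^sub>v x = x" using x AiA by simp
  finally have 1: "C *\<^sub>v (Ai *\<^sub>v (A *\<^sub>v x + B *\<^sub>v y)) = C *\<^sub>v x + C *\<^sub>v (Ai *\<^sub>v (B *\<^sub>v y))"
    using carriers x y by (simp only: mat_dim_simps)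
  have 2: "H *\<^sub>v y = D *\<^sub>v y + C *\<^sub>v (Ai *\<^sub>v (B *\<^sub>v y))"
    unfolding H_def using carriers y by (simp only: mat_dim_simps)
  have c: "C *\<^sub>v x \<in> carrier_vec p" "D *\<^sub>v y \<in> carrier_vec p" "C *\<^sub>v (Ai *\<^sub>v (B *\<^sub>v y)) \<in> carrier_vec p"
    using mult_mat_vec_carrier[OF C x] mult_mat_vec_carrier[OF D y]
      mult_mat_vec_carrier[OF C mult_mat_vec_carrier[OF Ai mult_mat_vec_carrier[OF B y]]] .
  have generic: "d + w = (- c + d) + (c + w)"
    if "c \<in> carrier_vec p" "d \<in> carrier_vec p" "w \<in> carrier_vec p" for c d w :: "'k vec"
    using that by (intro eq_vecI) auto
  show ?thesis unfolding 1 2 mult_mat_vec_uminus[OF C x] by (rule generic[OF c])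
qed

text \<open>Subtracting \<open>Y f\<close> from \<open>y\<close> removes the term \<open>C A\<^sup>-\<^sup>1 f\<close>, which need not be integral.\<close>

lemma transfer_mult_vec_corrected:
  assumes x: "x \<in> carrier_vec n" and y: "y \<in> carrier_vec m"
    and f_def: "f = A *\<^sub>v x + B *\<^sub>v y" and g_def: "g = - C *\<^sub>v x + D *\<^sub>v y"
  shows "H *\<^sub>v (y - Y *\<^sub>v f) = g + (C *\<^sub>v (X *\<^sub>v f) - D *\<^sub>v (Y *\<^sub>v f))"
proof -
  have f: "f \<in> carrier_vec n" and g: "g \<in> carrier_vec p"
    unfolding f_def g_def using carriers x y by simp_all
  have Yf: "Y *\<^sub>v f \<in> carrier_vec m" using Y f by simp
  have Xf: "X *\<^sub>v f \<in> carrier_vec n" using X f by simp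
  have "(A * X + B * Y) *\<^sub>v f = A *\<^sub>v (X *\<^sub>v f) + B *\<^sub>v (Y *\<^sub>v f)"
    using carriers f by (simp only: mat_dim_simps)
  then have f_eq: "A *\<^sub>v (X *\<^sub>v f) + B *\<^sub>v (Y *\<^sub>v f) = f" unfolding left_coprime using f by simp
  \<comment> \<open>The pair of \<open>X *\<^sub>v f\<close> and \<open>Y *\<^sub>v f\<close> has
    upper component exactly \<open>f\<close>, hence produces the same term
    \<open>C *\<^sub>v (Ai *\<^sub>v f)\<close>; it cancels in the difference.\<close>
  have 1: "H *\<^sub>v (Y *\<^sub>v f) = (- C *\<^sub>v (X *\<^sub>v f) + D *\<^sub>v (Y *\<^sub>v f)) + C *\<^sub>v (Ai *\<^sub>v f)"
    using transfer_mult_vec[OF Xf Yf] unfolding f_eq .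
  have 2: "H *\<^sub>v y = g + C *\<^sub>v (Ai *\<^sub>v f)"
    using transfer_mult_vec[OF x y] unfolding f_def g_def .
  have c: "C *\<^sub>v (X *\<^sub>v f) \<in> carrier_vec p" "D *\<^sub>v (Y *\<^sub>v f) \<in> carrier_vec p" "C *\<^sub>v (Ai *\<^sub>v f) \<in> carrier_vec p"
    using mult_mat_vec_carrier[OF C Xf] mult_mat_vec_carrier[OF D Yf]
      mult_mat_vec_carrier[OF C mult_mat_vec_carrier[OF Ai f]] .
  have generic: "(g + w) - ((- c + d) + w) = g + (c - d)"
    if "c \<in> carrier_vec p" "d \<in> carrier_vec p" "w \<in> carrier_vec p" "g \<in> carrier_vec p" for c d w g :: "'k vec"
    using that by (intro eq_vecI) auto
  have "H *\<^sub>v (y - Y *\<^sub>v f) = H *\<^sub>v y - H *\<^sub>v (Y *\<^sub>v f)"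
    using H y Yf by (simp only: mat_dim_simps)
  also have "\<dots> = g + (C *\<^sub>v (X *\<^sub>v f) - D *\<^sub>v (Y *\<^sub>v f))"
    unfolding 1 2 mult_mat_vec_uminus[OF C Xf] by (rule generic[OF c g])
  finally show ?thesis .
qed

text \<open>Right coprimeness recovers \<open>x\<close> from A x = f - B y and C x = D y - g.
  Consequently \<open>x\<close> vanishes modulo \<pi> as soon as \<open>f\<close>, \<open>g\<close>
  and \<open>y\<close> do.\<close>

lemma state_from_output:
  assumes x: "x \<in> carrier_vec n" and y: "y \<in> carrier_vec m"
    and f_def: "f = A *\<^sub>v x + B *\<^sub>v y" and g_def: "g = - C *\<^sub>v x + D *\<^sub>v y"
  shows "x = X' *\<^sub>v (f - B *\<^sub>v y) + Y' *\<^sub>v (D *\<^sub>v y - g)"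
proof -
  have c: "C *\<^sub>v x \<in> carrier_vec p" "D *\<^sub>v y \<in> carrier_vec p"
    and a: "A *\<^sub>v x \<in> carrier_vec n" "B *\<^sub>v y \<in> carrier_vec n"
    using mult_mat_vec_carrier[OF C x] mult_mat_vec_carrier[OF D y]
      mult_mat_vec_carrier[OF A x] mult_mat_vec_carrier[OF B y] .
  have "v + w - w = v" if "v \<in> carrier_vec n" "w \<in> carrier_vec n" for v w :: "'k vec"
    using that by (intro eq_vecI) auto
  from this[OF a] have 1: "f - B *\<^sub>v y = A *\<^sub>v x" unfolding f_def .
  have "w - (- v + w) = v" if "v \<in> carrier_vec p" "w \<in> carrier_vec p" for v w :: "'k vec"
    using that by (intro eq_vecI) auto
  from this[OF c] have 2: "D *\<^sub>v y - g = C *\<^sub>v x" unfolding g_def mult_mat_vec_uminus[OF C x] .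
  have "(X' * A + Y' * C) *\<^sub>v x = X' *\<^sub>v (A *\<^sub>v x) + Y' *\<^sub>v (C *\<^sub>v x)"
    using carriers x by (simp only: mat_dim_simps)
  then show ?thesis unfolding 1 2 right_coprime using x by simp
qed

end

lemma zero_mat_mult_vec: "w \<in> carrier_vec nc \<Longrightarrow> 0\<^sub>m nr nc *\<^sub>v (w :: 'a::semiring_0 vec) = 0\<^sub>v nr"
  by (intro eq_vecI) (auto simp: scalar_prod_def)

context minimal_realization begin

context
  fixes \<alpha> \<nu> :: "int list"
  assumes orders_A: "equivalent n n A (pi_diag n n \<alpha>)" and len_A: "length \<alpha> = n"
    and orders_H: "equivalent p m H (pi_diag p m \<nu>)" and len_H: "length \<nu> \<le> p" "length \<nu> \<le> m"
begin

lemma count_le_negative: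
  assumes "k < 0"
  shows "count_le k \<nu> = count_le k (map uminus \<alpha>)"
proof (rule antisym)
  have orders_Ai: "equivalent n n Ai (pi_diag n n (map uminus \<alpha>))"
    by (rule equivalent_inverse[OF orders_A A Ai AAi len_A])
  \<comment> \<open>The exponent is \<open>k + 1\<close>, not \<open>k\<close>: a negative
    \<open>k\<close> gives \<open>k + 1 \<le> 0\<close>, so the integral matrices \<open>D\<close>
    and \<open>E\<close> both qualify as errors.\<close>
  have mono: "mat_ge (k + 1) M" if "mat_ge 0 M" for M
    using that vge_mono assms unfolding mat_ge_def by (metis add_le_same_cancel2 zless_imp_add1_zle add.commute)
  have HD: "H = C * Ai * B + D"
    unfolding H_def by (rule comm_add_mat[OF D]) (use carriers in simp)
  show "count_le k \<nu> \<le> count_le k (map uminus \<alpha>)"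
    by (rule count_le_mono_equivalent[OF HD orders_H orders_Ai C geC B geB D mono[OF geD]])
      (use len_A len_H in simp_all)
  obtain E where E: "E \<in> carrier_mat n n" "mat_ge 0 E" "Ai = Y' * H * Y + E"
    using inverse_from_transfer by blast
  show "count_le k (map uminus \<alpha>) \<le> count_le k \<nu>"
    by (rule count_le_mono_equivalent[OF E(3) orders_Ai orders_H Y' geY' Y geY E(1) mono[OF E(2)]])
      (use len_A len_H in simp_all)
qed

context
  fixes \<beta> :: "int list"
  assumes orders_P: "equivalent (n + p) (n + m) P (pi_diag (n + p) (n + m) \<beta>)"
    and len_P: "length \<beta> \<le> n + p" "length \<beta> \<le> n + m"
begin

text \<open>A failure would leave room for a primitive vector with free state \<open>x\<close> and
  with \<open>y'\<close> supported on the orders of \<open>H\<close> up to \<open>k\<close>, mapped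
  by \<open>P\<close> into multiples of \<pi>^(k+1). The transfer function then forces
  \<open>y'\<close> to vanish modulo \<pi>, and right coprimeness forces \<open>x\<close> to vanish
  with it.\<close>

lemma count_le_system_ge:
  assumes k: "0 \<le> k"
  shows "n + count_le k \<nu> \<le> count_le k \<beta>"
proof (rule ccontr)
  assume neg: "\<not> ?thesis"
  obtain U U' V V' where uv: "unimodular_pair p U U'" "unimodular_pair m V V'" "H = U * pi_diag p m \<nu> * V"
    using orders_H unfolding equivalent_def by blast
  have c: "U \<in> carrier_mat p p" "U' \<in> carrier_mat p p" "V \<in> carrier_mat m m" "V' \<in> carrier_mat m m"
    and g: "mat_ge 0 U'" "mat_ge 0 V" "mat_ge 0 V'"
    and e: "U' * U = 1\<^sub>m p" "V * V' = 1\<^sub>m m"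
    using uv(1,2) unfolding unimodular_pair_def by blast+
  obtain S S' T T' where st: "unimodular_pair (n + p) S S'" "unimodular_pair (n + m) T T'"
      "P = S * pi_diag (n + p) (n + m) \<beta> * T"
    using orders_P unfolding equivalent_def by blast
  have cS: "S \<in> carrier_mat (n + p) (n + p)" "T \<in> carrier_mat (n + m) (n + m)"
    and gS: "mat_ge 0 S" "mat_ge 0 T"
    using st(1,2) unfolding unimodular_pair_def by blast+
  \<comment> \<open>The input is chosen in the coordinates \<open>y' = V *\<^sub>v y\<close> that
    diagonalize \<open>H\<close>; \<open>W\<close> converts it back to the input \<open>y\<close> of
    \<open>P\<close>.\<close>
  define W where "W = four_block_mat (1\<^sub>m n) (0\<^sub>m n m) (0\<^sub>m m n) V'"
  have W: "W \<in> carrier_mat (n + m) (n + m)" "mat_ge 0 W"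
    unfolding W_def using c(4) g(3)
    by (auto intro!: mat_ge_four_block[of _ _ _ _ _ n n m m] mat_ge_one mat_ge_zero)
  note TW = mult_carrier_mat[OF cS(2) W(1)] mat_ge_0_mult[OF gS(2) W(2) cS(2) W(1)]
  define J where "J = {j. j < length \<beta> \<and> \<beta> ! j \<le> k}"
  define K where "K = {i. i < length \<nu> \<and> \<nu> ! i \<le> k}"
  define I where "I = {..<n} \<union> (+) n ` K"
  have finK: "finite K" unfolding K_def by simp
  have cardI: "card I = n + card K"
    unfolding I_def using finK by (subst card_Un_disjoint) (auto simp: card_image)
  have "card (row (T * W) ` J) \<le> card J" unfolding J_def by (intro card_image_le) simp
  also have "\<dots> < card I" using neg unfolding cardI J_def K_def count_le_card by simp
  finally have "card (row (T * W) ` J) < card I" .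
  moreover have "finite (row (T * W) ` J)" unfolding J_def by simp
  moreover have "row (T * W) ` J \<subseteq> carrier_vec (n + m)" using W(1) by (auto intro!: carrier_vecI)
  moreover have "I \<subseteq> {..<n + m}" unfolding I_def K_def using len_H by auto
  ultimately obtain v where v: "v \<in> carrier_vec (n + m)" "\<forall>r\<in>row (T * W) ` J. r \<bullet> v = 0" "vec_ge 0 v"
      "\<forall>i<n + m. i \<notin> I \<longrightarrow> v $ i = 0" "\<exists>i\<in>I. \<not> vge 1 (v $ i)"
    using exists_primitive_orthogonal_vec[of "row (T * W) ` J" "n + m" I] by blast
  define x where "x = vec_first v n"
  define y' where "y' = vec_last v m"
  have vxy: "v = x @\<^sub>v y'" unfolding x_def y'_def using v(1) by simp
  have x: "x \<in> carrier_vec n" and y': "y' \<in> carrier_vec m" unfolding x_def y'_def by simp_all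
  have ge_y': "vec_ge 0 y'" using v(3) unfolding vxy vec_ge_append by blast
  define y where "y = V' *\<^sub>v y'"
  have y: "y \<in> carrier_vec m" unfolding y_def by (rule mult_mat_vec_carrier[OF c(4) y'])
  have Vy: "V *\<^sub>v y = y'"
    unfolding y_def assoc_mult_mat_vec[OF c(3,4) y', symmetric] e(2) using y' by simp
  have Wv: "W *\<^sub>v v = x @\<^sub>v y"
    unfolding W_def vxy four_block_mat_mult_vec[OF one_carrier_mat zero_carrier_mat zero_carrier_mat c(4) x y']
    using x y unfolding y_def by (simp add: zero_mat_mult_vec[OF x] zero_mat_mult_vec[OF y'])
  have Wvc: "W *\<^sub>v v \<in> carrier_vec (n + m)" by (rule mult_mat_vec_carrier[OF W(1) v(1)])
  note TWv = mult_mat_vec_carrier[OF TW(1) v(1)]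
  have "vec_ge (k + 1) (pi_diag (n + p) (n + m) \<beta> *\<^sub>v ((T * W) *\<^sub>v v))"
  proof (rule vec_ge_pi_diag_mult[OF TWv])
    show "vec_ge 0 (T * W *\<^sub>v v)" by (rule mat_ge_0_mult_vec[OF TW(2) v(3) TW(1) v(1)])
    fix j assume j: "j < length \<beta>" "j < n + m" "\<beta> ! j < k + 1"
    then have "row (T * W) j \<bullet> v = 0" using v(2) unfolding J_def by auto
    moreover have "(T * W *\<^sub>v v) $ j = row (T * W) j \<bullet> v"
      by (rule index_mult_mat_vec) (use j(2) carrier_matD(1)[OF TW(1)] in linarith)
    ultimately show "(T * W *\<^sub>v v) $ j = 0" by argo
  qed
  from mat_ge_0_mult_vec[OF gS(1) this cS(1) mult_mat_vec_carrier[OF pi_diag_carrier TWv]]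
  have "vec_ge (k + 1) (P *\<^sub>v (x @\<^sub>v y))"
    unfolding st(3) Wv[symmetric] assoc_mult_mat_vec[OF cS(2) W(1) v(1)]
      assoc_mult_mat_vec[OF cS(1) pi_diag_carrier mult_mat_vec_carrier[OF cS(2) Wvc]]
      assoc_mult_mat_vec[OF mult_carrier_mat[OF cS(1) pi_diag_carrier] cS(2) Wvc] .
  moreover define f where "f = A *\<^sub>v x + B *\<^sub>v y"
  moreover define g' where "g' = - C *\<^sub>v x + D *\<^sub>v y"
  ultimately have fg: "vec_ge (k + 1) f" "vec_ge (k + 1) g'"
    unfolding P_def four_block_mat_mult_vec[OF A B uminus_carrier_mat[OF C] D x y] vec_ge_append by blast+
  have f: "f \<in> carrier_vec n"
    unfolding f_def by (rule add_carrier_vec[OF mult_mat_vec_carrier[OF A x] mult_mat_vec_carrier[OF B y]])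
  have g': "g' \<in> carrier_vec p"
    unfolding g'_def by (rule add_carrier_vec[OF mult_mat_vec_carrier[OF uminus_carrier_mat[OF C] x] mult_mat_vec_carrier[OF D y]])
  note Yf = mult_mat_vec_carrier[OF Y f] mat_ge_0_mult_vec[OF geY fg(1) Y f]
  note Xf = mult_mat_vec_carrier[OF X f] mat_ge_0_mult_vec[OF geX fg(1) X f]
  \<comment> \<open>The correction is a multiple of \<pi>^(k+1), so for \<open>k \<ge> 0\<close> it
    does not change \<open>y\<close> modulo \<pi>.\<close>
  let ?u = "y - Y *\<^sub>v f"
  have u: "?u \<in> carrier_vec m" by (rule minus_carrier_vec[OF y Yf(1)])
  note CXf = mult_mat_vec_carrier[OF C Xf(1)] mat_ge_0_mult_vec[OF geC Xf(2) C Xf(1)]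
  note DYf = mult_mat_vec_carrier[OF D Yf(1)] mat_ge_0_mult_vec[OF geD Yf(2) D Yf(1)]
  have Hu: "vec_ge (k + 1) (H *\<^sub>v ?u)"
    unfolding transfer_mult_vec_corrected[OF x y f_def g'_def]
    by (rule vec_ge_add[OF fg(2) vec_ge_diff[OF CXf(2) DYf(2) CXf(1) DYf(1)] g' minus_carrier_vec[OF CXf(1) DYf(1)]])
  note Vu = mult_mat_vec_carrier[OF c(3) u]
  have "H *\<^sub>v ?u = U *\<^sub>v (pi_diag p m \<nu> *\<^sub>v (V *\<^sub>v ?u))"
    unfolding uv(3) assoc_mult_mat_vec[OF mult_carrier_mat[OF c(1) pi_diag_carrier] c(3) u]
      assoc_mult_mat_vec[OF c(1) pi_diag_carrier Vu] ..
  then have "U' *\<^sub>v (H *\<^sub>v ?u) = (U' * U) *\<^sub>v (pi_diag p m \<nu> *\<^sub>v (V *\<^sub>v ?u))"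
    using assoc_mult_mat_vec[OF c(2,1) mult_mat_vec_carrier[OF pi_diag_carrier Vu]] by simp
  also have "\<dots> = pi_diag p m \<nu> *\<^sub>v (V *\<^sub>v ?u)"
    unfolding e(1) by (rule one_mult_mat_vec[OF mult_mat_vec_carrier[OF pi_diag_carrier Vu]])
  finally have diag_u: "vec_ge (k + 1) (pi_diag p m \<nu> *\<^sub>v (V *\<^sub>v ?u))"
    using mat_ge_0_mult_vec[OF g(1) Hu c(2) mult_mat_vec_carrier[OF H u]] by simp
  have Vu_eq: "V *\<^sub>v ?u = y' - V *\<^sub>v (Y *\<^sub>v f)"
    using mult_diff_distrib_mat_vec_dim[of V y "Y *\<^sub>v f"] c(3) y Y Vy by simp
  note VYf = mult_mat_vec_carrier[OF c(3) Yf(1)] mat_ge_0_mult_vec[OF g(2) Yf(2) c(3) Yf(1)]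
  have "vge 1 (y' $ i)" if i: "i < m" for i
  proof (cases "i \<in> K")
    case True
    then have iK: "i < length \<nu>" "\<nu> ! i \<le> k" "i < p" using len_H unfolding K_def by auto
    have "vge (k + 1) ((pi_diag p m \<nu> *\<^sub>v (V *\<^sub>v ?u)) $ i)"
      using diag_u iK(3) unfolding vec_ge_def by simp
    then have "vge (k + 1 - \<nu> ! i) ((V *\<^sub>v ?u) $ i)"
      unfolding pi_diag_mult_vec[OF Vu iK(3)] using iK(1) i by (simp add: vge_powi_mult_iff)
    then have "vge 1 ((V *\<^sub>v ?u) $ i)" by (rule vge_mono) (use iK(2) in simp)
    moreover have "vge 1 ((V *\<^sub>v (Y *\<^sub>v f)) $ i)"
    proof (rule vge_mono)
      show "vge (k + 1) ((V *\<^sub>v (Y *\<^sub>v f)) $ i)"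
        using VYf(2) i unfolding vec_ge_def carrier_vecD[OF VYf(1)] by blast
    qed (use k in simp)
    ultimately have "vge 1 ((V *\<^sub>v ?u) $ i + (V *\<^sub>v (Y *\<^sub>v f)) $ i)" by (rule vge_add)
    moreover have "(V *\<^sub>v ?u) $ i + (V *\<^sub>v (Y *\<^sub>v f)) $ i = y' $ i"
      unfolding Vu_eq using i c(3) y' by (subst index_minus_vec) auto
    ultimately show ?thesis by simp
  next
    case False
    then have "n + i \<notin> I" unfolding I_def by auto
    then have "v $ (n + i) = 0" using v(4) i by simp
    then have "y' $ i = 0" unfolding vxy using x y' i by simp
    then show ?thesis by simp
  qed
  then have y'1: "vec_ge 1 y'" unfolding vec_ge_def using y' by simp
  have y1: "vec_ge 1 y" unfolding y_def by (rule mat_ge_0_mult_vec[OF g(3) y'1 c(4) y'])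
  have f1: "vec_ge 1 f" and g1: "vec_ge 1 g'" using fg vec_ge_mono k by auto
  note By = mult_mat_vec_carrier[OF B y] mat_ge_0_mult_vec[OF geB y1 B y]
  note Dy = mult_mat_vec_carrier[OF D y] mat_ge_0_mult_vec[OF geD y1 D y]
  note fBy = minus_carrier_vec[OF f By(1)] vec_ge_diff[OF f1 By(2) f By(1)]
  note Dyg = minus_carrier_vec[OF Dy(1) g'] vec_ge_diff[OF Dy(2) g1 Dy(1) g']
  have x1: "vec_ge 1 x"
    by (subst state_from_output[OF x y f_def g'_def])
      (rule vec_ge_add[OF mat_ge_0_mult_vec[OF geX' fBy(2) X' fBy(1)] mat_ge_0_mult_vec[OF geY' Dyg(2) Y' Dyg(1)]
        mult_mat_vec_carrier[OF X' fBy(1)] mult_mat_vec_carrier[OF Y' Dyg(1)]])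
  have "vec_ge 1 v" unfolding vxy vec_ge_append using x1 y'1 by blast
  then show False using v(1,5) \<open>I \<subseteq> {..<n + m}\<close> unfolding vec_ge_def by auto
qed

text \<open>A failure would give a primitive vector that satisfies the \<open>n\<close> equations of
  a vanishing upper component and also makes \<open>V *\<^sub>v y\<close> vanish wherever
  \<open>H\<close> has order at most \<open>k\<close>. The lower component is then exactly
  \<open>H *\<^sub>v y\<close>, so \<open>P\<close> maps the vector into multiples of \<pi>^(k+1),
  although it is nonzero modulo \<pi> at some order of \<open>P\<close> up to
  \<open>k\<close>.\<close>

lemma count_le_system_le: "count_le k \<beta> \<le> n + count_le k \<nu>"
proof (rule ccontr)
  assume neg: "\<not> ?thesis"
  obtain U U' V V' where uv: "unimodular_pair p U U'" "unimodular_pair m V V'" "H = U * pi_diag p m \<nu> * V"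
    using orders_H unfolding equivalent_def by blast
  have c: "U \<in> carrier_mat p p" "V \<in> carrier_mat m m" and g: "mat_ge 0 U" "mat_ge 0 V"
    using uv(1,2) unfolding unimodular_pair_def by blast+
  obtain S S' T T' where st: "unimodular_pair (n + p) S S'" "unimodular_pair (n + m) T T'"
      "P = S * pi_diag (n + p) (n + m) \<beta> * T"
    using orders_P unfolding equivalent_def by blast
  have cS: "S \<in> carrier_mat (n + p) (n + p)" "S' \<in> carrier_mat (n + p) (n + p)"
      "T \<in> carrier_mat (n + m) (n + m)" "T' \<in> carrier_mat (n + m) (n + m)"
    and gS: "mat_ge 0 S'" "mat_ge 0 T'" and eS: "S' * S = 1\<^sub>m (n + p)" "T * T' = 1\<^sub>m (n + m)"
    using st(1,2) unfolding unimodular_pair_def by blast+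
  define W where "W = four_block_mat (1\<^sub>m n) (0\<^sub>m n m) (0\<^sub>m m n) V"
  have W: "W \<in> carrier_mat (n + m) (n + m)" unfolding W_def using c(2) by simp
  note WT = mult_carrier_mat[OF W cS(4)] and PT = mult_carrier_mat[OF P cS(4)]
  define I where "I = {i. i < length \<beta> \<and> \<beta> ! i \<le> k}"
  define J where "J = {j. j < length \<nu> \<and> \<nu> ! j \<le> k}"
  \<comment> \<open>The vector \<open>v\<close> lives in the coordinates that diagonalize
    \<open>P\<close>, so the conditions are pulled back along \<open>T'\<close>: the first
    \<open>n\<close> rows of \<open>P * T'\<close> give the upper component, and row
    \<open>n + j\<close> of \<open>W * T'\<close> gives coordinate \<open>j\<close> of
    \<open>V *\<^sub>v y\<close>.\<close>
  define R where "R = row (P * T') ` {..<n} \<union> row (W * T') ` ((+) n ` J)"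
  have finJ: "finite J" unfolding J_def by simp
  have "card R \<le> card (row (P * T') ` {..<n}) + card (row (W * T') ` ((+) n ` J))"
    unfolding R_def by (rule card_Un_le)
  also have "card (row (P * T') ` {..<n}) \<le> n" using card_image_le[of "{..<n}" "row (P * T')"] by simp
  also have "card (row (W * T') ` ((+) n ` J)) \<le> card J"
    unfolding image_image by (rule card_image_le[OF finJ])
  also have "n + card J < card I" using neg unfolding I_def J_def count_le_card by simp
  finally have "card R < card I" by simp
  moreover have "finite R" unfolding R_def using finJ by simp
  moreover have "R \<subseteq> carrier_vec (n + m)" unfolding R_def using cS(4) by (auto intro!: carrier_vecI)
  moreover have "I \<subseteq> {..<n + m}" unfolding I_def using len_P by auto
  ultimately obtain v where v: "v \<in> carrier_vec (n + m)" "\<forall>r\<in>R. r \<bullet> v = 0" "vec_ge 0 v"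
      "\<exists>i\<in>I. \<not> vge 1 (v $ i)"
    using exists_primitive_orthogonal_vec[of R "n + m" I] by blast
  note Tv = mult_mat_vec_carrier[OF cS(4) v(1)] mat_ge_0_mult_vec[OF gS(2) v(3) cS(4) v(1)]
  define x where "x = vec_first (T' *\<^sub>v v) n"
  define y where "y = vec_last (T' *\<^sub>v v) m"
  have Txy: "T' *\<^sub>v v = x @\<^sub>v y" unfolding x_def y_def using Tv(1) by simp
  have x: "x \<in> carrier_vec n" and y: "y \<in> carrier_vec m" unfolding x_def y_def by simp_all
  have ge_y: "vec_ge 0 y" using Tv(2) unfolding Txy vec_ge_append by blast
  have Px: "P *\<^sub>v (x @\<^sub>v y) = (A *\<^sub>v x + B *\<^sub>v y) @\<^sub>v (- C *\<^sub>v x + D *\<^sub>v y)"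
    unfolding P_def by (rule four_block_mat_mult_vec[OF A B uminus_carrier_mat[OF C] D x y])
  have Axc: "A *\<^sub>v x + B *\<^sub>v y \<in> carrier_vec n"
    by (rule add_carrier_vec[OF mult_mat_vec_carrier[OF A x] mult_mat_vec_carrier[OF B y]])
  have gc: "- C *\<^sub>v x + D *\<^sub>v y \<in> carrier_vec p"
    by (rule add_carrier_vec[OF mult_mat_vec_carrier[OF uminus_carrier_mat[OF C] x] mult_mat_vec_carrier[OF D y]])
  have f0: "A *\<^sub>v x + B *\<^sub>v y = 0\<^sub>v n"
  proof (rule eq_vecI)
    fix i assume "i < dim_vec (0\<^sub>v n :: 'k vec)"
    then have i: "i < n" by simp
    have "row (P * T') i \<bullet> v = 0" using v(2) i unfolding R_def by blast
    moreover have "((P * T') *\<^sub>v v) $ i = row (P * T') i \<bullet> v"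
      by (rule index_mult_mat_vec) (use i carrier_matD(1)[OF PT] in linarith)
    ultimately have "((P * T') *\<^sub>v v) $ i = 0" by argo
    then have "(P *\<^sub>v (x @\<^sub>v y)) $ i = 0" unfolding assoc_mult_mat_vec[OF P cS(4) v(1)] Txy .
    then show "(A *\<^sub>v x + B *\<^sub>v y) $ i = (0\<^sub>v n :: 'k vec) $ i"
      unfolding Px using i Axc gc by (subst (asm) index_append_vec(1)) (simp_all del: index_mult_mat_vec index_add_vec)
  qed (use B in simp)
  have Vy0: "(V *\<^sub>v y) $ j = 0" if j: "j \<in> J" for j
  proof -
    have jm: "j < m" using j len_H unfolding J_def by simp
    have "row (W * T') (n + j) \<bullet> v = 0" using v(2) j unfolding R_def by blast
    moreover have "((W * T') *\<^sub>v v) $ (n + j) = row (W * T') (n + j) \<bullet> v"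
      by (rule index_mult_mat_vec) (use jm carrier_matD(1)[OF WT] in linarith)
    ultimately have "((W * T') *\<^sub>v v) $ (n + j) = 0" by argo
    then have "(W *\<^sub>v (x @\<^sub>v y)) $ (n + j) = 0" unfolding assoc_mult_mat_vec[OF W cS(4) v(1)] Txy .
    then show ?thesis
      unfolding W_def
        four_block_mult_vec_lower[OF one_carrier_mat zero_carrier_mat zero_carrier_mat c(2) x y jm]
      using mult_mat_vec_carrier[OF c(2) y] jm by (simp add: zero_mat_mult_vec[OF x])
  qed
  note Vy = mult_mat_vec_carrier[OF c(2) y] mat_ge_0_mult_vec[OF g(2) ge_y c(2) y]
  have "vec_ge (k + 1) (pi_diag p m \<nu> *\<^sub>v (V *\<^sub>v y))"
    by (rule vec_ge_pi_diag_mult[OF Vy]) (use Vy0 in \<open>auto simp: J_def\<close>)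
  from mat_ge_0_mult_vec[OF g(1) this c(1) mult_mat_vec_carrier[OF pi_diag_carrier Vy(1)]]
  have Hy: "vec_ge (k + 1) (H *\<^sub>v y)"
    unfolding uv(3) assoc_mult_mat_vec[OF mult_carrier_mat[OF c(1) pi_diag_carrier] c(2) y]
      assoc_mult_mat_vec[OF c(1) pi_diag_carrier Vy(1)] .
  have "Ai *\<^sub>v 0\<^sub>v n = 0\<^sub>v n" "C *\<^sub>v 0\<^sub>v n = 0\<^sub>v p"
    using Ai C by (auto intro!: eq_vecI)
  then have "H *\<^sub>v y = - C *\<^sub>v x + D *\<^sub>v y"
    using transfer_mult_vec[OF x y] gc unfolding f0 by simp
  then have Pge: "vec_ge (k + 1) (P *\<^sub>v (x @\<^sub>v y))"
    unfolding Px f0 vec_ge_append using Hy by (simp add: vec_ge_def)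
  note dv = mult_mat_vec_carrier[OF pi_diag_carrier v(1), of "n + p" \<beta>]
  have "P *\<^sub>v (x @\<^sub>v y) = S *\<^sub>v (pi_diag (n + p) (n + m) \<beta> *\<^sub>v ((T * T') *\<^sub>v v))"
    unfolding st(3) Txy[symmetric] using cS v(1) by (simp only: mat_dim_simps pi_diag_dim)
  also have "(T * T') *\<^sub>v v = v" unfolding eS using v(1) by simp
  finally have "S' *\<^sub>v (P *\<^sub>v (x @\<^sub>v y)) = (S' * S) *\<^sub>v (pi_diag (n + p) (n + m) \<beta> *\<^sub>v v)"
    using assoc_mult_mat_vec[OF cS(2,1) dv] by simp
  also have "\<dots> = pi_diag (n + p) (n + m) \<beta> *\<^sub>v v" unfolding eS by (rule one_mult_mat_vec[OF dv])
  finally have diag: "vec_ge (k + 1) (pi_diag (n + p) (n + m) \<beta> *\<^sub>v v)"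
    using mat_ge_0_mult_vec[OF gS(1) Pge cS(2)] mult_mat_vec_carrier[OF P] x y by simp
  obtain i where i: "i \<in> I" "\<not> vge 1 (v $ i)" using v(4) by blast
  then have i': "i < length \<beta>" "\<beta> ! i \<le> k" "i < n + p" "i < n + m" using len_P unfolding I_def by auto
  have "vge (k + 1) ((pi_diag (n + p) (n + m) \<beta> *\<^sub>v v) $ i)"
    using diag i'(3) unfolding vec_ge_def by simp
  then have "vge (k + 1 - \<beta> ! i) (v $ i)"
    unfolding pi_diag_mult_vec[OF v(1) i'(3)] using i' by (simp add: vge_powi_mult_iff)
  then show False using i(2) i'(2) vge_mono[of "k + 1 - \<beta> ! i" "v $ i" 1] by simp
qed

end
end
end

section \<open>Sorted lists and their counting functions\<close>

lemma count_le_append: "count_le k (xs @ ys) = count_le k xs + count_le k ys"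
  unfolding count_le_def by simp

lemma count_le_mono_bound: "j \<le> k \<Longrightarrow> count_le j xs \<le> count_le k xs"
  unfolding count_le_def by (induction xs) auto

lemma count_mset_count_le: "count (mset xs) x + count_le (x - 1) xs = count_le x xs"
  unfolding count_le_def by (induction xs) auto

text \<open>Successive differences of the counts are the multiplicities of the integers, and a
  sorted list is determined by its multiset.\<close>

lemma sorted_eqI_count_le:
  assumes "sorted xs" "sorted ys" "\<And>k. count_le k xs = count_le k ys"
  shows "xs = ys"
proof -
  have "count (mset xs) x = count (mset ys) x" for x
    using count_mset_count_le[of xs x] count_mset_count_le[of ys x] assms(3) by simp
  then have "mset xs = mset ys" by (rule multiset_eqI)
  then show ?thesis using assms(1,2) by (metis properties_for_sort)
qed

text \<open>Counts below 0 determine the negative part of \<open>\<nu>\<close>, those of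
  \<open>\<beta>\<close> its positive part, and zeros fill up the remaining length.\<close>

lemma sorted_orders_from_counts:
  fixes \<alpha> \<nu> \<beta> :: "int list"
  assumes sorted: "sorted \<alpha>" "sorted \<nu>" "sorted \<beta>"
    and nonneg: "\<forall>x\<in>set \<alpha>. 0 \<le> x" "\<forall>x\<in>set \<beta>. 0 \<le> x"
    and neg: "\<And>k. k < 0 \<Longrightarrow> count_le k \<nu> = count_le k (map uminus \<alpha>)"
    and pos: "\<And>k. 0 \<le> k \<Longrightarrow> count_le k \<beta> = n + count_le k \<nu>"
  defines "es \<equiv> filter (\<lambda>x. x \<noteq> 0) \<alpha>" and "us \<equiv> filter (\<lambda>x. x \<noteq> 0) \<beta>"
  shows "length es + length us \<le> length \<nu> \<and>
    \<nu> = map uminus (rev es) @ replicate (length \<nu> - length es - length us) 0 @ us"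
proof -
  have es0: "count_le (- 1) (map uminus \<alpha>) = length es"
    using nonneg(1) unfolding es_def count_le_def by (induction \<alpha>) auto
  have es_neg: "count_le k (map uminus (rev es)) = count_le k (map uminus \<alpha>)" if "k < 0" for k
    using that unfolding es_def count_le_def by (induction \<alpha>) (auto simp: rev_map[symmetric] rev_filter[symmetric])
  have es_pos: "count_le k (map uminus (rev es)) = length es" if "0 \<le> k" for k
  proof -
    have "filter (\<lambda>x. x \<le> k) (map uminus (rev es)) = map uminus (rev es)"
      by (rule filter_True) (use nonneg(1) that in \<open>force simp: es_def\<close>)
    then show ?thesis unfolding count_le_def by simp
  qed
  have us_pos: "count_le k \<beta> + length us = length \<beta> + count_le k us" if "0 \<le> k" for k
    using that unfolding us_def count_le_def by (induction \<beta>) auto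
  have us_neg: "count_le k us = 0" if "k \<le> 0" for k
    using nonneg(2) that unfolding us_def count_le_def by (induction \<beta>) auto
  \<comment> \<open>At a bound above all orders the counts are the lengths, so \<open>pos\<close>
    gives \<open>length \<beta> = n + length \<nu>\<close>.\<close>
  define K where "K = Max (insert 0 (set \<nu> \<union> set \<beta>))"
  have K: "0 \<le> K" "\<forall>x\<in>set \<nu> \<union> set \<beta>. x \<le> K" unfolding K_def by simp_all
  have "count_le K \<nu> = length \<nu>" "count_le K \<beta> = length \<beta>"
    using K(2) unfolding count_le_def by (simp_all add: filter_id_conv)
  then have len: "length \<beta> = n + length \<nu>" using pos[OF K(1)] by simp
  \<comment> \<open>There are \<open>length es\<close> entries of \<open>\<nu>\<close> up to -1 and
    \<open>length \<nu> - length us\<close> up to 0; the difference is the number of zeros.\<close>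
  have le: "length es + length us \<le> length \<nu>"
    using count_le_mono_bound[of "- 1" 0 \<nu>] neg[of "- 1"] es0 pos[of 0] us_pos[of 0] us_neg[of 0] len
    by simp
  define z where "z = length \<nu> - length es - length us"
  have zeros: "count_le k (replicate z 0) = (if 0 \<le> k then z else 0)" for k
    unfolding count_le_def by (induction z) auto
  have "\<nu> = map uminus (rev es) @ replicate z 0 @ us"
  proof (rule sorted_eqI_count_le[OF sorted(2)])
    have "sorted (map uminus (rev es))"
    proof -
      have "sorted es" unfolding es_def using sorted(1) by (rule sorted_wrt_filter)
      then show ?thesis by (simp add: sorted_wrt_map sorted_wrt_rev)
    qed
    moreover have "sorted us" unfolding us_def using sorted(3) by (rule sorted_wrt_filter)
    moreover have "\<forall>x\<in>set es. 0 \<le> x" "\<forall>x\<in>set us. 0 \<le> x" unfolding es_def us_def using nonneg by auto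
    ultimately show "sorted (map uminus (rev es) @ replicate z 0 @ us)"
      by (force simp: sorted_append)
    fix k
    show "count_le k \<nu> = count_le k (map uminus (rev es) @ replicate z 0 @ us)"
    proof (cases "k < 0")
      case True
      then show ?thesis using neg[OF True] es_neg[OF True] us_neg[of k] zeros[of k]
        by (simp add: count_le_append)
    next
      case False
      then show ?thesis using pos[of k] es_pos[of k] us_pos[of k] zeros[of k] le len
        unfolding z_def by (simp add: count_le_append)
    qed
  qed
  then show ?thesis using le unfolding z_def by blast
qed

section \<open>The local rings at a finite point and at infinity\<close>

lemma not_has_pole_at_iff:
  "\<not> has_pole_at f x \<longleftrightarrow> (\<exists>a b. f = to_fract a / to_fract b \<and> poly b x \<noteq> 0)"
  unfolding has_pole_at_def takes_value_at_def Fract_conv_to_fract by auto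

lemma not_has_pole_atI: "f = to_fract a / to_fract b \<Longrightarrow> poly b x \<noteq> 0 \<Longrightarrow> \<not> has_pole_at f x"
  unfolding not_has_pole_at_iff by blast

lemma to_fract_power: "to_fract (p ^ k) = to_fract p ^ k"
  by (induction k) simp_all

lemma poly_split_root:
  fixes a :: "'a::field poly"
  assumes "a \<noteq> 0"
  obtains i a' where "to_fract a = to_fract [:- x, 1:] powi int i * to_fract a'" "poly a' x \<noteq> 0"
proof -
  obtain a' where a: "a = [:- x, 1:] ^ order x a * a'" "\<not> [:- x, 1:] dvd a'"
    using order_decomp[OF assms] by blast
  have "to_fract a = to_fract [:- x, 1:] powi int (order x a) * to_fract a'"
    by (subst a(1)) (simp add: to_fract_power)
  moreover have "poly a' x \<noteq> 0" using a(2) by (simp add: poly_eq_0_iff_dvd)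
  ultimately show thesis by (rule that)
qed

text \<open>The localization of the polynomial ring at the prime \<open>[:- x, 1:]\<close>.
  Splitting off the root \<open>x\<close> from numerator and denominator leaves a quotient of
  polynomials that do not vanish there, which is a unit.\<close>

interpretation local_ring: dvr "{f. \<not> has_pole_at f x}" "to_fract [:- x, 1:]"
  for x :: "'a::field"
proof
  show "1 \<in> {f. \<not> has_pole_at f x}"
    using not_has_pole_atI[of 1 1 1 x] by simp
next
  fix f g assume "f \<in> {f. \<not> has_pole_at f x}" "g \<in> {f. \<not> has_pole_at f x}"
  then obtain a b c d where fg: "f = to_fract a / to_fract b" "poly b x \<noteq> 0"
      "g = to_fract c / to_fract d" "poly d x \<noteq> 0"
    by (auto simp: not_has_pole_at_iff)
  have nz: "to_fract b \<noteq> 0" "to_fract d \<noteq> 0" using fg by auto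
  have "f - g = to_fract (a * d - c * b) / to_fract (b * d)"
    unfolding fg(1,3) using nz by (simp add: diff_frac_eq)
  then have "\<not> has_pole_at (f - g) x" by (rule not_has_pole_atI) (use fg in simp)
  then show "f - g \<in> {f. \<not> has_pole_at f x}" by (rule CollectI)
  have "f * g = to_fract (a * c) / to_fract (b * d)" using fg by simp
  then have "\<not> has_pole_at (f * g) x" by (rule not_has_pole_atI) (use fg in simp)
  then show "f * g \<in> {f. \<not> has_pole_at f x}" by (rule CollectI)
next
  show "to_fract [:- x, 1:] \<in> {f. \<not> has_pole_at f x}"
    using not_has_pole_atI[of "to_fract [:- x, 1:]" _ 1 x] by simp
next
  show "inverse (to_fract [:- x, 1:]) \<notin> {f. \<not> has_pole_at f x}"
  proof
    assume "inverse (to_fract [:- x, 1:]) \<in> {f. \<not> has_pole_at f x}"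
    then obtain a b where ab: "inverse (to_fract [:- x, 1:]) = to_fract a / to_fract b" "poly b x \<noteq> 0"
      by (auto simp: not_has_pole_at_iff)
    have nz: "to_fract b \<noteq> 0" "to_fract [:- x, 1:] \<noteq> 0" using ab(2) by auto
    have "to_fract b = to_fract (a * [:- x, 1:])"
      unfolding to_fract_mult using ab(1) nz by (simp add: field_simps del: to_fract_eq_0_iff)
    then have "b = a * [:- x, 1:]" by (simp only: to_fract_eq_iff)
    then show False using ab(2) by simp
  qed
next
  fix f :: "'a rat_fun" assume "f \<noteq> 0"
  then obtain a b where f: "f = Fract a b" "b \<noteq> 0" "a \<noteq> 0"
    by (cases f rule: Fract_cases_nonzero) auto
  let ?\<pi> = "to_fract [:- x, 1:]"
  obtain i a' where a: "to_fract a = ?\<pi> powi int i * to_fract a'" "poly a' x \<noteq> 0"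
    using poly_split_root[OF f(3)] by metis
  obtain j b' where b: "to_fract b = ?\<pi> powi int j * to_fract b'" "poly b' x \<noteq> 0"
    using poly_split_root[OF f(2)] by metis
  have nz: "?\<pi> \<noteq> 0" by simp
  then have c: "?\<pi> powi int i * ?\<pi> powi (int j - int i) = ?\<pi> powi int j"
    by (subst power_int_add[symmetric]) auto
  have "f * ?\<pi> powi (int j - int i) = (?\<pi> powi int i * ?\<pi> powi (int j - int i)) * to_fract a' / to_fract b"
    unfolding f(1) Fract_conv_to_fract a(1) by simp
  also have "\<dots> = to_fract a' / to_fract b'"
    unfolding c b(1) using nz by simp
  finally have e: "f * ?\<pi> powi (int j - int i) = to_fract a' / to_fract b'" .
  show "\<exists>k. f * ?\<pi> powi k \<in> {f. \<not> has_pole_at f x} \<and> inverse (f * ?\<pi> powi k) \<in> {f. \<not> has_pole_at f x}"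
    by (rule exI[of _ "int j - int i"], unfold e)
      (use not_has_pole_atI[OF refl b(2), of a'] not_has_pole_atI[OF refl a(2), of b'] in simp)
qed

lemma proper_iff:
  "proper f \<longleftrightarrow> (\<exists>a b. f = to_fract a / to_fract b \<and> b \<noteq> 0 \<and> degree a \<le> degree b)"
  unfolding proper_def Fract_conv_to_fract ..

lemma properI: "f = to_fract a / to_fract b \<Longrightarrow> b \<noteq> 0 \<Longrightarrow> degree a \<le> degree b \<Longrightarrow> proper f"
  unfolding proper_iff by blast

interpretation ring_at_infinity: dvr "{f :: 'a::field rat_fun. proper f}" "1 / rat_var"
proof
  show "(1 :: 'a rat_fun) \<in> {f. proper f}" using properI[of 1 1 1] by simp
next
  fix f g :: "'a rat_fun" assume "f \<in> {f. proper f}" "g \<in> {f. proper f}"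
  then obtain a b c d where fg: "f = to_fract a / to_fract b" "b \<noteq> 0" "degree a \<le> degree b"
      "g = to_fract c / to_fract d" "d \<noteq> 0" "degree c \<le> degree d"
    by (auto simp: proper_iff)
  have nz: "to_fract b \<noteq> 0" "to_fract d \<noteq> 0" using fg by auto
  have bd: "degree (b * d) = degree b + degree d" using fg by (simp add: degree_mult_eq)
  have "degree (a * d) \<le> degree (b * d)" "degree (c * b) \<le> degree (b * d)" "degree (a * c) \<le> degree (b * d)"
    unfolding bd using fg by (auto intro: order_trans[OF degree_mult_le])
  note dg = this
  have "f - g = to_fract (a * d - c * b) / to_fract (b * d)"
    unfolding fg(1,4) using nz by (simp add: diff_frac_eq)
  then have "proper (f - g)" by (rule properI) (use fg degree_diff_le[OF dg(1,2)] in simp_all)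
  then show "f - g \<in> {f. proper f}" by (rule CollectI)
  have "f * g = to_fract (a * c) / to_fract (b * d)" using fg by simp
  then have "proper (f * g)" by (rule properI) (use fg dg in simp_all)
  then show "f * g \<in> {f. proper f}" by (rule CollectI)
next
  show "1 / rat_var \<in> {f :: 'a rat_fun. proper f}" using properI[of "1 / rat_var" 1 "[:0, 1:]"] by simp
next
  show "inverse (1 / rat_var) \<notin> {f :: 'a rat_fun. proper f}"
  proof
    assume "inverse (1 / rat_var) \<in> {f :: 'a rat_fun. proper f}"
    then obtain a b :: "'a poly" where ab: "inverse (1 / rat_var) = to_fract a / to_fract b" "b \<noteq> 0" "degree a \<le> degree b"
      by (auto simp: proper_iff)
    then have "to_fract a = to_fract (b * [:0, 1:])"
      unfolding to_fract_mult by (simp add: field_simps)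
    then have "a = b * [:0, 1:]" unfolding to_fract_eq_iff .
    then show False using ab(2,3) by (simp add: degree_mult_eq del: mult_pCons_right)
  qed
next
  fix f :: "'a rat_fun" assume "f \<noteq> 0"
  then obtain a b where f: "f = Fract a b" "b \<noteq> 0" "a \<noteq> 0"
    by (cases f rule: Fract_cases_nonzero) auto
  let ?v = "[:0, 1:] :: 'a poly"
  \<comment> \<open>Minus the order of \<open>f\<close> at infinity: the factor
    \<open>(1 / rat_var) powi k\<close> equalizes the degrees, which makes the quotient and its
    inverse proper. The sign of \<open>k\<close> decides whether the power of \<lambda> is put into
    the denominator or the numerator.\<close>
  define k where "k = int (degree a) - int (degree b)"
  have nz: "(rat_var :: 'a rat_fun) \<noteq> 0" "?v \<noteq> 0" by simp_all
  have deg: "degree (c * ?v ^ i) = degree c + i" if "c \<noteq> 0" for c i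
    using that by (simp add: degree_mult_eq degree_power_eq del: mult_pCons_right)
  have "\<exists>c d. c \<noteq> 0 \<and> d \<noteq> 0 \<and> degree c = degree d \<and> f * (1 / rat_var) powi k = to_fract c / to_fract d"
  proof (cases "0 \<le> k")
    case True
    define i where "i = nat k"
    have "f * (1 / rat_var) powi k = to_fract a / to_fract (b * ?v ^ i)"
      unfolding f(1) Fract_conv_to_fract to_fract_mult to_fract_power using True
      by (simp add: power_int_def i_def power_divide)
    moreover have "degree a = degree (b * ?v ^ i)" unfolding deg[OF f(2)] using True by (simp add: i_def k_def)
    moreover have "b * ?v ^ i \<noteq> 0" using f(2) nz by simp
    ultimately show ?thesis using f(3) by blast
  next
    case False
    define i where "i = nat (- k)"
    have "f * (1 / rat_var) powi k = to_fract (a * ?v ^ i) / to_fract b"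
      unfolding f(1) Fract_conv_to_fract to_fract_mult to_fract_power using False
      by (simp add: power_int_def i_def inverse_eq_divide)
    moreover have "degree (a * ?v ^ i) = degree b" unfolding deg[OF f(3)] using False by (simp add: i_def k_def)
    moreover have "a * ?v ^ i \<noteq> 0" using f(3) nz by simp
    ultimately show ?thesis using f(2) by blast
  qed
  then obtain c d where cd: "c \<noteq> 0" "d \<noteq> 0" "degree c = degree d" "f * (1 / rat_var) powi k = to_fract c / to_fract d"
    by blast
  have "proper (to_fract c / to_fract d)" "proper (inverse (to_fract c / to_fract d))"
    using cd properI[of _ c d] properI[of _ d c] by simp_all
  then show "\<exists>k. f * (1 / rat_var) powi k \<in> {f. proper f} \<and> inverse (f * (1 / rat_var) powi k) \<in> {f. proper f}"
    using cd(4) by (intro exI[of _ k]) simp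
qed

section \<open>Regular and biproper matrices as unimodular matrices\<close>

context dvr begin

lemma det_mem:
  assumes M: "M \<in> carrier_mat n n" "mat_ge 0 M"
  shows "det M \<in> \<O>"
  unfolding det_def'[OF M(1)]
proof (intro sum_mem mult_mem prod_mem)
  fix p assume p: "p \<in> {p. p permutes {0..<n}}"
  show "of_int (sign p) \<in> \<O>" unfolding sign_def using one_mem uminus_mem[OF one_mem] by simp
  fix i assume i: "i \<in> {0..<n}"
  then have "p i < n" using p permutes_in_image[of p "{0..<n}" i] by simp
  then show "M $$ (i, p i) \<in> \<O>" using M i unfolding mat_ge_def vge_0_iff by simp
qed

text \<open>The adjugate formula: the cofactors are integral and the determinant is a unit.\<close>

lemma exists_unimodular_pair:
  assumes M: "M \<in> carrier_mat n n" "mat_ge 0 M" and det: "inverse (det M) \<in> \<O>" "det M \<noteq> 0"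
  shows "\<exists>N. unimodular_pair n M N"
proof -
  define N where "N = inverse (det M) \<cdot>\<^sub>m adj_mat M"
  have "cofactor M i j \<in> \<O>" if "i < n" "j < n" for i j
  proof -
    have d: "mat_delete M i j \<in> carrier_mat (n - 1) (n - 1)" by (rule mat_delete_carrier[OF M(1)])
    have "mat_ge 0 (mat_delete M i j)"
      using M that unfolding mat_ge_def mat_delete_def by auto
    then have "det (mat_delete M i j) \<in> \<O>" by (rule det_mem[OF d])
    then show ?thesis unfolding cofactor_def by (intro mult_mem power_mem uminus_mem one_mem)
  qed
  then have "mat_ge 0 N"
    unfolding N_def mat_ge_def vge_0_iff adj_mat_def using M(1) det(1) by (auto intro!: mult_mem)
  moreover have "N \<in> carrier_mat n n" unfolding N_def using adj_mat(1)[OF M(1)] by simp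
  moreover have "M * N = 1\<^sub>m n"
    unfolding N_def mult_smult_distrib[OF M(1) adj_mat(1)[OF M(1)]] adj_mat(2)[OF M(1)]
    using det(2) by (intro eq_matI) auto
  moreover have "N * M = 1\<^sub>m n"
    unfolding N_def mult_smult_assoc_mat[OF adj_mat(1)[OF M(1)] M(1)] adj_mat(3)[OF M(1)]
    using det(2) by (intro eq_matI) auto
  ultimately show ?thesis using M unfolding unimodular_pair_def by blast
qed

end

lemma regular_at_unimodular_pair:
  assumes "regular_at R x" "R \<in> carrier_mat n n"
  shows "\<exists>R'. local_ring.unimodular_pair x n R R'"
proof (rule local_ring.exists_unimodular_pair[OF assms(2)])
  show "local_ring.mat_ge x 0 R"
    using assms(1) unfolding regular_at_def local_ring.mat_ge_0_iff by auto
  obtain v a b where v: "v \<noteq> 0" "det R = Fract a b" "poly b x \<noteq> 0" "v = poly a x / poly b x"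
    using assms(1) unfolding regular_at_def takes_value_at_def by blast
  then have a: "poly a x \<noteq> 0" by auto
  show "inverse (det R) \<in> {f. \<not> has_pole_at f x}"
    using not_has_pole_atI[of "inverse (det R)" b a x] a v(2) by (simp add: Fract_conv_to_fract)
  show "det R \<noteq> 0" unfolding v(2) Fract_conv_to_fract using v(3) a by auto
qed

lemma invariant_orders_atD:
  assumes "invariant_orders_at M x ks" "M \<in> carrier_mat nr nc"
  shows "sorted ks" "length ks = mat_rank M"
    "local_ring.equivalent x nr nc M (local_ring.pi_diag x nr nc ks)"
proof -
  have dims: "dim_row M = nr" "dim_col M = nc" using assms(2) by auto
  obtain R S where RS: "R \<in> carrier_mat nr nr" "S \<in> carrier_mat nc nc" "regular_at R x" "regular_at S x"
      "M = R * local_ring.pi_diag x nr nc ks * S"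
    using assms(1) unfolding invariant_orders_at_def dims local_ring.pi_diag_def by blast
  obtain R' where R': "local_ring.unimodular_pair x nr R R'" using regular_at_unimodular_pair[OF RS(3,1)] ..
  obtain S' where S': "local_ring.unimodular_pair x nc S S'" using regular_at_unimodular_pair[OF RS(4,2)] ..
  show "local_ring.equivalent x nr nc M (local_ring.pi_diag x nr nc ks)"
    by (rule local_ring.equivalentI[OF R' S' RS(5)])
  show "sorted ks" "length ks = mat_rank M" using assms(1) unfolding invariant_orders_at_def by auto
qed

lemma biproper_iff:
  assumes "M \<in> carrier_mat n n"
  shows "biproper M \<longleftrightarrow> (\<exists>N. ring_at_infinity.unimodular_pair n M N)"
  using assms unfolding biproper_def ring_at_infinity.unimodular_pair_def ring_at_infinity.mat_ge_0_iff
    inverts_mat_def by auto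

lemma invariant_orders_at_infinity_iff:
  fixes G :: "'a::field rat_fun mat"
  assumes "G \<in> carrier_mat nr nc"
  shows "invariant_orders_at_infinity G qs \<longleftrightarrow> sorted qs \<and> length qs = mat_rank G \<and>
    ring_at_infinity.equivalent nr nc G (ring_at_infinity.pi_diag nr nc qs)"
proof -
  have dims: "dim_row G = nr" "dim_col G = nc" using assms by auto
  \<comment> \<open>The sign convention: \<lambda>^(-q) is the power q of the uniformizer, so the
    orders at infinity are exponents of \<open>1 / rat_var\<close>.\<close>
  have diag: "rect_diag nr nc (map (\<lambda>q. (rat_var :: 'a rat_fun) powi (- q)) qs) = ring_at_infinity.pi_diag nr nc qs"
  proof -
    have "(\<lambda>q. rat_var powi (- q)) = (\<lambda>q. (1 / rat_var :: 'a rat_fun) powi q)"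
      by (rule ext) (simp add: power_int_minus power_int_divide_distrib inverse_eq_divide)
    then show ?thesis unfolding ring_at_infinity.pi_diag_def by (simp only:)
  qed
  have car: "U \<in> carrier_mat k k" if "ring_at_infinity.unimodular_pair k U V" for k and U V :: "'a rat_fun mat"
    using that unfolding ring_at_infinity.unimodular_pair_def by blast
  have "(\<exists>U\<in>carrier_mat nr nr. \<exists>V\<in>carrier_mat nc nc. biproper U \<and> biproper V \<and> G = U * N * V)
      \<longleftrightarrow> ring_at_infinity.equivalent nr nc G N" for N
  proof
    assume "\<exists>U\<in>carrier_mat nr nr. \<exists>V\<in>carrier_mat nc nc. biproper U \<and> biproper V \<and> G = U * N * V"
    then obtain U V where UV: "U \<in> carrier_mat nr nr" "V \<in> carrier_mat nc nc" "biproper U" "biproper V"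
        "G = U * N * V" by blast
    obtain U' V' where "ring_at_infinity.unimodular_pair nr U U'" "ring_at_infinity.unimodular_pair nc V V'"
      using UV(3,4) unfolding biproper_iff[OF UV(1)] biproper_iff[OF UV(2)] by blast
    then show "ring_at_infinity.equivalent nr nc G N" using UV(5) by (rule ring_at_infinity.equivalentI)
  next
    assume "ring_at_infinity.equivalent nr nc G N"
    then obtain U U' V V' where UV: "ring_at_infinity.unimodular_pair nr U U'"
        "ring_at_infinity.unimodular_pair nc V V'" "G = U * N * V"
      unfolding ring_at_infinity.equivalent_def by blast
    have "biproper U" "biproper V" using UV(1,2) biproper_iff[OF car] by blast+
    then show "\<exists>U\<in>carrier_mat nr nr. \<exists>V\<in>carrier_mat nc nc. biproper U \<and> biproper V \<and> G = U * N * V"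
      using car[OF UV(1)] car[OF UV(2)] UV(3) by blast
  qed
  then show ?thesis unfolding invariant_orders_at_infinity_def dims diag by simp
qed

section \<open>Residues at a finite point\<close>

lemma local_ring_vge_quotient:
  assumes "poly b x \<noteq> 0" "poly a x = 0"
  shows "local_ring.vge x 1 (to_fract a / to_fract b)"
proof -
  obtain q where q: "a = [:- x, 1:] * q" using assms(2) by (auto simp: poly_eq_0_iff_dvd elim: dvdE)
  have e: "to_fract a / to_fract b * to_fract [:- x, 1:] powi - 1 = to_fract q / to_fract b"
    unfolding q to_fract_mult by (simp add: power_int_minus)
  show ?thesis
    unfolding local_ring.vge_def e by (rule CollectI) (rule not_has_pole_atI[OF refl assms(1)])
qed

lemma local_ring_vge_1_to_fract_iff: "local_ring.vge x 1 (to_fract p) \<longleftrightarrow> poly p x = 0"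
proof
  assume "poly p x = 0"
  then show "local_ring.vge x 1 (to_fract p)" using local_ring_vge_quotient[of 1 x p] by simp
next
  assume "local_ring.vge x 1 (to_fract p)"
  then obtain a b where ab: "to_fract p * to_fract [:- x, 1:] powi - 1 = to_fract a / to_fract b" "poly b x \<noteq> 0"
    unfolding local_ring.vge_def by (auto simp: not_has_pole_at_iff)
  have nz: "to_fract b \<noteq> 0" "to_fract [:- x, 1:] \<noteq> 0" using ab(2) by auto
  have "to_fract (p * b) = to_fract (a * [:- x, 1:])"
    unfolding to_fract_mult using ab(1) nz by (simp add: power_int_minus field_simps del: to_fract_eq_0_iff)
  then have "p * b = a * [:- x, 1:]" by (simp only: to_fract_eq_iff)
  then have "poly p x * poly b x = 0" by (metis poly_mult poly_eq_0_iff_dvd dvd_triv_right)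
  then show "poly p x = 0" using ab(2) by simp
qed

text \<open>The constant is the value of \<open>f\<close> at \<open>x\<close>; thus constants
  represent all residue classes.\<close>

lemma exists_residue:
  assumes "\<not> has_pole_at f x"
  shows "\<exists>c. local_ring.vge x 1 (f - to_fract [:c:])"
proof -
  obtain a b where f: "f = to_fract a / to_fract b" "poly b x \<noteq> 0"
    using assms unfolding not_has_pole_at_iff by blast
  define c where "c = poly a x / poly b x"
  have "to_fract b \<noteq> 0" using f(2) by auto
  then have "f - to_fract [:c:] = to_fract (a - [:c:] * b) / to_fract b"
    unfolding f(1) to_fract_diff to_fract_mult by (simp add: field_simps del: to_fract_eq_0_iff)
  moreover have "poly (a - [:c:] * b) x = 0" unfolding c_def using f(2) by simp
  ultimately show ?thesis using local_ring_vge_quotient[OF f(2)] by metis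
qed

interpretation to_fract_hom: comm_ring_hom "to_fract :: 'a::idom \<Rightarrow> 'a fract"
  by unfold_locales simp_all

lemma mat_ge_rat_mat: "local_ring.mat_ge x 0 (rat_mat M)"
  unfolding local_ring.mat_ge_def local_ring.vge_0_iff
  using not_has_pole_atI[of _ _ 1 x] by simp

text \<open>Modulo the uniformizer, \<open>w\<close> may be replaced by the vector of its constant
  residues, and the value at \<open>x\<close> of \<open>M\<close> times that vector is
  \<open>eval_mat M x *\<^sub>v v\<close>. This carries injectivity over the constants to the form
  that \<open>local_ring.exists_left_inverse\<close> asks for.\<close>

lemma residue_injective:
  fixes M :: "'a::field poly mat"
  assumes M: "M \<in> carrier_mat l n"
    and inj: "\<And>v. v \<in> carrier_vec n \<Longrightarrow> eval_mat M x *\<^sub>v v = 0\<^sub>v l \<Longrightarrow> v = 0\<^sub>v n"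
    and w: "w \<in> carrier_vec n" "local_ring.vec_ge x 0 w" "local_ring.vec_ge x 1 (rat_mat M *\<^sub>v w)"
  shows "local_ring.vec_ge x 1 w"
proof -
  have "\<exists>c. local_ring.vge x 1 (w $ i - to_fract [:c:])" if "i < n" for i
    using exists_residue[of "w $ i" x] w(1,2) that unfolding local_ring.vec_ge_def local_ring.vge_0_iff by simp
  then obtain c where c: "\<And>i. i < n \<Longrightarrow> local_ring.vge x 1 (w $ i - to_fract [:c i:])" by metis
  define v where "v = vec n c"
  define p where "p = vec n (\<lambda>i. [:c i:])"
  have v: "v \<in> carrier_vec n" and p: "p \<in> carrier_vec n" unfolding v_def p_def by simp_all
  have p': "map_vec to_fract p \<in> carrier_vec n" using p by simp
  have M': "rat_mat M \<in> carrier_mat l n" using M by simp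
  define u where "u = w - map_vec to_fract p"
  have u: "u \<in> carrier_vec n" "local_ring.vec_ge x 1 u"
    unfolding u_def local_ring.vec_ge_def using w(1) p c by (auto simp: p_def)
  have w_eq: "map_vec to_fract p = w - u"
    unfolding u_def using w(1) p' by (intro eq_vecI) auto
  have "local_ring.vec_ge x 1 (rat_mat M *\<^sub>v map_vec to_fract p)"
    unfolding w_eq mult_minus_distrib_mat_vec[OF M' w(1) u(1)]
    using local_ring.vec_ge_diff[OF w(3) local_ring.mat_ge_0_mult_vec[OF mat_ge_rat_mat u(2) M' u(1)]
        mult_mat_vec_carrier[OF M' w(1)] mult_mat_vec_carrier[OF M' u(1)]] .
  then have ge: "local_ring.vec_ge x 1 (map_vec to_fract (M *\<^sub>v p))"
    unfolding to_fract_hom.mult_mat_vec_hom[OF M p] .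
  have "eval_mat M x *\<^sub>v v = 0\<^sub>v l"
  proof (rule eq_vecI)
    fix i assume "i < dim_vec (0\<^sub>v l :: 'a vec)"
    then have i: "i < l" by simp
    then have "poly ((M *\<^sub>v p) $ i) x = 0"
      using ge M unfolding local_ring.vec_ge_def
      by (simp add: local_ring_vge_1_to_fract_iff del: index_mult_mat_vec)
    moreover have "poly ((M *\<^sub>v p) $ i) x = (eval_mat M x *\<^sub>v v) $ i"
      using i M unfolding eval_mat_def p_def v_def by (simp add: scalar_prod_def poly_sum mult.commute)
    ultimately show "(eval_mat M x *\<^sub>v v) $ i = 0\<^sub>v l $ i" using i by simp
  qed (use M in \<open>simp add: eval_mat_def\<close>)
  then have "v = 0\<^sub>v n" by (rule inj[OF v])
  then have "map_vec to_fract p = 0\<^sub>v n"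
    unfolding v_def p_def by (intro eq_vecI) (auto simp: vec_eq_iff)
  then have "u = w" unfolding u_def using w(1) by simp
  then show ?thesis using u(2) by simp
qed

section \<open>Substituting \<open>1/\<lambda>\<close> for \<open>\<lambda>\<close>\<close>

definition poly_at_inverse :: "'a::field poly \<Rightarrow> 'a rat_fun" where
  "poly_at_inverse p = poly (map_poly (\<lambda>c. to_fract [:c:]) p) (1 / rat_var)"

interpretation const_hom: comm_ring_hom "\<lambda>c :: 'a::field. to_fract [:c:]"
  by unfold_locales (simp_all add: one_pCons[symmetric] flip: to_fract_add to_fract_mult)

interpretation map_const_hom: map_poly_comm_ring_hom "\<lambda>c :: 'a::field. to_fract [:c:]" ..

lemma poly_at_inverse_hom:
  "poly_at_inverse (p + q) = poly_at_inverse p + poly_at_inverse q"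
  "poly_at_inverse (p * q) = poly_at_inverse p * poly_at_inverse q"
  "poly_at_inverse 0 = 0" "poly_at_inverse 1 = 1"
  unfolding poly_at_inverse_def
  by (simp_all add: map_const_hom.hom_add map_const_hom.hom_mult)

lemma coeff_rev_poly: "coeff (rev_poly g p) k = (if k \<le> g then coeff p (g - k) else 0)"
proof -
  have "coeff (rev_poly g p) k = (\<Sum>j\<le>g. if j = g - k then (if k \<le> g then coeff p j else 0) else 0)"
    unfolding rev_poly_def coeff_sum coeff_monom by (intro sum.cong) auto
  then show ?thesis by simp
qed

lemma degree_rev_poly: "degree (rev_poly g p) \<le> g"
  by (rule degree_le) (simp add: coeff_rev_poly)

lemma rev_poly_rev_poly: "degree p \<le> g \<Longrightarrow> rev_poly g (rev_poly g p) = p"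
  by (rule poly_eqI) (auto simp: coeff_rev_poly coeff_eq_0)

lemma to_fract_rev_poly_at_inverse:
  "degree p \<le> g \<Longrightarrow> to_fract (rev_poly g p) = rat_var ^ g * poly_at_inverse p"
  unfolding poly_at_inverse_def by (rule to_fract_rev_poly)

text \<open>Reversal with bound \<open>degree p\<close> can be undone, so the substitution loses
  nothing; denominators stay nonzero and it extends to fractions.\<close>

lemma poly_at_inverse_eq_0_iff: "poly_at_inverse p = 0 \<longleftrightarrow> p = 0"
proof
  assume "poly_at_inverse p = 0"
  then have "rev_poly (degree p) p = 0"
    using to_fract_rev_poly_at_inverse[of p "degree p"] by simp
  then show "p = 0" using rev_poly_rev_poly[of p "degree p"] by (simp add: rev_poly_def)
qed (simp add: poly_at_inverse_hom)

text \<open>The substitution of 1/\<lambda> for \<lambda> on rational functions, through a chosen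
  quotient; \<open>at_inverse_quotient\<close> shows that the choice does not matter.\<close>

definition at_inverse :: "'a::field rat_fun \<Rightarrow> 'a rat_fun" where
  "at_inverse f = (SOME y. \<exists>a b. b \<noteq> 0 \<and> f = to_fract a / to_fract b \<and> y = poly_at_inverse a / poly_at_inverse b)"

lemma at_inverse_quotient:
  assumes "b \<noteq> 0"
  shows "at_inverse (to_fract a / to_fract b) = poly_at_inverse a / poly_at_inverse b"
proof -
  let ?f = "to_fract a / to_fract b"
  have "\<exists>a' b'. b' \<noteq> 0 \<and> ?f = to_fract a' / to_fract b' \<and> at_inverse ?f = poly_at_inverse a' / poly_at_inverse b'"
    unfolding at_inverse_def by (rule someI_ex) (use assms in blast)
  then obtain a' b' where 1: "b' \<noteq> 0" "?f = to_fract a' / to_fract b'"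
      "at_inverse ?f = poly_at_inverse a' / poly_at_inverse b'" by blast
  have "to_fract (a * b') = to_fract (a' * b)"
    unfolding to_fract_mult using 1(1,2) assms by (simp add: field_simps)
  then have "a * b' = a' * b" by (simp only: to_fract_eq_iff)
  then have "poly_at_inverse a * poly_at_inverse b' = poly_at_inverse a' * poly_at_inverse b"
    by (simp only: poly_at_inverse_hom(2)[symmetric])
  moreover have "poly_at_inverse b \<noteq> 0" "poly_at_inverse b' \<noteq> 0"
    using assms 1(1) unfolding poly_at_inverse_eq_0_iff by simp_all
  ultimately show ?thesis unfolding 1(3) by (simp add: field_simps)
qed

lemma at_inverse_to_fract: "at_inverse (to_fract p) = poly_at_inverse p"
  using at_inverse_quotient[of 1 p] by (simp add: poly_at_inverse_hom)

lemma rat_fun_cases: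
  obtains a b where "f = to_fract a / to_fract b" "b \<noteq> 0"
  by (cases f) (simp add: Fract_conv_to_fract)

interpretation at_inverse_hom: field_hom "at_inverse :: 'a::field rat_fun \<Rightarrow> 'a rat_fun"
proof
  show "at_inverse (0 :: 'a rat_fun) = 0" "at_inverse (1 :: 'a rat_fun) = 1"
    using at_inverse_to_fract[of 0] at_inverse_to_fract[of 1] by (simp_all add: poly_at_inverse_hom)
next
  fix f g :: "'a rat_fun"
  obtain a b where f: "f = to_fract a / to_fract b" "b \<noteq> 0" by (rule rat_fun_cases)
  obtain c d where g: "g = to_fract c / to_fract d" "d \<noteq> 0" by (rule rat_fun_cases)
  have bd: "b * d \<noteq> 0" using f g by simp
  have nz: "poly_at_inverse b \<noteq> 0" "poly_at_inverse d \<noteq> 0"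
    using f g unfolding poly_at_inverse_eq_0_iff by simp_all
  have nz': "to_fract b \<noteq> 0" "to_fract d \<noteq> 0" using f g by simp_all
  have "f + g = to_fract (a * d + c * b) / to_fract (b * d)"
    unfolding f(1) g(1) using nz' by (simp add: add_frac_eq)
  then have "at_inverse (f + g) = poly_at_inverse (a * d + c * b) / poly_at_inverse (b * d)"
    using at_inverse_quotient[OF bd] by (simp only:)
  then show "at_inverse (f + g) = at_inverse f + at_inverse g"
    unfolding f(1) g(1) at_inverse_quotient[OF f(2)] at_inverse_quotient[OF g(2)]
    using nz by (simp add: poly_at_inverse_hom add_frac_eq)
  have "f * g = to_fract (a * c) / to_fract (b * d)" unfolding f(1) g(1) by simp
  then have "at_inverse (f * g) = poly_at_inverse (a * c) / poly_at_inverse (b * d)"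
    using at_inverse_quotient[OF bd] by (simp only:)
  then show "at_inverse (f * g) = at_inverse f * at_inverse g"
    unfolding f(1) g(1) at_inverse_quotient[OF f(2)] at_inverse_quotient[OF g(2)]
    by (simp add: poly_at_inverse_hom)
qed

lemma proper_at_inverse:
  assumes "\<not> has_pole_at f 0"
  shows "proper (at_inverse f)"
proof -
  obtain a b where f: "f = to_fract a / to_fract b" "poly b 0 \<noteq> 0"
    using assms unfolding not_has_pole_at_iff by blast
  then have b: "b \<noteq> 0" by auto
  define g where "g = max (degree a) (degree b)"
  have "at_inverse f = (rat_var ^ g * poly_at_inverse a) / (rat_var ^ g * poly_at_inverse b)"
    unfolding f(1) at_inverse_quotient[OF b] by simp
  also have "\<dots> = to_fract (rev_poly g a) / to_fract (rev_poly g b)"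
    by (subst (1 2) to_fract_rev_poly_at_inverse) (simp_all add: g_def)
  finally have e: "at_inverse f = to_fract (rev_poly g a) / to_fract (rev_poly g b)" .
  \<comment> \<open>The coefficient of \<lambda>^g in the reversed denominator is the value of
    \<open>b\<close> at 0, so the denominator has degree exactly \<open>g\<close>, which bounds the
    numerator.\<close>
  have c: "coeff (rev_poly g b) g \<noteq> 0" using f(2) by (simp add: coeff_rev_poly poly_0_coeff_0)
  then have "g \<le> degree (rev_poly g b)" by (rule le_degree)
  then show ?thesis using properI[OF e] c degree_rev_poly[of g a] by fastforce
qed

text \<open>Functions without a pole at 0 become proper and the uniformizer \<lambda> becomes
  \<open>1 / rat_var\<close>, so the factors remain unimodular and the exponents do not
  change.\<close>

lemma equivalent_at_inverse:
  fixes M :: "'a::field rat_fun mat"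
  assumes "local_ring.equivalent 0 nr nc M (local_ring.pi_diag 0 nr nc ks)"
  shows "ring_at_infinity.equivalent nr nc (map_mat at_inverse M) (ring_at_infinity.pi_diag nr nc ks)"
proof -
  have unim: "ring_at_infinity.unimodular_pair n (map_mat at_inverse U) (map_mat at_inverse U')"
    if "local_ring.unimodular_pair 0 n U U'" for n and U U' :: "'a rat_fun mat"
  proof -
    have ge: "ring_at_infinity.mat_ge 0 (map_mat at_inverse N)" if "local_ring.mat_ge 0 0 N" for N :: "'a rat_fun mat"
      using that
      unfolding ring_at_infinity.mat_ge_def local_ring.mat_ge_def local_ring.vge_0_iff ring_at_infinity.vge_0_iff
      by (auto intro!: proper_at_inverse)
    have U: "U \<in> carrier_mat n n" "U' \<in> carrier_mat n n" "U * U' = 1\<^sub>m n" "U' * U = 1\<^sub>m n"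
        "local_ring.mat_ge 0 0 U" "local_ring.mat_ge 0 0 U'"
      using that unfolding local_ring.unimodular_pair_def by blast+
    then show ?thesis
      unfolding ring_at_infinity.unimodular_pair_def
      by (simp add: ge at_inverse_hom.mat_hom_mult[symmetric] at_inverse_hom.mat_hom_one)
  qed
  obtain U U' V V' where uv: "local_ring.unimodular_pair 0 nr U U'" "local_ring.unimodular_pair 0 nc V V'"
      "M = U * local_ring.pi_diag 0 nr nc ks * V"
    using assms unfolding local_ring.equivalent_def by blast
  have c: "U \<in> carrier_mat nr nr" "V \<in> carrier_mat nc nc"
    using uv(1,2) unfolding local_ring.unimodular_pair_def by blast+
  have var: "at_inverse rat_var = (1 / rat_var :: 'a rat_fun)"
    unfolding at_inverse_to_fract poly_at_inverse_def by (simp add: map_poly_pCons)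
  have powi: "at_inverse (rat_var powi k) = (1 / rat_var :: 'a rat_fun) powi k" for k
    unfolding power_int_def using var
    by (simp add: at_inverse_hom.hom_power at_inverse_hom.hom_inverse)
  have "map_mat at_inverse (local_ring.pi_diag (0::'a) nr nc ks) = ring_at_infinity.pi_diag nr nc ks"
    unfolding local_ring.pi_diag_def ring_at_infinity.pi_diag_def rect_diag_def
    by (rule eq_matI) (auto simp: powi)
  then have "map_mat at_inverse M =
      map_mat at_inverse U * ring_at_infinity.pi_diag nr nc ks * map_mat at_inverse V"
    unfolding uv(3) at_inverse_hom.mat_hom_mult[OF mult_carrier_mat[OF c(1) local_ring.pi_diag_carrier] c(2)]
      at_inverse_hom.mat_hom_mult[OF c(1) local_ring.pi_diag_carrier] by simp
  then show ?thesis
    by (rule ring_at_infinity.equivalentI[OF unim[OF uv(1)] unim[OF uv(2)]])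
qed

context dvr begin

lemma equivalent_smult:
  assumes "equivalent nr nc M (pi_diag nr nc ks)"
  shows "equivalent nr nc (\<pi> powi j \<cdot>\<^sub>m M) (pi_diag nr nc (map (\<lambda>k. k + j) ks))"
proof -
  obtain U U' V V' where uv: "unimodular_pair nr U U'" "unimodular_pair nc V V'" "M = U * pi_diag nr nc ks * V"
    using assms unfolding equivalent_def by blast
  have c: "U \<in> carrier_mat nr nr" "V \<in> carrier_mat nc nc"
    using uv(1,2) unfolding unimodular_pair_def by blast+
  have "\<pi> powi j \<cdot>\<^sub>m pi_diag nr nc ks = pi_diag nr nc (map (\<lambda>k. k + j) ks)"
    by (rule eq_matI) (auto simp: pi_diag_index powi_add mult.commute)
  then have "\<pi> powi j \<cdot>\<^sub>m M = U * pi_diag nr nc (map (\<lambda>k. k + j) ks) * V"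
    unfolding uv(3) using mult_smult_assoc_mat[OF mult_carrier_mat[OF c(1) pi_diag_carrier] c(2)]
      mult_smult_distrib[OF c(1) pi_diag_carrier] by metis
  then show ?thesis by (rule equivalentI[OF uv(1,2)])
qed

end

lemma degree_le_mat_degree:
  assumes "i < dim_row P" "j < dim_col P"
  shows "degree (P $$ (i, j)) \<le> mat_degree P"
proof (cases "P $$ (i, j) = 0")
  case False
  let ?K = "{k. map_mat (\<lambda>p. coeff p k) P \<noteq> 0\<^sub>m (dim_row P) (dim_col P)}"
  \<comment> \<open>Finiteness is what makes \<open>Max\<close> meaningful; the exponents are
    bounded by the degrees of the finitely many entries.\<close>
  have "?K \<subseteq> (\<Union>a<dim_row P. \<Union>b<dim_col P. {..degree (P $$ (a, b))})"
  proof
    fix k assume "k \<in> ?K"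
    then obtain a b where ab: "a < dim_row P" "b < dim_col P" "coeff (P $$ (a, b)) k \<noteq> 0"
      by (auto simp: mat_eq_iff)
    then have "k \<in> {..degree (P $$ (a, b))}" by (simp add: le_degree)
    then show "k \<in> (\<Union>a<dim_row P. \<Union>b<dim_col P. {..degree (P $$ (a, b))})" using ab by blast
  qed
  then have fin: "finite ?K" by (rule finite_subset) simp
  have "coeff (P $$ (i, j)) (degree (P $$ (i, j))) \<noteq> 0" using False by simp
  then have "degree (P $$ (i, j)) \<in> ?K" using assms unfolding mat_eq_iff by fastforce
  then show ?thesis unfolding mat_degree_def using fin by (intro Max_ge) auto
qed simp

lemma rat_mat_conv_rev_mat:
  assumes "\<And>i j. i < dim_row M \<Longrightarrow> j < dim_col M \<Longrightarrow> degree (M $$ (i, j)) \<le> d"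
  shows "rat_mat M = rat_var ^ d \<cdot>\<^sub>m map_mat at_inverse (rat_mat (rev_mat d M))"
proof (rule eq_matI)
  fix i j assume "i < dim_row (rat_var ^ d \<cdot>\<^sub>m map_mat at_inverse (rat_mat (rev_mat d M)))"
    "j < dim_col (rat_var ^ d \<cdot>\<^sub>m map_mat at_inverse (rat_mat (rev_mat d M)))"
  then have ij: "i < dim_row M" "j < dim_col M" by (simp_all add: rev_mat_def)
  have "to_fract (M $$ (i, j)) = rat_var ^ d * poly_at_inverse (rev_poly d (M $$ (i, j)))"
    using to_fract_rev_poly_at_inverse[OF degree_rev_poly[of d "M $$ (i, j)"]] rev_poly_rev_poly[OF assms[OF ij]] by simp
  then show "rat_mat M $$ (i, j) = (rat_var ^ d \<cdot>\<^sub>m map_mat at_inverse (rat_mat (rev_mat d M))) $$ (i, j)"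
    using ij by (simp add: rev_mat_def at_inverse_to_fract)
qed (simp_all add: rev_mat_def)

section \<open>Orders of the transfer function\<close>

theorem (in minimal_realization) transfer_orders:
  assumes sorted: "sorted \<alpha>" "sorted \<nu>" "sorted \<beta>"
    and orders_A: "equivalent n n A (pi_diag n n \<alpha>)" "length \<alpha> = n"
    and orders_H: "equivalent p m H (pi_diag p m \<nu>)" "length \<nu> \<le> p" "length \<nu> \<le> m"
    and orders_P: "equivalent (n + p) (n + m) P (pi_diag (n + p) (n + m) \<beta>)"
      "length \<beta> \<le> n + p" "length \<beta> \<le> n + m"
  defines "es \<equiv> filter (\<lambda>x. x \<noteq> 0) \<alpha>" and "us \<equiv> filter (\<lambda>x. x \<noteq> 0) \<beta>"
  shows "length es + length us \<le> length \<nu> \<and>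
    \<nu> = map uminus (rev es) @ replicate (length \<nu> - length es - length us) 0 @ us"
  unfolding es_def us_def
proof (rule sorted_orders_from_counts[OF sorted, of n])
  show "\<forall>x\<in>set \<alpha>. 0 \<le> x" using pi_diag_nonneg[OF orders_A(1) A geA] orders_A(2) by simp
  show "\<forall>x\<in>set \<beta>. 0 \<le> x" using pi_diag_nonneg[OF orders_P(1) P geP orders_P(2,3)] by blast
  show "count_le k \<nu> = count_le k (map uminus \<alpha>)" if "k < 0" for k
    by (rule count_le_negative[OF orders_A orders_H that])
  show "count_le k \<beta> = n + count_le k \<nu>" if "0 \<le> k" for k
    using count_le_system_ge[OF orders_A orders_H orders_P that]
      count_le_system_le[OF orders_A orders_H orders_P, of k] by simp
qed

text \<open>Injectivity of the stacked matrix at \<open>x\<close> lifts to a left inverse over the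
  local ring, whose two column blocks are the cofactors.\<close>

lemma exists_bezout_cofactors:
  fixes A C :: "'a::field poly mat"
  assumes A: "A \<in> carrier_mat n n" and C: "C \<in> carrier_mat p n"
    and inj: "\<And>v. v \<in> carrier_vec n \<Longrightarrow> (eval_mat A x @\<^sub>r eval_mat C x) *\<^sub>v v = 0\<^sub>v (n + p) \<Longrightarrow> v = 0\<^sub>v n"
  shows "\<exists>X\<in>carrier_mat n n. \<exists>Y\<in>carrier_mat n p. local_ring.mat_ge x 0 X \<and> local_ring.mat_ge x 0 Y \<and>
    X * rat_mat A + Y * rat_mat C = 1\<^sub>m n"
proof -
  let ?M = "A @\<^sub>r C"
  have M: "?M \<in> carrier_mat (n + p) n" using A C by simp
  have eval: "eval_mat ?M x = eval_mat A x @\<^sub>r eval_mat C x"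
    using A C unfolding eval_mat_def append_rows_def by (intro eq_matI) auto
  have "\<exists>L\<in>carrier_mat n (n + p). local_ring.mat_ge x 0 L \<and> L * rat_mat ?M = 1\<^sub>m n"
  proof (rule local_ring.exists_left_inverse[OF _ mat_ge_rat_mat])
    show "rat_mat ?M \<in> carrier_mat (n + p) n" using M by simp
    fix w assume w: "w \<in> carrier_vec n" "local_ring.vec_ge x 0 w" "local_ring.vec_ge x 1 (rat_mat ?M *\<^sub>v w)"
    show "local_ring.vec_ge x 1 w"
      by (rule residue_injective[OF M _ w]) (rule inj, simp_all only: eval)
  qed
  then obtain L where L: "L \<in> carrier_mat n (n + p)" "local_ring.mat_ge x 0 L" "L * rat_mat ?M = 1\<^sub>m n" by blast
  define X where "X = mat n n (\<lambda>(i, j). L $$ (i, j))"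
  define Y where "Y = mat n p (\<lambda>(i, j). L $$ (i, n + j))"
  have XY: "X \<in> carrier_mat n n" "Y \<in> carrier_mat n p" unfolding X_def Y_def by simp_all
  have ge: "local_ring.mat_ge x 0 X" "local_ring.mat_ge x 0 Y"
    using L(1,2) unfolding X_def Y_def local_ring.mat_ge_def by simp_all
  let ?A = "rat_mat A" and ?C = "rat_mat C"
  have AC: "?A \<in> carrier_mat n n" "?C \<in> carrier_mat p n" using A C by simp_all
  \<comment> \<open>Empty blocks complete the row of cofactors and the stacked column to four-block
    matrices, so that the block product formula applies.\<close>
  have L_eq: "L = four_block_mat X Y (0\<^sub>m 0 n) (0\<^sub>m 0 p)"
    using L(1) unfolding X_def Y_def by (intro eq_matI) auto
  have M_eq: "rat_mat ?M = four_block_mat ?A (0\<^sub>m n 0) ?C (0\<^sub>m p 0)"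
    using A C unfolding append_rows_def by (intro eq_matI) auto
  have "L * rat_mat ?M = four_block_mat (X * ?A + Y * ?C) (X * 0\<^sub>m n 0 + Y * 0\<^sub>m p 0)
      (0\<^sub>m 0 n * ?A + 0\<^sub>m 0 p * ?C) (0\<^sub>m 0 n * 0\<^sub>m n 0 + 0\<^sub>m 0 p * 0\<^sub>m p 0)"
    unfolding L_eq M_eq
    by (rule mult_four_block_mat[OF XY zero_carrier_mat zero_carrier_mat AC(1) zero_carrier_mat AC(2) zero_carrier_mat])
  then have e: "four_block_mat (X * ?A + Y * ?C) (X * 0\<^sub>m n 0 + Y * 0\<^sub>m p 0)
      (0\<^sub>m 0 n * ?A + 0\<^sub>m 0 p * ?C) (0\<^sub>m 0 n * 0\<^sub>m n 0 + 0\<^sub>m 0 p * 0\<^sub>m p 0) = 1\<^sub>m n"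
    unfolding L(3) by simp
  have S: "X * ?A + Y * ?C \<in> carrier_mat n n" by (rule add_carrier_mat[OF mult_carrier_mat[OF XY(2) AC(2)]])
  have "X * ?A + Y * ?C = 1\<^sub>m n"
  proof (rule eq_matI)
    fix i j assume "i < dim_row (1\<^sub>m n :: 'a rat_fun mat)" "j < dim_col (1\<^sub>m n :: 'a rat_fun mat)"
    then have ij: "i < n" "j < n" by simp_all
    have "(X * ?A + Y * ?C) $$ (i, j) = four_block_mat (X * ?A + Y * ?C) (X * 0\<^sub>m n 0 + Y * 0\<^sub>m p 0)
      (0\<^sub>m 0 n * ?A + 0\<^sub>m 0 p * ?C) (0\<^sub>m 0 n * 0\<^sub>m n 0 + 0\<^sub>m 0 p * 0\<^sub>m p 0) $$ (i, j)"
      using ij carrier_matD[OF S] by (subst index_mat_four_block(1)) (simp_all only: if_True trans_less_add1)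
    then show "(X * ?A + Y * ?C) $$ (i, j) = 1\<^sub>m n $$ (i, j)" unfolding e .
  qed (use carrier_matD[OF S] in simp_all)
  then show ?thesis using XY ge by blast
qed

lemma exists_inverse:
  fixes M :: "'a::field mat"
  assumes M: "M \<in> carrier_mat n n" "det M \<noteq> 0"
  obtains N where "mat_inverse M = Some N" "N \<in> carrier_mat n n" "M * N = 1\<^sub>m n" "N * M = 1\<^sub>m n"
proof -
  have "mat_inverse M \<noteq> None" using det_non_zero_imp_unit[OF M, of "()"] mat_inverse(1)[OF M(1), of "()"] by blast
  then obtain N where "mat_inverse M = Some N" by blast
  then show thesis using mat_inverse(2)[OF M(1)] that by blast
qed

text \<open>The cofactors for \<open>A\<close> and \<open>B\<close> come from the transposed
  matrices, where full row rank turns into injectivity.\<close>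

lemma minimal_at_bezout:
  fixes A B C :: "'a::field poly mat"
  assumes A: "A \<in> carrier_mat n n" and B: "B \<in> carrier_mat n m" and C: "C \<in> carrier_mat p n"
    and min: "minimal_at A B C x"
  shows "\<exists>X\<in>carrier_mat n n. \<exists>Y\<in>carrier_mat m n. local_ring.mat_ge x 0 X \<and> local_ring.mat_ge x 0 Y \<and>
      rat_mat A * X + rat_mat B * Y = 1\<^sub>m n"
    and "\<exists>X\<in>carrier_mat n n. \<exists>Y\<in>carrier_mat n p. local_ring.mat_ge x 0 X \<and> local_ring.mat_ge x 0 Y \<and>
      X * rat_mat A + Y * rat_mat C = 1\<^sub>m n"
proof -
  have ev: "eval_mat A x \<in> carrier_mat n n" "eval_mat B x \<in> carrier_mat n m" "eval_mat C x \<in> carrier_mat p n"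
    unfolding eval_mat_def using A B C by simp_all
  \<comment> \<open>An empty state matrix is minimal by convention and supplies no rank condition,
    but its vectors have no coordinates.\<close>
  have triv: "v = 0\<^sub>v n" if "v \<in> carrier_vec n" "n = 0" for v :: "'a vec"
    using that by (intro eq_vecI) auto
  show "\<exists>X\<in>carrier_mat n n. \<exists>Y\<in>carrier_mat n p. local_ring.mat_ge x 0 X \<and> local_ring.mat_ge x 0 Y \<and>
      X * rat_mat A + Y * rat_mat C = 1\<^sub>m n"
  proof (rule exists_bezout_cofactors[OF A C])
    fix v assume v: "v \<in> carrier_vec n" "(eval_mat A x @\<^sub>r eval_mat C x) *\<^sub>v v = 0\<^sub>v (n + p)"
    show "v = 0\<^sub>v n"
    proof (cases "n = 0")
      case False
      then have "mat_rank (eval_mat A x @\<^sub>r eval_mat C x) = n" using min A unfolding minimal_at_def by simp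
      then show ?thesis by (rule full_column_rank_injective[OF carrier_append_rows[OF ev(1,3)] _ v])
    qed (rule triv[OF v(1)])
  qed
  let ?N = "four_block_mat (eval_mat A x) (eval_mat B x) (0\<^sub>m 0 n) (0\<^sub>m 0 m)"
  have N: "?N \<in> carrier_mat n (n + m)"
    using four_block_carrier_mat[OF ev(1), of "0\<^sub>m 0 m" 0 m] by simp
  have "\<exists>X\<in>carrier_mat n n. \<exists>Y\<in>carrier_mat n m. local_ring.mat_ge x 0 X \<and> local_ring.mat_ge x 0 Y \<and>
      X * rat_mat A\<^sup>T + Y * rat_mat B\<^sup>T = 1\<^sub>m n"
  proof (rule exists_bezout_cofactors)
    show "A\<^sup>T \<in> carrier_mat n n" "B\<^sup>T \<in> carrier_mat m n" using A B by simp_all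
    fix v assume v: "v \<in> carrier_vec n" "(eval_mat A\<^sup>T x @\<^sub>r eval_mat B\<^sup>T x) *\<^sub>v v = 0\<^sub>v (n + m)"
    have tr: "eval_mat A\<^sup>T x @\<^sub>r eval_mat B\<^sup>T x = ?N\<^sup>T"
      using A B unfolding eval_mat_def append_rows_def by (intro eq_matI) auto
    show "v = 0\<^sub>v n"
    proof (cases "n = 0")
      case False
      then have "mat_rank ?N = n" using min A B unfolding minimal_at_def eval_mat_def by simp
      then show ?thesis by (rule full_row_rank_transpose_injective[OF N _ v[unfolded tr]])
    qed (rule triv[OF v(1)])
  qed
  then obtain X Y where XY: "X \<in> carrier_mat n n" "Y \<in> carrier_mat n m" "local_ring.mat_ge x 0 X"
      "local_ring.mat_ge x 0 Y" "X * rat_mat A\<^sup>T + Y * rat_mat B\<^sup>T = 1\<^sub>m n" by blast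
  have AB: "rat_mat A \<in> carrier_mat n n" "rat_mat B \<in> carrier_mat n m" using A B by simp_all
  have At: "rat_mat A\<^sup>T = (rat_mat A)\<^sup>T" "rat_mat B\<^sup>T = (rat_mat B)\<^sup>T" by (auto intro!: eq_matI)
  have "rat_mat A * X\<^sup>T + rat_mat B * Y\<^sup>T = (X * (rat_mat A)\<^sup>T + Y * (rat_mat B)\<^sup>T)\<^sup>T"
    using AB XY(1,2) transpose_mult[OF XY(1), of "(rat_mat A)\<^sup>T" n] transpose_mult[OF XY(2), of "(rat_mat B)\<^sup>T" n]
    by (subst transpose_add[of _ n n]) (auto intro: mult_carrier_mat[of _ n n] mult_carrier_mat[of _ n m])
  also have "\<dots> = 1\<^sub>m n" using XY(5) unfolding At by simp
  finally show "\<exists>X\<in>carrier_mat n n. \<exists>Y\<in>carrier_mat m n. local_ring.mat_ge x 0 X \<and> local_ring.mat_ge x 0 Y \<and>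
      rat_mat A * X + rat_mat B * Y = 1\<^sub>m n"
    by (intro bexI[of _ "X\<^sup>T"] bexI[of _ "Y\<^sup>T"] conjI) (use XY(1-4) in \<open>simp_all add: local_ring.mat_ge_transpose\<close>)
qed


lemma rev_poly_uminus: "rev_poly g (- p) = - rev_poly g p"
  by (rule poly_eqI) (simp add: coeff_rev_poly)

lemma rev_mat_carrier: "M \<in> carrier_mat nr nc \<Longrightarrow> rev_mat g M \<in> carrier_mat nr nc"
  unfolding rev_mat_def by simp

lemma rat_mat_rev_system_matrix:
  assumes "A \<in> carrier_mat n n" "B \<in> carrier_mat n m" "C \<in> carrier_mat p n" "D \<in> carrier_mat p m"
  shows "rat_mat (rev_mat d (system_matrix A B C D)) =
    four_block_mat (rat_mat (rev_mat d A)) (rat_mat (rev_mat d B)) (- rat_mat (rev_mat d C)) (rat_mat (rev_mat d D))"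
  using assms unfolding system_matrix_def rev_mat_def
  by (intro eq_matI) (auto simp: rev_poly_uminus)

lemma degree_block_le:
  assumes "A \<in> carrier_mat n n" "B \<in> carrier_mat n m" "C \<in> carrier_mat p n" "D \<in> carrier_mat p m"
  defines "d \<equiv> mat_degree (system_matrix A B C D)"
  shows "i < n \<Longrightarrow> j < n \<Longrightarrow> degree (A $$ (i, j)) \<le> d"
    and "i < n \<Longrightarrow> j < m \<Longrightarrow> degree (B $$ (i, j)) \<le> d"
    and "i < p \<Longrightarrow> j < n \<Longrightarrow> degree (C $$ (i, j)) \<le> d"
    and "i < p \<Longrightarrow> j < m \<Longrightarrow> degree (D $$ (i, j)) \<le> d"
proof -
  have *: "degree (system_matrix A B C D $$ (i, j)) \<le> d" if "i < n + p" "j < n + m" for i j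
    unfolding d_def by (rule degree_le_mat_degree) (use that assms in \<open>auto simp: system_matrix_def\<close>)
  show "degree (A $$ (i, j)) \<le> d" if "i < n" "j < n"
    using *[of i j] that assms by (simp add: system_matrix_def)
  show "degree (B $$ (i, j)) \<le> d" if "i < n" "j < m"
    using *[of i "n + j"] that assms by (simp add: system_matrix_def)
  show "degree (C $$ (i, j)) \<le> d" if "i < p" "j < n"
    using *[of "n + i" j] that assms by (simp add: system_matrix_def)
  show "degree (D $$ (i, j)) \<le> d" if "i < p" "j < m"
    using *[of "n + i" "n + j"] that assms by (simp add: system_matrix_def)
qed

text \<open>The inverse of \<open>c \<cdot>\<^sub>m A\<close> contributes \<open>inverse c\<close>,
  which cancels one of the two factors coming from \<open>C\<close> and \<open>B\<close>.\<close>

lemma transfer_smult: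
  fixes A B C D :: "'a::field mat"
  assumes car: "A \<in> carrier_mat n n" "B \<in> carrier_mat n m" "C \<in> carrier_mat p n" "D \<in> carrier_mat p m"
    and inv: "Ai \<in> carrier_mat n n" "A * Ai = 1\<^sub>m n"
    and c: "c \<noteq> 0" and Ci: "Ci \<in> carrier_mat n n" "Ci * (c \<cdot>\<^sub>m A) = 1\<^sub>m n"
  shows "c \<cdot>\<^sub>m D + c \<cdot>\<^sub>m C * Ci * (c \<cdot>\<^sub>m B) = c \<cdot>\<^sub>m (D + C * Ai * B)"
proof -
  have cA: "c \<cdot>\<^sub>m A \<in> carrier_mat n n" and Z: "inverse c \<cdot>\<^sub>m Ai \<in> carrier_mat n n" using car inv by simp_all
  have "c \<cdot>\<^sub>m A * (inverse c \<cdot>\<^sub>m Ai) = c \<cdot>\<^sub>m (inverse c \<cdot>\<^sub>m (A * Ai))"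
    unfolding mult_smult_assoc_mat[OF car(1) Z] mult_smult_distrib[OF car(1) inv(1)] ..
  also have "\<dots> = 1\<^sub>m n" unfolding inv(2) using c by (intro eq_matI) auto
  finally have "c \<cdot>\<^sub>m A * (inverse c \<cdot>\<^sub>m Ai) = 1\<^sub>m n" .
  then have "Ci = inverse c \<cdot>\<^sub>m Ai"
    using assoc_mult_mat[OF Ci(1) cA Z] left_mult_one_mat[OF Z] right_mult_one_mat[OF Ci(1)]
    unfolding Ci(2) by simp
  then have CAi: "c \<cdot>\<^sub>m C * Ci = C * Ai"
    using mult_smult_assoc_mat[OF car(3) Z] mult_smult_distrib[OF car(3) inv(1)] c
    by (auto intro!: eq_matI)
  note CA = mult_carrier_mat[OF car(3) inv(1)]
  show ?thesis
    unfolding CAi mult_smult_distrib[OF CA car(2)]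
    by (rule add_smult_distrib_left_mat[symmetric, OF car(4) mult_carrier_mat[OF CA car(2)]])
qed

text \<open>One sorted diagonal form settles existence and uniqueness together: its length is the
  rank, and any other such form has the same counts.\<close>

lemma invariant_orders_at_infinity_unique:
  fixes G :: "'a::field rat_fun mat"
  assumes G: "G \<in> carrier_mat nr nc"
    and orders: "ring_at_infinity.equivalent nr nc G (ring_at_infinity.pi_diag nr nc ks)"
    and ks: "sorted ks" "length ks \<le> nr" "length ks \<le> nc"
  shows "invariant_orders_at_infinity G qs \<longleftrightarrow> qs = ks"
proof -
  have rank: "mat_rank G = length ks"
    by (rule ring_at_infinity.mat_rank_equivalent_pi_diag[OF orders ks(2,3)])
  show ?thesis
  proof
    assume "invariant_orders_at_infinity G qs"
    then have qs: "sorted qs" "length qs = length ks"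
        "ring_at_infinity.equivalent nr nc G (ring_at_infinity.pi_diag nr nc qs)"
      unfolding invariant_orders_at_infinity_iff[OF G] rank by blast+
    show "qs = ks"
      by (rule sorted_eqI_count_le[OF qs(1) ks(1)], rule ring_at_infinity.count_le_unique[OF qs(3) orders G])
        (use ks qs(2) in simp_all)
  next
    assume "qs = ks"
    then show "invariant_orders_at_infinity G qs"
      unfolding invariant_orders_at_infinity_iff[OF G] rank using ks orders by blast
  qed
qed

theorem theorem3p15:
  fixes G :: "'a::alg_closed_field poly fract mat"
    and A B C D P :: "'a poly mat"
    and n p m r d :: nat
    and es us :: "int list"
  assumes "G \<in> carrier_mat p m"
    and "mat_rank G = r"
    and "system_matrix_blocks n p m A B C D"
    and "P = system_matrix A B C D"
    and "mat_degree P = d"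
    and "minimal_at_infinity A B C D"
    and "transfer_function A B C D = G"
    and "partial_multiplicities_at (rev_mat d A) 0 es"
    and "partial_multiplicities_at (rev_mat d P) 0 us"
  shows "length es + length us \<le> r \<and>
    (\<forall>qs. invariant_orders_at_infinity G qs \<longleftrightarrow>
       qs = map (\<lambda>q. q - int d)
              (map uminus (rev es) @ replicate (r - length es - length us) 0 @ us))"
proof -
  have car: "A \<in> carrier_mat n n" "B \<in> carrier_mat n m" "C \<in> carrier_mat p n" "D \<in> carrier_mat p m"
    and detA: "det A \<noteq> 0"
    using assms(3) unfolding system_matrix_blocks_def by blast+
  have d: "d = mat_degree (system_matrix A B C D)" using assms(4,5) by simp
  let ?v = "rat_var ^ d :: 'a rat_fun"
  define RA where "RA = rat_mat (rev_mat d A)"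
  define RB where "RB = rat_mat (rev_mat d B)"
  define RC where "RC = rat_mat (rev_mat d C)"
  define RD where "RD = rat_mat (rev_mat d D)"
  note rev_car = car[THEN rev_mat_carrier, of d]
  have R: "RA \<in> carrier_mat n n" "RB \<in> carrier_mat n m" "RC \<in> carrier_mat p n" "RD \<in> carrier_mat p m"
    unfolding RA_def RB_def RC_def RD_def using rev_car by simp_all
  have conv: "rat_mat A = ?v \<cdot>\<^sub>m map_mat at_inverse RA" "rat_mat B = ?v \<cdot>\<^sub>m map_mat at_inverse RB"
    "rat_mat C = ?v \<cdot>\<^sub>m map_mat at_inverse RC" "rat_mat D = ?v \<cdot>\<^sub>m map_mat at_inverse RD"
    unfolding RA_def RB_def RC_def RD_def
    by (rule rat_mat_conv_rev_mat, use degree_block_le[OF car, folded d] car in simp)+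
  \<comment> \<open>The reversed state matrix is again invertible: \<open>det (rat_mat A)\<close> is
    a power of \<lambda> times the substituted determinant of \<open>RA\<close>.\<close>
  have "det (rat_mat A) \<noteq> 0" using detA by simp
  moreover have "det (rat_mat A) = ?v ^ n * at_inverse (det RA)"
    unfolding conv(1) det_smult at_inverse_hom.hom_det using R(1) by simp
  ultimately have det: "det (rat_mat A) \<noteq> 0" "det RA \<noteq> 0" by auto
  obtain Ai where Ai: "mat_inverse RA = Some Ai" "Ai \<in> carrier_mat n n" "RA * Ai = 1\<^sub>m n" "Ai * RA = 1\<^sub>m n"
    by (rule exists_inverse[OF R(1) det(2)])
  have rA: "rat_mat A \<in> carrier_mat n n" using car by simp
  obtain Ci where Ci: "mat_inverse (rat_mat A) = Some Ci" "Ci \<in> carrier_mat n n" "rat_mat A * Ci = 1\<^sub>m n"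
      "Ci * rat_mat A = 1\<^sub>m n"
    by (rule exists_inverse[OF rA det(1)])
  define H where "H = RD + RC * Ai * RB"
  \<comment> \<open>The same \<open>d\<close> bounds the degrees in all four blocks, so
    \<open>transfer_smult\<close> applies to the substituted blocks with the scalar
    \<lambda>^d.\<close>
  have G_eq: "G = ?v \<cdot>\<^sub>m map_mat at_inverse H"
  proof -
    have "map_mat at_inverse RA * map_mat at_inverse Ai = 1\<^sub>m n"
      unfolding at_inverse_hom.mat_hom_mult[OF R(1) Ai(2), symmetric] Ai(3) by (rule at_inverse_hom.mat_hom_one)
    then have "rat_mat D + rat_mat C * Ci * rat_mat B = ?v \<cdot>\<^sub>m (map_mat at_inverse RD
        + map_mat at_inverse RC * map_mat at_inverse Ai * map_mat at_inverse RB)"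
      unfolding conv by (intro transfer_smult[of "map_mat at_inverse RA" n]) (use R Ai Ci(2,4) in \<open>simp_all add: conv(1)\<close>)
    also have "\<dots> = ?v \<cdot>\<^sub>m map_mat at_inverse H"
      unfolding H_def at_inverse_hom.mat_hom_mult[OF R(3) Ai(2), symmetric]
        at_inverse_hom.mat_hom_mult[OF mult_carrier_mat[OF R(3) Ai(2)] R(2), symmetric]
      using R by (intro arg_cong[of _ _ "\<lambda>M. ?v \<cdot>\<^sub>m M"] eq_matI) (auto simp: at_inverse_hom.hom_add)
    finally show ?thesis using assms(7) Ci(1) unfolding transfer_function_def by simp
  qed
  have min: "minimal_at (rev_mat d A) (rev_mat d B) (rev_mat d C) 0"
    using assms(6) unfolding minimal_at_infinity_def d Let_def .
  obtain X Y where XY: "X \<in> carrier_mat n n" "Y \<in> carrier_mat m n" "local_ring.mat_ge 0 0 X"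
      "local_ring.mat_ge 0 0 Y" "RA * X + RB * Y = 1\<^sub>m n"
    using minimal_at_bezout(1)[OF rev_car(1,2,3) min] unfolding RA_def RB_def by blast
  obtain X' Y' where XY': "X' \<in> carrier_mat n n" "Y' \<in> carrier_mat n p" "local_ring.mat_ge 0 0 X'"
      "local_ring.mat_ge 0 0 Y'" "X' * RA + Y' * RC = 1\<^sub>m n"
    using minimal_at_bezout(2)[OF rev_car(1,2,3) min] unfolding RA_def RC_def by blast
  interpret realization: minimal_realization "{f. \<not> has_pole_at f (0::'a)}" "to_fract [:- 0, 1:]"
    n p m RA RB RC RD Ai X Y X' Y'
    by (intro minimal_realization.intro local_ring.dvr_axioms minimal_realization_axioms.intro)
      (use R Ai XY XY' mat_ge_rat_mat in \<open>simp_all only: RA_def RB_def RC_def RD_def\<close>)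
  have H_eq: "realization.H = H" unfolding realization.H_def H_def ..
  \<comment> \<open>An invertible state matrix has \<open>n\<close> orders: \<open>\<alpha>\<close>
    includes the zeros that \<open>es\<close> omits.\<close>
  have rank_A: "mat_rank RA = n" by (rule mat_rank_left_invertible[OF R(1) Ai(2,4)])
  obtain \<alpha> where \<alpha>: "invariant_orders_at RA 0 \<alpha>" "es = filter (\<lambda>x. x \<noteq> 0) \<alpha>"
    using assms(8) unfolding partial_multiplicities_at_def RA_def by blast
  note orders_A = invariant_orders_atD[OF \<alpha>(1) R(1)]
  have P: "rat_mat (rev_mat d P) = realization.P"
    unfolding assms(4) rat_mat_rev_system_matrix[OF car] realization.P_def
    unfolding RA_def RB_def RC_def RD_def ..
  obtain \<beta> where \<beta>: "invariant_orders_at realization.P 0 \<beta>" "us = filter (\<lambda>x. x \<noteq> 0) \<beta>"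
    using assms(9) unfolding partial_multiplicities_at_def P by blast
  note orders_P = invariant_orders_atD[OF \<beta>(1) realization.P]
  \<comment> \<open>The definition of \<open>\<beta>\<close> fixes its length as the rank; the
    bounds by the dimensions are read off from a Smith form.\<close>
  have "mat_rank realization.P \<le> n + p" "mat_rank realization.P \<le> n + m"
    using local_ring.exists_orders[OF realization.P, of 0] by (elim exE conjE; simp)+
  then have len_P: "length \<beta> \<le> n + p" "length \<beta> \<le> n + m" using orders_P(2) by simp_all
  obtain \<nu> where \<nu>: "sorted \<nu>" "length \<nu> \<le> p" "length \<nu> \<le> m"
      "local_ring.equivalent (0::'a) p m realization.H (local_ring.pi_diag (0::'a) p m \<nu>)"
    using local_ring.exists_orders[OF realization.H, of 0] by (elim exE conjE)
  have main: "length es + length us \<le> length \<nu> \<and>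
      \<nu> = map uminus (rev es) @ replicate (length \<nu> - length es - length us) 0 @ us"
    unfolding \<alpha>(2) \<beta>(2)
    by (rule realization.transfer_orders[OF orders_A(1) \<nu>(1) orders_P(1) orders_A(3) _ \<nu>(4,2,3) orders_P(3) len_P])
      (use orders_A(2) rank_A in simp)
  let ?ks = "map (\<lambda>q. q - int d) \<nu>"
  have "ring_at_infinity.equivalent p m ((1 / rat_var) powi (- int d) \<cdot>\<^sub>m map_mat at_inverse H)
      (ring_at_infinity.pi_diag p m (map (\<lambda>k. k + - int d) \<nu>))"
    by (rule ring_at_infinity.equivalent_smult[OF equivalent_at_inverse[OF \<nu>(4)[unfolded H_eq]]])
  \<comment> \<open>The factor \<lambda>^d is the power -d of the uniformizer at infinity, hence the
    shift of every order by -d.\<close>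
  moreover have "(1 / rat_var) powi (- int d) = ?v"
    by (simp add: power_int_minus power_divide)
  ultimately have orders_G: "ring_at_infinity.equivalent p m G (ring_at_infinity.pi_diag p m ?ks)"
    unfolding G_eq by simp
  have sorted: "sorted ?ks" using \<nu>(1) by (simp add: sorted_wrt_map)
  have len: "length ?ks \<le> p" "length ?ks \<le> m" using \<nu>(2,3) by simp_all
  have "r = length \<nu>"
    using ring_at_infinity.mat_rank_equivalent_pi_diag[OF orders_G len] assms(2) by simp
  then show ?thesis
    using main invariant_orders_at_infinity_unique[OF assms(1) orders_G sorted len] by simp
qed

end
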